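(* Let $M$ be a manifold and consider the trivial Lie bialgebroid $(TM,T^*M)$, with the standard bracket of vector fields on $TM$ and the zero Lie algebroid structure on $T^*M$, and the corresponding Courant bracket $(X+\xi)\circ(Y+\eta)=[X,Y]+(\mathcal{L}_X\eta-i_Yd\xi)$ on $TM\oplus T^*M$. The Lie bialgebroid-Nijenhuis tensors $N:TM\oplus T^*M\to TM\oplus T^*M$ for it are precisely those of the form $$N=\begin{pmatrix}\frac{\lambda}{2}I+N_0&\Lambda\\ \Omega&\frac{\lambda}{2}I-{}^tN_0\end{pmatrix},\qquad \lambda\in\mathbb{R},$$ where $N_0$ is a Nijenhuis tensor, $(N_0,\Omega)$ is a presymplectic-Nijenhuis structure and $(N_0,\Lambda)$ is a Poisson-Nijenhuis structure.
   Context: The blocks are bundle maps $N_0:TM\to TM$, ${}^tN_0:T^*M\to T^*M$ (its dual), $\Lambda:T^*M\to TM$, $\Omega:TM\to T^*M$; skew-symmetric $\Omega$, $\Lambda$ are identified with a 2-form and a bivector field. For a $(1,1)$-tensor (bundle morphism over the identity) $N$ on $A=TM\oplus T^*M$ put $U\circ_NV=N(U)\circ V+U\circ N(V)-N(U\circ V)$ and $T_N(U,V)=N(U)\circ N(V)-N(U\circ_NV)$. The pairing on $A$ is $\langle X+\xi,Y+\eta\rangle=\langle\xi,Y\rangle+\langle\eta,X\rangle$, and $N$ is paired if $N+N^*=\lambda I$ for some $\lambda\in\mathbb{R}$, $N^*$ being the adjoint with respect to this pairing. $N$ is an outer Nijenhuis tensor for a subbundle $L$ with $Sec(L)$ closed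 under $\circ$ if $Sec(L)$ is closed under $\circ_N$ and $T_N$ vanishes on $Sec(L)\times Sec(L)$. $N$ is a Lie bialgebroid-Nijenhuis tensor if it is paired and an outer Nijenhuis tensor for both $TM$ and $T^*M$. $N_0$ is a Nijenhuis tensor if $[N_0X,N_0Y]=N_0([N_0X,Y]+[X,N_0Y]-N_0[X,Y])$ for all vector fields $X,Y$. $(N_0,\Omega)$ is a presymplectic-Nijenhuis structure if $N_0$ is a Nijenhuis tensor, $\Omega$ is a closed 2-form (no rank condition), $\Omega N_0$ is skew-symmetric and $d(\Omega N_0)=0$. For a bundle map $P:T^*M\to TM$ put $[\xi,\eta]^P=\mathcal{L}_{P\xi}\eta-i_{P\eta}d\xi$, and put $[\xi,\eta]^\Lambda_{{}^tN_0}=[{}^tN_0\xi,\eta]^\Lambda+[\xi,{}^tN_0\eta]^\Lambda-{}^tN_0[\xi,\eta]^\Lambda$. $(N_0,\Lambda)$ is a Poisson-Nijenhuis structure if $\Lambda$ is a Poisson tensor, $N_0$ is a Nijenhuis tensor, $N_0\Lambda$ is skew-symmetric (i.e. $N_0\Lambda=\Lambda\,{}^tN_0$) and $[\xi,\eta]^\Lambda_{{}^tN_0}=[\xi,\eta]^{N_0\Lambda}$ for all 1-forms $\xi,\eta$. *)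

theory Defs
  imports "HOL-Analysis.Analysis" "HOL-Library.Function_Algebras"
begin

text \<open>Tangent and cotangent vectors are real-valued functions; with the pointwise scalar
  multiplication, function types become real vector spaces.\<close>

instantiation "fun" :: (type, real_vector) real_vector
begin

definition scaleR_fun :: "real \<Rightarrow> ('a \<Rightarrow> 'b) \<Rightarrow> 'a \<Rightarrow> 'b" where
  "scaleR_fun c f = (\<lambda>x. c *\<^sub>R f x)"

instance
  by standard (simp_all add: scaleR_fun_def plus_fun_def scaleR_add_right scaleR_add_left)

end

text \<open>For finite-dimensional domains, which is the only case used below, \<open>Ck_on k S f\<close> says
  that \<open>f\<close> is of class C^k on the open set \<open>S\<close>.\<close>

fun Ck_on :: "nat \<Rightarrow> 'a::real_normed_vector set \<Rightarrow> ('a \<Rightarrow> 'b::real_normed_vector) \<Rightarrow> bool" where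
  "Ck_on 0 S f \<longleftrightarrow> continuous_on S f"
| "Ck_on (Suc k) S f \<longleftrightarrow> (\<forall>x\<in>S. f differentiable (at x)) \<and>
     (\<forall>v. Ck_on k S (\<lambda>x. frechet_derivative f (at x) v))"

definition smooth_on :: "'a::real_normed_vector set \<Rightarrow> ('a \<Rightarrow> 'b::real_normed_vector) \<Rightarrow> bool" where
  "smooth_on S f \<longleftrightarrow> (\<forall>k. Ck_on k S f)"

type_synonym ('m, 'e) chart = "'m set \<times> ('m \<Rightarrow> 'e)"

definition is_chart :: "('m::topological_space, 'e::topological_space) chart \<Rightarrow> bool" where
  "is_chart c \<longleftrightarrow> (case c of (U, \<phi>) \<Rightarrow>
     open U \<and> open (\<phi> ` U) \<and> homeomorphism U (\<phi> ` U) \<phi> (inv_into U \<phi>))"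

text \<open>The manifold is the whole type \<open>'m\<close> with its topology, and \<open>A\<close> is a smooth atlas of it.
  The model space \<open>'e\<close> is an arbitrary finite-dimensional inner product space; the class
  \<open>euclidean_space\<close> is not used because it excludes dimension 0.\<close>

definition smooth_manifold ::
    "('m::{t2_space,second_countable_topology}, 'e::real_inner) chart set \<Rightarrow> bool" where
  "smooth_manifold A \<longleftrightarrow>
     (\<exists>B :: 'e set. finite B \<and> span B = UNIV) \<and>
     (\<forall>c\<in>A. is_chart c) \<and>
     (\<Union>(U, \<phi>)\<in>A. U) = UNIV \<and>
     (\<forall>(U, \<phi>)\<in>A. \<forall>(V, \<psi>)\<in>A. smooth_on (\<phi> ` (U \<inter> V)) (\<psi> \<circ> inv_into U \<phi>))"

definition smooth_functions ::
    "('m::topological_space, 'e::real_inner) chart set \<Rightarrow> ('m \<Rightarrow> real) set" where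
  "smooth_functions A = {f. \<forall>(U, \<phi>)\<in>A. smooth_on (\<phi> ` U) (f \<circ> inv_into U \<phi>)}"

text \<open>A tangent vector at \<open>p\<close> is a directional derivative \<open>f \<mapsto> D(f \<circ> \<phi>\<inverse>)(\<phi> p) e\<close> on smooth
  functions, taken in a chart around \<open>p\<close>; a covector is a linear functional on the tangent space.
  Both are extended by 0 outside their proper domain, so that equality is equality of functions.\<close>

type_synonym 'm tangent = "('m \<Rightarrow> real) \<Rightarrow> real"
type_synonym 'm cotangent = "'m tangent \<Rightarrow> real"

definition tangent_space ::
    "('m::topological_space, 'e::real_inner) chart set \<Rightarrow> 'm \<Rightarrow> 'm tangent set" where
  "tangent_space A p = {v. \<exists>(U, \<phi>)\<in>A. p \<in> U \<and> (\<exists>e. v = (\<lambda>f.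
     if f \<in> smooth_functions A
     then frechet_derivative (f \<circ> inv_into U \<phi>) (at (\<phi> p)) e else 0))}"

definition linear_between ::
    "'u::real_vector set \<Rightarrow> 'w::real_vector set \<Rightarrow> ('u \<Rightarrow> 'w) \<Rightarrow> bool" where
  "linear_between S T h \<longleftrightarrow> (\<forall>u\<in>S. h u \<in> T) \<and>
     (\<forall>u\<in>S. \<forall>v\<in>S. h (u + v) = h u + h v) \<and> (\<forall>c. \<forall>u\<in>S. h (c *\<^sub>R u) = c *\<^sub>R h u)"

definition cotangent_space ::
    "('m::topological_space, 'e::real_inner) chart set \<Rightarrow> 'm \<Rightarrow> 'm cotangent set" where
  "cotangent_space A p = {\<xi>. linear_between (tangent_space A p) UNIV \<xi> \<and>
     (\<forall>v. v \<notin> tangent_space A p \<longrightarrow> \<xi> v = 0)}"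

definition big_space ::
    "('m::topological_space, 'e::real_inner) chart set \<Rightarrow> 'm \<Rightarrow> ('m tangent \<times> 'm cotangent) set" where
  "big_space A p = tangent_space A p \<times> cotangent_space A p"

definition vector_fields ::
    "('m::topological_space, 'e::real_inner) chart set \<Rightarrow> ('m \<Rightarrow> 'm tangent) set" where
  "vector_fields A = {X. (\<forall>p. X p \<in> tangent_space A p) \<and>
     (\<forall>f\<in>smooth_functions A. (\<lambda>p. X p f) \<in> smooth_functions A)}"

definition one_forms ::
    "('m::topological_space, 'e::real_inner) chart set \<Rightarrow> ('m \<Rightarrow> 'm cotangent) set" where
  "one_forms A = {\<xi>. (\<forall>p. \<xi> p \<in> cotangent_space A p) \<and>
     (\<forall>X\<in>vector_fields A. (\<lambda>p. \<xi> p (X p)) \<in> smooth_functions A)}"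

definition big_sections ::
    "('m::topological_space, 'e::real_inner) chart set \<Rightarrow> ('m \<Rightarrow> 'm tangent \<times> 'm cotangent) set" where
  "big_sections A = {U. (\<lambda>p. fst (U p)) \<in> vector_fields A \<and> (\<lambda>p. snd (U p)) \<in> one_forms A}"

text \<open>A bundle map over the identity between two vector bundles, each given by its fibres and its
  smooth sections: fibrewise linear, and smooth in the sense that it preserves smooth sections.\<close>

definition bundle_map ::
    "('m \<Rightarrow> 'u::real_vector set) \<Rightarrow> ('m \<Rightarrow> 'u) set \<Rightarrow>
     ('m \<Rightarrow> 'w::real_vector set) \<Rightarrow> ('m \<Rightarrow> 'w) set \<Rightarrow> ('m \<Rightarrow> 'u \<Rightarrow> 'w) \<Rightarrow> bool" where
  "bundle_map E SE F SF h \<longleftrightarrow> (\<forall>p. linear_between (E p) (F p) (h p)) \<and>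
     (\<forall>s\<in>SE. (\<lambda>p. h p (s p)) \<in> SF)"

abbreviation "map_T_T A \<equiv>
  bundle_map (tangent_space A) (vector_fields A) (tangent_space A) (vector_fields A)"
abbreviation "map_T_Tstar A \<equiv>
  bundle_map (tangent_space A) (vector_fields A) (cotangent_space A) (one_forms A)"
abbreviation "map_Tstar_T A \<equiv>
  bundle_map (cotangent_space A) (one_forms A) (tangent_space A) (vector_fields A)"
abbreviation "map_big A \<equiv>
  bundle_map (big_space A) (big_sections A) (big_space A) (big_sections A)"

definition bcomp :: "('m \<Rightarrow> 'v \<Rightarrow> 'w) \<Rightarrow> ('m \<Rightarrow> 'u \<Rightarrow> 'v) \<Rightarrow> 'm \<Rightarrow> 'u \<Rightarrow> 'w" where
  "bcomp g h = (\<lambda>p u. g p (h p u))"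

definition bapp :: "('m \<Rightarrow> 'u \<Rightarrow> 'w) \<Rightarrow> ('m \<Rightarrow> 'u) \<Rightarrow> 'm \<Rightarrow> 'w" where
  "bapp h s = (\<lambda>p. h p (s p))"

definition dual_map ::
    "('m::topological_space, 'e::real_inner) chart set \<Rightarrow> ('m \<Rightarrow> 'm tangent \<Rightarrow> 'm tangent) \<Rightarrow>
     'm \<Rightarrow> 'm cotangent \<Rightarrow> 'm cotangent" where
  "dual_map A N0 p \<xi> = (\<lambda>v. if v \<in> tangent_space A p then \<xi> (N0 p v) else 0)"

definition skew_T_Tstar ::
    "('m::topological_space, 'e::real_inner) chart set \<Rightarrow> ('m \<Rightarrow> 'm tangent \<Rightarrow> 'm cotangent) \<Rightarrow> bool" where
  "skew_T_Tstar A \<Omega> \<longleftrightarrow>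
     (\<forall>p. \<forall>v\<in>tangent_space A p. \<forall>w\<in>tangent_space A p. \<Omega> p v w = - \<Omega> p w v)"

definition skew_Tstar_T ::
    "('m::topological_space, 'e::real_inner) chart set \<Rightarrow> ('m \<Rightarrow> 'm cotangent \<Rightarrow> 'm tangent) \<Rightarrow> bool" where
  "skew_Tstar_T A P \<longleftrightarrow>
     (\<forall>p. \<forall>\<xi>\<in>cotangent_space A p. \<forall>\<eta>\<in>cotangent_space A p. \<eta> (P p \<xi>) = - \<xi> (P p \<eta>))"

definition vf_apply :: "('m \<Rightarrow> 'm tangent) \<Rightarrow> ('m \<Rightarrow> real) \<Rightarrow> 'm \<Rightarrow> real" where
  "vf_apply X f = (\<lambda>p. X p f)"

definition contract :: "('m \<Rightarrow> 'm cotangent) \<Rightarrow> ('m \<Rightarrow> 'm tangent) \<Rightarrow> 'm \<Rightarrow> real" where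
  "contract \<xi> X = (\<lambda>p. \<xi> p (X p))"

definition lie_bracket :: "('m \<Rightarrow> 'm tangent) \<Rightarrow> ('m \<Rightarrow> 'm tangent) \<Rightarrow> 'm \<Rightarrow> 'm tangent" where
  "lie_bracket X Y = (\<lambda>p f. X p (vf_apply Y f) - Y p (vf_apply X f))"

text \<open>The covectors \<open>(L_X \<eta>)\<^sub>p\<close> and \<open>(i_Y d\<xi>)\<^sub>p\<close> are evaluated on a tangent vector \<open>v\<close> by the
  usual invariant formulas, with \<open>v\<close> extended to a smooth vector field; by tensoriality the result
  does not depend on the extension.\<close>

definition extend_tangent ::
    "('m::topological_space, 'e::real_inner) chart set \<Rightarrow> 'm \<Rightarrow> 'm tangent \<Rightarrow> 'm \<Rightarrow> 'm tangent" where
  "extend_tangent A p v = (SOME Z. Z \<in> vector_fields A \<and> Z p = v)"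

definition lie_derivative ::
    "('m::topological_space, 'e::real_inner) chart set \<Rightarrow> ('m \<Rightarrow> 'm tangent) \<Rightarrow>
     ('m \<Rightarrow> 'm cotangent) \<Rightarrow> 'm \<Rightarrow> 'm cotangent" where
  "lie_derivative A X \<eta> = (\<lambda>p v. if v \<in> tangent_space A p
     then let Z = extend_tangent A p v
          in X p (contract \<eta> Z) - \<eta> p (lie_bracket X Z p)
     else 0)"

definition d1 :: "('m \<Rightarrow> 'm cotangent) \<Rightarrow> ('m \<Rightarrow> 'm tangent) \<Rightarrow> ('m \<Rightarrow> 'm tangent) \<Rightarrow> 'm \<Rightarrow> real" where
  "d1 \<xi> X Y = (\<lambda>p. X p (contract \<xi> Y) - Y p (contract \<xi> X) - \<xi> p (lie_bracket X Y p))"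

definition interior_d ::
    "('m::topological_space, 'e::real_inner) chart set \<Rightarrow> ('m \<Rightarrow> 'm tangent) \<Rightarrow>
     ('m \<Rightarrow> 'm cotangent) \<Rightarrow> 'm \<Rightarrow> 'm cotangent" where
  "interior_d A Y \<xi> = (\<lambda>p v. if v \<in> tangent_space A p
     then d1 \<xi> Y (extend_tangent A p v) p else 0)"

definition d0 ::
    "('m::topological_space, 'e::real_inner) chart set \<Rightarrow> ('m \<Rightarrow> real) \<Rightarrow> 'm \<Rightarrow> 'm cotangent" where
  "d0 A f = (\<lambda>p v. if v \<in> tangent_space A p then v f else 0)"

text \<open>\<open>d2 \<Omega>\<close> is the exterior derivative of the 2-form \<open>\<omega>(X, Y) = (\<Omega> X)(Y)\<close>.\<close>

definition d2 :: "('m \<Rightarrow> 'm tangent \<Rightarrow> 'm cotangent) \<Rightarrow> ('m \<Rightarrow> 'm tangent) \<Rightarrow>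
    ('m \<Rightarrow> 'm tangent) \<Rightarrow> ('m \<Rightarrow> 'm tangent) \<Rightarrow> 'm \<Rightarrow> real" where
  "d2 \<Omega> X Y Z = (let \<omega> = (\<lambda>V W. contract (bapp \<Omega> V) W) in
     (\<lambda>p. X p (\<omega> Y Z) - Y p (\<omega> X Z) + Z p (\<omega> X Y)
        - \<omega> (lie_bracket X Y) Z p + \<omega> (lie_bracket X Z) Y p - \<omega> (lie_bracket Y Z) X p))"

definition closed_two_form ::
    "('m::topological_space, 'e::real_inner) chart set \<Rightarrow> ('m \<Rightarrow> 'm tangent \<Rightarrow> 'm cotangent) \<Rightarrow> bool" where
  "closed_two_form A \<Omega> \<longleftrightarrow> map_T_Tstar A \<Omega> \<and> skew_T_Tstar A \<Omega> \<and>
     (\<forall>X\<in>vector_fields A. \<forall>Y\<in>vector_fields A. \<forall>Z\<in>vector_fields A. d2 \<Omega> X Y Z = 0)"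

definition nijenhuis_tensor ::
    "('m::topological_space, 'e::real_inner) chart set \<Rightarrow> ('m \<Rightarrow> 'm tangent \<Rightarrow> 'm tangent) \<Rightarrow> bool" where
  "nijenhuis_tensor A N0 \<longleftrightarrow> map_T_T A N0 \<and>
     (\<forall>X\<in>vector_fields A. \<forall>Y\<in>vector_fields A.
        lie_bracket (bapp N0 X) (bapp N0 Y) =
        bapp N0 (lie_bracket (bapp N0 X) Y + lie_bracket X (bapp N0 Y)
                 - bapp N0 (lie_bracket X Y)))"

definition presymplectic_nijenhuis ::
    "('m::topological_space, 'e::real_inner) chart set \<Rightarrow> ('m \<Rightarrow> 'm tangent \<Rightarrow> 'm tangent) \<Rightarrow>
     ('m \<Rightarrow> 'm tangent \<Rightarrow> 'm cotangent) \<Rightarrow> bool" where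
  "presymplectic_nijenhuis A N0 \<Omega> \<longleftrightarrow> nijenhuis_tensor A N0 \<and> closed_two_form A \<Omega> \<and>
     closed_two_form A (bcomp \<Omega> N0)"

definition poisson_bracket ::
    "('m::topological_space, 'e::real_inner) chart set \<Rightarrow> ('m \<Rightarrow> 'm cotangent \<Rightarrow> 'm tangent) \<Rightarrow>
     ('m \<Rightarrow> real) \<Rightarrow> ('m \<Rightarrow> real) \<Rightarrow> 'm \<Rightarrow> real" where
  "poisson_bracket A \<Lambda> f g = contract (d0 A g) (bapp \<Lambda> (d0 A f))"

definition poisson_tensor ::
    "('m::topological_space, 'e::real_inner) chart set \<Rightarrow> ('m \<Rightarrow> 'm cotangent \<Rightarrow> 'm tangent) \<Rightarrow> bool" where
  "poisson_tensor A \<Lambda> \<longleftrightarrow> map_Tstar_T A \<Lambda> \<and> skew_Tstar_T A \<Lambda> \<and>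
     (\<forall>f\<in>smooth_functions A. \<forall>g\<in>smooth_functions A. \<forall>h\<in>smooth_functions A.
        poisson_bracket A \<Lambda> f (poisson_bracket A \<Lambda> g h)
      + poisson_bracket A \<Lambda> g (poisson_bracket A \<Lambda> h f)
      + poisson_bracket A \<Lambda> h (poisson_bracket A \<Lambda> f g) = 0)"

definition form_bracket ::
    "('m::topological_space, 'e::real_inner) chart set \<Rightarrow> ('m \<Rightarrow> 'm cotangent \<Rightarrow> 'm tangent) \<Rightarrow>
     ('m \<Rightarrow> 'm cotangent) \<Rightarrow> ('m \<Rightarrow> 'm cotangent) \<Rightarrow> 'm \<Rightarrow> 'm cotangent" where
  "form_bracket A P \<xi> \<eta> = lie_derivative A (bapp P \<xi>) \<eta> - interior_d A (bapp P \<eta>) \<xi>"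

definition deformed_form_bracket ::
    "('m::topological_space, 'e::real_inner) chart set \<Rightarrow> ('m \<Rightarrow> 'm cotangent \<Rightarrow> 'm tangent) \<Rightarrow>
     ('m \<Rightarrow> 'm tangent \<Rightarrow> 'm tangent) \<Rightarrow>
     ('m \<Rightarrow> 'm cotangent) \<Rightarrow> ('m \<Rightarrow> 'm cotangent) \<Rightarrow> 'm \<Rightarrow> 'm cotangent" where
  "deformed_form_bracket A \<Lambda> N0 \<xi> \<eta> =
     form_bracket A \<Lambda> (bapp (dual_map A N0) \<xi>) \<eta>
   + form_bracket A \<Lambda> \<xi> (bapp (dual_map A N0) \<eta>)
   - bapp (dual_map A N0) (form_bracket A \<Lambda> \<xi> \<eta>)"

definition poisson_nijenhuis ::
    "('m::topological_space, 'e::real_inner) chart set \<Rightarrow> ('m \<Rightarrow> 'm tangent \<Rightarrow> 'm tangent) \<Rightarrow>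
     ('m \<Rightarrow> 'm cotangent \<Rightarrow> 'm tangent) \<Rightarrow> bool" where
  "poisson_nijenhuis A N0 \<Lambda> \<longleftrightarrow> poisson_tensor A \<Lambda> \<and> nijenhuis_tensor A N0 \<and>
     skew_Tstar_T A (bcomp N0 \<Lambda>) \<and>
     (\<forall>\<xi>\<in>one_forms A. \<forall>\<eta>\<in>one_forms A.
        deformed_form_bracket A \<Lambda> N0 \<xi> \<eta> = form_bracket A (bcomp N0 \<Lambda>) \<xi> \<eta>)"

definition courant ::
    "('m::topological_space, 'e::real_inner) chart set \<Rightarrow> ('m \<Rightarrow> 'm tangent \<times> 'm cotangent) \<Rightarrow>
     ('m \<Rightarrow> 'm tangent \<times> 'm cotangent) \<Rightarrow> 'm \<Rightarrow> 'm tangent \<times> 'm cotangent" where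
  "courant A U V =
     (let X = (\<lambda>p. fst (U p)); \<xi> = (\<lambda>p. snd (U p)); Y = (\<lambda>p. fst (V p)); \<eta> = (\<lambda>p. snd (V p))
      in (\<lambda>p. (lie_bracket X Y p, lie_derivative A X \<eta> p - interior_d A Y \<xi> p)))"

definition deformed_courant ::
    "('m::topological_space, 'e::real_inner) chart set \<Rightarrow>
     ('m \<Rightarrow> 'm tangent \<times> 'm cotangent \<Rightarrow> 'm tangent \<times> 'm cotangent) \<Rightarrow>
     ('m \<Rightarrow> 'm tangent \<times> 'm cotangent) \<Rightarrow> ('m \<Rightarrow> 'm tangent \<times> 'm cotangent) \<Rightarrow>
     'm \<Rightarrow> 'm tangent \<times> 'm cotangent" where
  "deformed_courant A N U V =
     courant A (bapp N U) V + courant A U (bapp N V) - bapp N (courant A U V)"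

definition nijenhuis_torsion ::
    "('m::topological_space, 'e::real_inner) chart set \<Rightarrow>
     ('m \<Rightarrow> 'm tangent \<times> 'm cotangent \<Rightarrow> 'm tangent \<times> 'm cotangent) \<Rightarrow>
     ('m \<Rightarrow> 'm tangent \<times> 'm cotangent) \<Rightarrow> ('m \<Rightarrow> 'm tangent \<times> 'm cotangent) \<Rightarrow>
     'm \<Rightarrow> 'm tangent \<times> 'm cotangent" where
  "nijenhuis_torsion A N U V =
     courant A (bapp N U) (bapp N V) - bapp N (deformed_courant A N U V)"

definition pairing :: "'m tangent \<times> 'm cotangent \<Rightarrow> 'm tangent \<times> 'm cotangent \<Rightarrow> real" where
  "pairing u v = snd u (fst v) + snd v (fst u)"

definition is_adjoint ::
    "('m::topological_space, 'e::real_inner) chart set \<Rightarrow>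
     ('m \<Rightarrow> 'm tangent \<times> 'm cotangent \<Rightarrow> 'm tangent \<times> 'm cotangent) \<Rightarrow>
     ('m \<Rightarrow> 'm tangent \<times> 'm cotangent \<Rightarrow> 'm tangent \<times> 'm cotangent) \<Rightarrow> bool" where
  "is_adjoint A N Nadj \<longleftrightarrow> map_big A Nadj \<and>
     (\<forall>p. \<forall>u\<in>big_space A p. \<forall>v\<in>big_space A p. pairing (N p u) v = pairing u (Nadj p v))"

definition paired ::
    "('m::topological_space, 'e::real_inner) chart set \<Rightarrow>
     ('m \<Rightarrow> 'm tangent \<times> 'm cotangent \<Rightarrow> 'm tangent \<times> 'm cotangent) \<Rightarrow> bool" where
  "paired A N \<longleftrightarrow> (\<exists>Nadj c. is_adjoint A N Nadj \<and>
     (\<forall>p. \<forall>u\<in>big_space A p. N p u + Nadj p u = c *\<^sub>R u))"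

definition sub_sections ::
    "('m::topological_space, 'e::real_inner) chart set \<Rightarrow> ('m \<Rightarrow> ('m tangent \<times> 'm cotangent) set) \<Rightarrow>
     ('m \<Rightarrow> 'm tangent \<times> 'm cotangent) set" where
  "sub_sections A L = {U \<in> big_sections A. \<forall>p. U p \<in> L p}"

definition outer_nijenhuis ::
    "('m::topological_space, 'e::real_inner) chart set \<Rightarrow>
     ('m \<Rightarrow> 'm tangent \<times> 'm cotangent \<Rightarrow> 'm tangent \<times> 'm cotangent) \<Rightarrow>
     ('m \<Rightarrow> ('m tangent \<times> 'm cotangent) set) \<Rightarrow> bool" where
  "outer_nijenhuis A N L \<longleftrightarrow>
     (\<forall>U\<in>sub_sections A L. \<forall>V\<in>sub_sections A L.
        courant A U V \<in> sub_sections A L \<and>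
        deformed_courant A N U V \<in> sub_sections A L \<and>
        nijenhuis_torsion A N U V = 0)"

definition lie_bialgebroid_nijenhuis ::
    "('m::topological_space, 'e::real_inner) chart set \<Rightarrow>
     ('m \<Rightarrow> 'm tangent \<times> 'm cotangent \<Rightarrow> 'm tangent \<times> 'm cotangent) \<Rightarrow> bool" where
  "lie_bialgebroid_nijenhuis A N \<longleftrightarrow> map_big A N \<and> paired A N \<and>
     outer_nijenhuis A N (\<lambda>p. tangent_space A p \<times> {0}) \<and>
     outer_nijenhuis A N (\<lambda>p. {0} \<times> cotangent_space A p)"

definition block_map ::
    "('m::topological_space, 'e::real_inner) chart set \<Rightarrow> real \<Rightarrow>
     ('m \<Rightarrow> 'm tangent \<Rightarrow> 'm tangent) \<Rightarrow> ('m \<Rightarrow> 'm cotangent \<Rightarrow> 'm tangent) \<Rightarrow>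
     ('m \<Rightarrow> 'm tangent \<Rightarrow> 'm cotangent) \<Rightarrow>
     'm \<Rightarrow> 'm tangent \<times> 'm cotangent \<Rightarrow> 'm tangent \<times> 'm cotangent" where
  "block_map A c N0 \<Lambda> \<Omega> = (\<lambda>p (v, \<xi>).
     ((c / 2) *\<^sub>R v + N0 p v + \<Lambda> p \<xi>, \<Omega> p v + ((c / 2) *\<^sub>R \<xi> - dual_map A N0 p \<xi>)))"

end

theory Submission
  imports Defs
begin

text \<open>Write \<open>N\<close> in blocks as \<open>N(X + \<xi>) = (\<alpha> X + \<Lambda> \<xi>) + (\<Omega> X + \<delta> \<xi>)\<close>. Being paired with constant
  \<open>c\<close> says exactly that \<open>\<Omega>\<close> and \<open>\<Lambda>\<close> are skew and \<open>\<delta> = c I - \<alpha>\<^sup>*\<close>; with \<open>\<alpha> = (c/2) I + N0\<close> this is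
  the claimed form (\<open>paired_blocks\<close>). The two outer conditions are then expanded separately.

  On vector fields, the cotangent part of the deformed bracket is
  \<open>K \<Omega> X Y = L_X \<Omega>Y - i_Y d\<Omega>X - \<Omega>[X, Y]\<close>, which is \<open>d\<Omega>\<close> contracted with \<open>X\<close> and \<open>Y\<close> when \<open>\<Omega>\<close> is
  skew (\<open>closed_defect\<close>). Once \<open>K \<Omega> = 0\<close>, the tangent part of the torsion of \<open>N\<close> is the torsion
  of \<open>\<alpha>\<close>, which is that of \<open>N0\<close>, and the cotangent part is \<open>- K (\<Omega> N0)\<close>. So the condition on \<open>TM\<close> is the Nijenhuis property
  together with \<open>K \<Omega> = 0\<close> and \<open>K (\<Omega> N0) = 0\<close> (\<open>outer_nijenhuis_tangent_iff\<close>). That \<open>\<Omega> N0\<close> is skew is a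
  consequence: adding \<open>K \<omega> X Y\<close> and \<open>K \<omega> Y X\<close> leaves \<open>d(s(X, Y))\<close> with
  \<open>s(X, Y) = \<omega>(X, Y) + \<omega>(Y, X)\<close>; replacing \<open>Y\<close> by \<open>f Y\<close> gives \<open>s(X, Y) df = 0\<close> for all functions \<open>f\<close>, hence \<open>s = 0\<close>.

  On one-forms, closedness is automatic. The tangent part of the torsion is
  \<open>[\<Lambda>\<xi>, \<Lambda>\<eta>] - \<Lambda>[\<xi>, \<eta>]\<close>, an expression that is tensorial in both arguments and equals the Jacobiator
  of the Poisson bracket on exact forms; since every covector is the value of an exact form, it
  vanishes iff \<open>\<Lambda>\<close> is Poisson (\<open>poisson_tensor_iff\<close>). The same symmetrization as above shows that
  the vanishing of the cotangent part makes \<open>N0 \<Lambda>\<close> skew, and for skew \<open>N0 \<Lambda>\<close> it is, up to sign, the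
  difference of the two brackets that a Poisson-Nijenhuis structure identifies (\<open>poisson_nijenhuis_iff\<close>).

  All of this is algebra over the ring of smooth functions. The geometry enters through the locale
  \<open>smooth_frames\<close>, whose last axiom provides for each point a cutoff function and global fields
  that commute at the point and form a frame near it, with dual functions. It yields extensions of vectors and
  covectors, tangency of the Lie bracket and the tensoriality arguments. Its proof for a manifold
  (\<open>smooth_manifold_frames\<close>) is the analytic half: closure properties of \<open>Ck_on\<close>, a flat cutoff
  function, and the symmetry of second derivatives.\<close>

section \<open>Finite-dimensional inner product spaces\<close>

text \<open>Gram-Schmidt, for a finite set in an arbitrary inner product space. The model space of the
  manifold may have dimension 0, so it is handled through such a basis.\<close>

lemma finite_orthonormal_spanning_set:
  fixes S :: "'a::real_inner set"
  assumes "finite S"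
  shows "\<exists>B. finite B \<and> pairwise orthogonal B \<and> (\<forall>b\<in>B. norm b = 1) \<and> span B = span S"
  using assms
proof (induction S)
  case empty
  then show ?case by (intro exI[of _ "{}"]) auto
next
  case (insert a S)
  then obtain B where B: "finite B" "pairwise orthogonal B" "\<forall>b\<in>B. norm b = 1" "span B = span S"
    by auto
  define r where "r = a - (\<Sum>b\<in>B. (a \<bullet> b) *\<^sub>R b)"
  have proj: "(\<Sum>b\<in>B. (a \<bullet> b) *\<^sub>R b) \<in> span B"
    by (intro span_sum span_scale span_base)
  have orth: "r \<bullet> b = 0" if "b \<in> B" for b
  proof -
    have "(\<Sum>c\<in>B. (a \<bullet> c) * (c \<bullet> b)) = (\<Sum>c\<in>B. if c = b then a \<bullet> c else 0)"
      using B(2,3) that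
      by (intro sum.cong) (auto simp: pairwise_def orthogonal_def norm_eq_1)
    also have "\<dots> = a \<bullet> b" using B(1) that by simp
    finally show ?thesis by (simp add: r_def inner_diff_left inner_sum_left)
  qed
  have span_r: "span (insert r B) = span (insert a S)"
  proof -
    have "span (insert r B) = span (insert a B)"
      using proj by (metis eq_span_insert_eq r_def diff_diff_eq2 add_diff_cancel_left' diff_add_cancel)
    also have "\<dots> = span (insert a S)"
      using B(4) by (simp add: span_insert)
    finally show ?thesis .
  qed
  show ?case
  proof (cases "r = 0")
    case True
    then have "span B = span (insert a S)" using span_r by (simp add: span_insert_0)
    with B show ?thesis by blast
  next
    case False
    define u where "u = (1 / norm r) *\<^sub>R r"
    have "span (insert u B) = span (insert r B)"
    proof
      have "u \<in> span (insert r B)" unfolding u_def by (intro span_scale span_base) simp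
      then show "span (insert u B) \<subseteq> span (insert r B)"
        by (intro span_minimal subspace_span) (auto intro: span_base)
      have "r = norm r *\<^sub>R u" using False by (simp add: u_def)
      then have "r \<in> span (insert u B)" by (metis insertI1 span_base span_scale)
      then show "span (insert r B) \<subseteq> span (insert u B)"
        by (intro span_minimal subspace_span) (auto intro: span_base)
    qed
    moreover have "pairwise orthogonal (insert u B)"
      using B(2) orth
      by (auto simp: pairwise_insert orthogonal_def u_def inner_commute)
    moreover have "norm u = 1" using False by (simp add: u_def)
    ultimately show ?thesis using B span_r by (intro exI[of _ "insert u B"]) auto
  qed
qed

text \<open>The expansion property of an orthonormal basis is all that coordinates have to provide:
  derivatives and vectors are recovered from their components.\<close>

definition parseval :: "'a::real_inner set \<Rightarrow> bool" where
  "parseval B \<longleftrightarrow> finite B \<and> (\<forall>x. x = (\<Sum>b\<in>B. (x \<bullet> b) *\<^sub>R b))"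

lemma parseval_exists:
  assumes "finite S" "span S = (UNIV :: 'a::real_inner set)"
  shows "\<exists>B::'a set. parseval B"
proof -
  obtain B :: "'a set" where B: "finite B" "pairwise orthogonal B" "\<forall>b\<in>B. norm b = 1" "span B = UNIV"
    using finite_orthonormal_spanning_set[OF assms(1)] assms(2) by auto
  have "x = (\<Sum>b\<in>B. (x \<bullet> b) *\<^sub>R b)" for x
    using B by (intro orthonormal_basis_expand[symmetric]) auto
  with B(1) show ?thesis by (auto simp: parseval_def)
qed

lemma parseval_real: "parseval {1::real}"
  by (simp add: parseval_def)

text \<open>By induction the box is a sum of a segment and a box of lower dimension, and a sum of compact
  sets is compact.\<close>

lemma compact_coordinate_box:
  fixes B :: "'a::real_normed_vector set"
  assumes "finite B"
  shows "compact {\<Sum>b\<in>B. c b *\<^sub>R b | c. \<forall>b\<in>B. \<bar>c b\<bar> \<le> (r::real)}"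
  using assms
proof (induction B)
  case empty
  then show ?case by simp
next
  case (insert a B)
  let ?K = "{\<Sum>b\<in>B. c b *\<^sub>R b | c. \<forall>b\<in>B. \<bar>c b\<bar> \<le> r}"
  have "compact ((\<lambda>t. t *\<^sub>R a) ` {-r..r})"
    by (intro compact_continuous_image continuous_intros) auto
  then have "compact {x + y | x y. x \<in> (\<lambda>t. t *\<^sub>R a) ` {-r..r} \<and> y \<in> ?K}"
    using insert.IH by (rule compact_sums)
  moreover have "{x + y | x y. x \<in> (\<lambda>t. t *\<^sub>R a) ` {-r..r} \<and> y \<in> ?K}
     = {\<Sum>b\<in>insert a B. c b *\<^sub>R b | c. \<forall>b\<in>insert a B. \<bar>c b\<bar> \<le> r}" (is "?L = ?R")
  proof
    show "?L \<subseteq> ?R"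
    proof
      fix z assume "z \<in> ?L"
      then obtain t c where z: "z = t *\<^sub>R a + (\<Sum>b\<in>B. c b *\<^sub>R b)"
          "t \<in> {-r..r}" "\<forall>b\<in>B. \<bar>c b\<bar> \<le> r" by auto
      have "(\<Sum>b\<in>B. (c(a:=t)) b *\<^sub>R b) = (\<Sum>b\<in>B. c b *\<^sub>R b)"
        using insert.hyps by (intro sum.cong) auto
      then have "z = (\<Sum>b\<in>insert a B. (c(a:=t)) b *\<^sub>R b)"
        using insert.hyps z(1) by simp
      moreover have "\<forall>b\<in>insert a B. \<bar>(c(a:=t)) b\<bar> \<le> r" using z by auto
      ultimately show "z \<in> ?R" by blast
    qed
    show "?R \<subseteq> ?L"
    proof
      fix z assume "z \<in> ?R"
      then obtain c where z: "z = (\<Sum>b\<in>insert a B. c b *\<^sub>R b)" "\<forall>b\<in>insert a B. \<bar>c b\<bar> \<le> r"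
        by auto
      have "z = c a *\<^sub>R a + (\<Sum>b\<in>B. c b *\<^sub>R b)" using insert.hyps z(1) by simp
      moreover have "c a *\<^sub>R a \<in> (\<lambda>t. t *\<^sub>R a) ` {-r..r}" using z(2) by (auto simp: abs_le_iff)
      moreover have "(\<Sum>b\<in>B. c b *\<^sub>R b) \<in> ?K" using z(2) by blast
      ultimately show "z \<in> ?L" by blast
    qed
  qed
  ultimately show ?case by simp
qed

lemma compact_cball_finite_dim:
  fixes x :: "'a::real_inner"
  assumes "parseval (B :: 'a set)"
  shows "compact (cball x r)"
proof -
  have B: "finite B" "\<And>y::'a. y = (\<Sum>b\<in>B. (y \<bullet> b) *\<^sub>R b)" using assms by (auto simp: parseval_def)
  define m where "m = Max (insert 0 (norm ` B))"
  let ?K = "{\<Sum>b\<in>B. c b *\<^sub>R b | c. \<forall>b\<in>B. \<bar>c b\<bar> \<le> r * m}"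
  have sub: "cball 0 r \<subseteq> ?K"
  proof
    fix y :: 'a assume y: "y \<in> cball 0 r"
    have "\<bar>y \<bullet> b\<bar> \<le> r * m" if "b \<in> B" for b
    proof -
      have "norm b \<le> m" using B(1) that by (simp add: m_def)
      then have "norm y * norm b \<le> r * m" 
        using y order_trans[OF norm_ge_zero[of y]] by (intro mult_mono) auto
      then show ?thesis using Cauchy_Schwarz_ineq2[of y b] by linarith
    qed
    then show "y \<in> ?K" using B(2)[of y] by (intro CollectI exI[of _ "\<lambda>b. y \<bullet> b"]) auto
  qed
  have "compact (cball 0 r \<inter> ?K)"
    by (intro closed_Int_compact closed_cball compact_coordinate_box B(1))
  then have "compact (cball (0::'a) r)" using sub by (simp add: Int_absorb2)
  then have "compact ((+) x ` cball 0 r)" by (rule compact_translation)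
  then show ?thesis by simp
qed

section \<open>Functions of class C^k\<close>

lemma Ck_on_cong:
  assumes "open S" "\<And>x. x \<in> S \<Longrightarrow> f x = g x" "Ck_on k S f"
  shows "Ck_on k S g"
  using assms
proof (induction k arbitrary: f g)
  case 0
  then show ?case using continuous_on_cong[of S S f g] by simp
next
  case (Suc k)
  have d: "f differentiable (at x)" if "x \<in> S" for x using Suc.prems(3) that by simp
  have "g differentiable (at x)" if x: "x \<in> S" for x
  proof -
    obtain D where "(f has_derivative D) (at x)" using d[OF x] unfolding differentiable_def by blast
    then have "(g has_derivative D) (at x)"
      by (rule has_derivative_transform_within_open[OF _ Suc.prems(1) x Suc.prems(2)])
    then show ?thesis by (auto simp: differentiable_def)
  qed
  moreover have "Ck_on k S (\<lambda>x. frechet_derivative g (at x) v)" for v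
  proof (rule Suc.IH[OF Suc.prems(1)])
    show "Ck_on k S (\<lambda>x. frechet_derivative f (at x) v)" using Suc.prems by simp
    show "frechet_derivative f (at x) v = frechet_derivative g (at x) v" if "x \<in> S" for x
      using frechet_derivative_transform_within_open[OF d[OF that] Suc.prems(1) that Suc.prems(2)]
      by simp
  qed
  ultimately show ?case by simp
qed

text \<open>The derivative may be exhibited in any form: this turns the recursion of \<open>Ck_on\<close> into rules
  in which the derivative is computed by the usual differentiation rules.\<close>

lemma Ck_on_SucI:
  assumes "open S" "\<And>x. x \<in> S \<Longrightarrow> (f has_derivative f' x) (at x)"
    and "\<And>v. Ck_on k S (\<lambda>x. f' x v)"
  shows "Ck_on (Suc k) S f"
proof -
  have "Ck_on k S (\<lambda>x. frechet_derivative f (at x) v)" for v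
    by (rule Ck_on_cong[OF assms(1) _ assms(3)[of v]])
      (simp add: frechet_derivative_at[OF assms(2), symmetric])
  then show ?thesis using assms(2) by (auto simp: differentiable_def)
qed

lemma Ck_on_Suc_D:
  assumes "Ck_on (Suc k) S f"
  shows "x \<in> S \<Longrightarrow> (f has_derivative frechet_derivative f (at x)) (at x)"
    and "Ck_on k S (\<lambda>x. frechet_derivative f (at x) v)"
  using assms by (auto simp: frechet_derivative_works[symmetric])

lemma Ck_on_Suc_imp: "Ck_on (Suc k) S f \<Longrightarrow> Ck_on k S f"
proof (induction k arbitrary: f)
  case 0
  then show ?case
    by (auto intro!: continuous_at_imp_continuous_on differentiable_imp_continuous_within)
next
  case (Suc k)
  then show ?case by (metis Ck_on.simps(2))
qed

lemma Ck_on_subset: "Ck_on k S f \<Longrightarrow> T \<subseteq> S \<Longrightarrow> Ck_on k T f"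
  by (induction k arbitrary: f) (auto intro: continuous_on_subset)

text \<open>Smoothness is checked near each point. Extensions by zero are smooth because they are smooth
  on each of two overlapping open sets.\<close>

lemma Ck_on_local:
  assumes "\<And>x. x \<in> S \<Longrightarrow> \<exists>T. open T \<and> x \<in> T \<and> Ck_on k T f"
  shows "Ck_on k S f"
  using assms
proof (induction k arbitrary: f)
  case 0
  have "isCont f x" if "x \<in> S" for x
    using 0[OF that] by (auto simp: continuous_on_eq_continuous_at)
  then show ?case by (simp add: continuous_at_imp_continuous_on)
next
  case (Suc k)
  have "f differentiable (at x)" if "x \<in> S" for x
    using Suc.prems[OF that] by auto
  moreover have "Ck_on k S (\<lambda>x. frechet_derivative f (at x) v)" for v
    by (rule Suc.IH) (use Suc.prems in \<open>fastforce\<close>)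
  ultimately show ?case by simp
qed

lemma Ck_on_const: "Ck_on k S (\<lambda>x. c)"
  by (induction k arbitrary: c) simp_all

lemma Ck_on_bounded_linear: "bounded_linear f \<Longrightarrow> Ck_on k S f"
proof (cases k)
  case 0
  assume "bounded_linear f" then show ?thesis
    using 0 by (simp add: linear_continuous_on)
next
  case (Suc n)
  assume f: "bounded_linear f"
  have "frechet_derivative f (at x) = f" for x
    using frechet_derivative_at[OF bounded_linear_imp_has_derivative[OF f]] by simp
  then show ?thesis using f Suc bounded_linear_imp_differentiable[OF f]
    by (simp add: Ck_on_const)
qed

lemma Ck_on_bounded_linear_comp:
  assumes "bounded_linear L" "open S" "Ck_on k S f"
  shows "Ck_on k S (\<lambda>x. L (f x))"
  using assms(3)
proof (induction k arbitrary: f)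
  case 0
  then show ?case by (simp add: bounded_linear.continuous_on[OF assms(1)])
next
  case (Suc k)
  show ?case
    by (rule Ck_on_SucI[OF assms(2) bounded_linear.has_derivative[OF assms(1)
            Ck_on_Suc_D(1)[OF Suc.prems]] Suc.IH[OF Ck_on_Suc_D(2)[OF Suc.prems]]])
qed

lemma Ck_on_add:
  assumes "open S" "Ck_on k S f" "Ck_on k S g"
  shows "Ck_on k S (\<lambda>x. f x + g x)"
  using assms(2,3)
proof (induction k arbitrary: f g)
  case 0
  then show ?case by (simp add: continuous_on_add)
next
  case (Suc k)
  show ?case
    by (rule Ck_on_SucI[OF assms(1)
          has_derivative_add[OF Suc.prems[THEN Ck_on_Suc_D(1)]]
          Suc.IH[OF Suc.prems[THEN Ck_on_Suc_D(2)]]])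
qed

lemma Ck_on_sum:
  assumes "open S" "\<And>i. i \<in> I \<Longrightarrow> Ck_on k S (f i)"
  shows "Ck_on k S (\<lambda>x. \<Sum>i\<in>I. f i x)"
  using assms(2)
  by (induction I rule: infinite_finite_induct) (auto intro: Ck_on_const Ck_on_add[OF assms(1)])

lemma Ck_on_mult:
  fixes f g :: "'a::real_normed_vector \<Rightarrow> real"
  assumes "open S" "Ck_on k S f" "Ck_on k S g"
  shows "Ck_on k S (\<lambda>x. f x * g x)"
  using assms(2,3)
proof (induction k arbitrary: f g)
  case 0
  then show ?case by (simp add: continuous_on_mult)
next
  case (Suc k)
  note d = Suc.prems[THEN Ck_on_Suc_D(1)] and d' = Suc.prems[THEN Ck_on_Suc_D(2)]
  show ?case
    by (rule Ck_on_SucI[OF assms(1) has_derivative_mult[OF d]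
          Ck_on_add[OF assms(1) Suc.IH[OF Ck_on_Suc_imp[OF Suc.prems(1)] d'(2)]
            Suc.IH[OF d'(1) Ck_on_Suc_imp[OF Suc.prems(2)]]]])
qed

lemma frechet_derivative_parseval:
  assumes "parseval B" "f differentiable (at x)"
  shows "frechet_derivative f (at x) e = (\<Sum>b\<in>B. (e \<bullet> b) *\<^sub>R frechet_derivative f (at x) b)"
proof -
  interpret linear "frechet_derivative f (at x)"
    by (rule linear_frechet_derivative[OF assms(2)])
  have "frechet_derivative f (at x) e = frechet_derivative f (at x) (\<Sum>b\<in>B. (e \<bullet> b) *\<^sub>R b)"
    using assms(1) by (simp add: parseval_def)
  then show ?thesis by (simp add: sum scale)
qed

text \<open>In the coordinates \<open>B\<close> the chain rule writes a directional derivative of \<open>g \<circ> f\<close> as a sum of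
  products of components of a derivative of \<open>f\<close> with \<open>(\<partial>_b g) \<circ> f\<close>, so the induction closes with
  the rules for sums and products.\<close>

lemma Ck_on_compose:
  fixes g :: "'b::real_inner \<Rightarrow> real" and f :: "'a::real_normed_vector \<Rightarrow> 'b"
  assumes B: "parseval (B :: 'b set)" and S: "open S" and sub: "f ` S \<subseteq> T"
    and "Ck_on k S f" "Ck_on k T g"
  shows "Ck_on k S (\<lambda>x. g (f x))"
  using assms(4,5)
proof (induction k arbitrary: g)
  case 0
  then show ?case using continuous_on_compose2[of T g S f] sub by simp
next
  case (Suc k)
  have df: "f differentiable (at x)" and dg: "g differentiable (at (f x))" if "x \<in> S" for x
    using that Suc.prems sub by auto
  have D: "frechet_derivative (\<lambda>x. g (f x)) (at x) v
      = (\<Sum>b\<in>B. (frechet_derivative f (at x) v \<bullet> b) * frechet_derivative g (at (f x)) b)"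
    if "x \<in> S" for x v
  proof -
    have "frechet_derivative (\<lambda>x. g (f x)) (at x) v
        = frechet_derivative g (at (f x)) (frechet_derivative f (at x) v)"
      using frechet_derivative_compose[OF df[OF that] dg[OF that], THEN fun_cong, of v]
      unfolding o_def .
    also note frechet_derivative_parseval[OF B dg[OF that]]
    finally show ?thesis unfolding real_scaleR_def .
  qed
  have "Ck_on k S (\<lambda>x. frechet_derivative (\<lambda>x. g (f x)) (at x) v)" for v
  proof (rule Ck_on_cong[OF S D[symmetric]])
    have "Ck_on k S (\<lambda>x. frechet_derivative f (at x) v \<bullet> b)" for b
      using Suc.prems(1) by (auto intro: Ck_on_bounded_linear_comp[OF bounded_linear_inner_left S])
    moreover have "Ck_on k S (\<lambda>x. frechet_derivative g (at (f x)) b)" for b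
      by (rule Suc.IH[OF Ck_on_Suc_imp[OF Suc.prems(1)]]) (use Suc.prems(2) in simp)
    ultimately show "Ck_on k S (\<lambda>x. \<Sum>b\<in>B. (frechet_derivative f (at x) v \<bullet> b)
        * frechet_derivative g (at (f x)) b)"
      by (intro Ck_on_sum[OF S] Ck_on_mult[OF S])
  qed
  moreover have "(\<lambda>x. g (f x)) differentiable (at x)" if "x \<in> S" for x
    using differentiable_chain_at[OF df[OF that] dg[OF that]] by (simp add: o_def)
  ultimately show ?case by simp
qed

lemma smooth_on_cong: "open S \<Longrightarrow> (\<And>x. x \<in> S \<Longrightarrow> f x = g x) \<Longrightarrow> smooth_on S f \<Longrightarrow> smooth_on S g"
  unfolding smooth_on_def using Ck_on_cong by blast

lemma smooth_on_subset: "smooth_on S f \<Longrightarrow> T \<subseteq> S \<Longrightarrow> smooth_on T f"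
  unfolding smooth_on_def using Ck_on_subset by blast

lemma smooth_on_Un:
  assumes "open S" "open T" "smooth_on S f" "smooth_on T f"
  shows "smooth_on (S \<union> T) f"
  unfolding smooth_on_def
  by (intro allI Ck_on_local) (use assms in \<open>auto simp: smooth_on_def\<close>)

lemma smooth_on_const: "smooth_on S (\<lambda>x. c)"
  by (simp add: smooth_on_def Ck_on_const)

lemma smooth_on_bounded_linear: "bounded_linear f \<Longrightarrow> smooth_on S f"
  by (simp add: smooth_on_def Ck_on_bounded_linear)

lemma smooth_on_add: "open S \<Longrightarrow> smooth_on S f \<Longrightarrow> smooth_on S g \<Longrightarrow> smooth_on S (\<lambda>x. f x + g x)"
  by (simp add: smooth_on_def Ck_on_add)

lemma smooth_on_mult:
  fixes f g :: "'a::real_normed_vector \<Rightarrow> real"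
  shows "open S \<Longrightarrow> smooth_on S f \<Longrightarrow> smooth_on S g \<Longrightarrow> smooth_on S (\<lambda>x. f x * g x)"
  by (simp add: smooth_on_def Ck_on_mult)

lemma smooth_on_compose:
  fixes g :: "'b::real_inner \<Rightarrow> real"
  assumes "parseval (B :: 'b set)" "open S" "f ` S \<subseteq> T" "smooth_on S f" "smooth_on T g"
  shows "smooth_on S (\<lambda>x. g (f x))"
  using Ck_on_compose[OF assms(1-3)] assms(4,5) by (simp add: smooth_on_def)

lemma smooth_on_differentiable: "smooth_on S f \<Longrightarrow> x \<in> S \<Longrightarrow> f differentiable (at x)"
  unfolding smooth_on_def by (metis Ck_on.simps(2))

lemma smooth_on_frechet_derivative:
  "smooth_on S f \<Longrightarrow> smooth_on S (\<lambda>x. frechet_derivative f (at x) v)"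
  unfolding smooth_on_def by (metis Ck_on.simps(2))

lemma smooth_on_continuous_on: "smooth_on S f \<Longrightarrow> continuous_on S f"
  unfolding smooth_on_def by (metis Ck_on.simps(1))

section \<open>Smooth cutoff functions\<close>

text \<open>The family \<open>t\<^sup>-\<^sup>n exp(-1/t)\<close>, extended by 0 to \<open>t \<le> 0\<close>, is closed under differentiation up to
  linear combinations, so smoothness of all members is proved by one induction.\<close>

definition flat :: "nat \<Rightarrow> real \<Rightarrow> real" where
  "flat n t = (if t > 0 then (1 / t) ^ n * exp (- 1 / t) else 0)"

lemma power_le_fact_exp:
  assumes "x \<ge> (0::real)"
  shows "x ^ n \<le> fact n * exp x"
proof -
  have "summable (\<lambda>k. x ^ k /\<^sub>R fact k)" by (rule summable_exp_generic)
  then have "sum (\<lambda>k. x ^ k /\<^sub>R fact k) {n} \<le> (\<Sum>k. x ^ k /\<^sub>R fact k)"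
    using assms by (intro sum_le_suminf) auto
  then show ?thesis by (simp add: exp_def field_simps)
qed

text \<open>Comparison of \<open>exp(1/t)\<close> with the term of order \<open>n + 2\<close> of its series. The quadratic bound
  makes the derivative at 0 vanish.\<close>

lemma flat_bound: "\<bar>flat n t\<bar> \<le> fact (n + 2) * t\<^sup>2"
proof (cases "t > 0")
  case True
  have "(1 / t) ^ (n + 2) * t\<^sup>2 * exp (- 1 / t) \<le> fact (n + 2) * exp (1 / t) * t\<^sup>2 * exp (- 1 / t)"
    using True by (intro mult_right_mono power_le_fact_exp) auto
  also have "\<dots> = fact (n + 2) * t\<^sup>2"
    by (simp add: exp_minus field_simps)
  finally have "(1 / t) ^ (n + 2) * t\<^sup>2 * exp (- 1 / t) \<le> fact (n + 2) * t\<^sup>2" .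
  moreover have "(1 / t) ^ (n + 2) * t\<^sup>2 = (1 / t) ^ n"
    using True by (simp add: power_divide power2_eq_square)
  ultimately have "(1 / t) ^ n * exp (- 1 / t) \<le> fact (n + 2) * t\<^sup>2" by (simp only:)
  then show ?thesis unfolding flat_def using True by (simp del: fact_Suc)
qed (simp add: flat_def)

lemma has_derivative_flat:
  "(flat n has_derivative (\<lambda>v. (flat (n + 2) t - n * flat (Suc n) t) * v)) (at t)"
proof -
  let ?D = "flat (n + 2) t - n * flat (Suc n) t"
  consider "t > 0" | "t = 0" | "t < 0" by linarith
  then have "(flat n has_field_derivative ?D) (at t)"
  proof cases
    case 1
    have "((\<lambda>t. (1 / t) ^ n * exp (- 1 / t)) has_field_derivative ?D) (at t)"
      using 1 by (auto intro!: derivative_eq_intros simp: flat_def field_simps power2_eq_square) 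
         (cases n; simp add: field_simps power2_eq_square)
    moreover have "(flat n has_field_derivative ?D) (at t) \<longleftrightarrow>
        ((\<lambda>t. (1 / t) ^ n * exp (- 1 / t)) has_field_derivative ?D) (at t)"
      using 1 by (intro DERIV_cong_ev refl)
        (auto simp: flat_def intro!: eventually_nhds_in_open[of "{0<..}", THEN eventually_mono])
    ultimately show ?thesis by simp
  next
    case 2
    have "((\<lambda>h. flat n h / h) \<longlongrightarrow> 0) (at 0)"
    proof (rule Lim_null_comparison)
      show "\<forall>\<^sub>F h in at 0. norm (flat n h / h) \<le> fact (n + 2) * \<bar>h\<bar>"
      proof (intro always_eventually allI)
        fix h :: real
        have "norm (flat n h / h) \<le> fact (n + 2) * h\<^sup>2 / \<bar>h\<bar>"
          unfolding real_norm_def abs_divide by (intro divide_right_mono flat_bound) simp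
        also have "\<dots> = fact (n + 2) * \<bar>h\<bar>"
          by (cases "h = 0") (auto simp: power2_eq_square abs_if)
        finally show "norm (flat n h / h) \<le> fact (n + 2) * \<bar>h\<bar>" .
      qed
      show "((\<lambda>h. fact (n + 2) * \<bar>h\<bar>) \<longlongrightarrow> (0::real)) (at 0)"
        by (auto intro!: tendsto_eq_intros)
    qed
    then show ?thesis using 2 by (simp add: has_field_derivative_iff flat_def)
  next
    case 3
    have "(flat n has_field_derivative ?D) (at t) \<longleftrightarrow> ((\<lambda>t. 0) has_field_derivative ?D) (at t)"
      using 3 by (intro DERIV_cong_ev refl)
        (auto simp: flat_def intro!: eventually_nhds_in_open[of "{..<0}", THEN eventually_mono])
    then show ?thesis using 3 by (simp add: flat_def)
  qed
  then show ?thesis by (simp add: has_field_derivative_def)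
qed

lemma Ck_on_flat: "Ck_on k UNIV (flat n)"
proof (induction k arbitrary: n)
  case 0
  have "isCont (flat n) t" for t
    using has_derivative_continuous[OF has_derivative_flat] .
  then show ?case by (simp add: continuous_at_imp_continuous_on)
next
  case (Suc k)
  have "Ck_on k UNIV (\<lambda>t. (flat (n + 2) t + (- real n) * flat (Suc n) t) * v)" for v
    by (intro Ck_on_mult Ck_on_add Ck_on_const Suc.IH open_UNIV)
  then show ?case by (intro Ck_on_SucI[OF open_UNIV has_derivative_flat]) simp
qed

text \<open>A smooth function of \<open>s\<close> that is constantly 1 for \<open>s \<le> r/2\<close> and 0 for \<open>s \<ge> r\<close>. The inner
  \<open>flat 0 (r - s)\<close> already vanishes for \<open>s \<ge> r\<close>; applying \<open>flat 0\<close> once more to its distance below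
  the level \<open>flat 0 (r / 2)\<close> produces the plateau, without dividing by a function.\<close>

definition cutoff :: "real \<Rightarrow> real \<Rightarrow> real" where
  "cutoff r s = 1 - flat 0 (flat 0 (r / 2) - flat 0 (r - s)) / flat 0 (flat 0 (r / 2))"

lemma flat_0_pos: "t > 0 \<Longrightarrow> flat 0 t > 0" and flat_nonpos: "t \<le> 0 \<Longrightarrow> flat n t = 0"
  by (simp_all add: flat_def)

lemma cutoff_eq_1:
  assumes "r > 0" "s \<le> r / 2"
  shows "cutoff r s = 1"
proof -
  have "flat 0 (r / 2) \<le> flat 0 (r - s)" using assms by (simp add: flat_def field_simps)
  then show ?thesis by (simp add: cutoff_def flat_nonpos)
qed

lemma cutoff_eq_0: "r > 0 \<Longrightarrow> s \<ge> r \<Longrightarrow> cutoff r s = 0"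
  using flat_0_pos[of "r / 2"] flat_0_pos[of "flat 0 (r / 2)"]
  by (simp add: cutoff_def flat_nonpos)

lemma smooth_on_flat: "smooth_on UNIV (flat n)"
  by (simp add: smooth_on_def Ck_on_flat)

text \<open>The squared distance is a polynomial in the coordinates.\<close>

lemma smooth_on_cutoff_norm:
  fixes x0 :: "'a::real_inner"
  assumes B: "parseval (B :: 'a set)"
  shows "smooth_on UNIV (\<lambda>x. cutoff r ((x - x0) \<bullet> (x - x0)))"
proof -
  \<comment> \<open>Differences are written as sums with a factor \<open>-1\<close>, so that the rules for sums, products and
    constants suffice.\<close>
  note add = smooth_on_add[OF open_UNIV] and mult = smooth_on_mult[OF open_UNIV]
  have expand: "(x - x0) \<bullet> (x - x0) = (\<Sum>b\<in>B. (x \<bullet> b + - (x0 \<bullet> b)) * (x \<bullet> b + - (x0 \<bullet> b)))" for x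
  proof -
    have "(x - x0) \<bullet> (x - x0) = (x - x0) \<bullet> (\<Sum>b\<in>B. ((x - x0) \<bullet> b) *\<^sub>R b)"
      using B unfolding parseval_def by metis
    then show ?thesis by (simp add: inner_sum_right inner_diff_left)
  qed
  have "smooth_on UNIV (\<lambda>x. (x - x0) \<bullet> (x - x0))"
    unfolding expand smooth_on_def
    by (intro allI Ck_on_sum[OF open_UNIV] Ck_on_mult[OF open_UNIV] Ck_on_add[OF open_UNIV]
        Ck_on_const Ck_on_bounded_linear bounded_linear_inner_left)
  then have "smooth_on UNIV (\<lambda>x. r + (-1) * ((x - x0) \<bullet> (x - x0)))"
    by (intro add mult smooth_on_const)
  then have "smooth_on UNIV (\<lambda>x. flat 0 (r + (-1) * ((x - x0) \<bullet> (x - x0))))"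
    by (rule smooth_on_compose[OF parseval_real open_UNIV subset_UNIV _ smooth_on_flat])
  then have "smooth_on UNIV (\<lambda>x. flat 0 (r / 2) + (-1) * flat 0 (r + (-1) * ((x - x0) \<bullet> (x - x0))))"
    by (intro add mult smooth_on_const)
  then have "smooth_on UNIV (\<lambda>x. flat 0 (flat 0 (r / 2) + (-1) * flat 0 (r + (-1) * ((x - x0) \<bullet> (x - x0)))))"
    by (rule smooth_on_compose[OF parseval_real open_UNIV subset_UNIV _ smooth_on_flat])
  then have "smooth_on UNIV (\<lambda>x. 1 + (- 1 / flat 0 (flat 0 (r / 2))) *
     flat 0 (flat 0 (r / 2) + (-1) * flat 0 (r + (-1) * ((x - x0) \<bullet> (x - x0)))))"
    by (intro add mult smooth_on_const)
  then show ?thesis by (simp add: cutoff_def)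
qed

section \<open>Symmetry of second derivatives\<close>

text \<open>The mean value theorem applied first in direction \<open>u\<close> and then in direction \<open>v\<close>. The second
  difference is symmetric in \<open>u\<close> and \<open>v\<close>, which is what forces mixed derivatives to agree.\<close>

lemma second_difference_mean_value:
  fixes F :: "'a::real_normed_vector \<Rightarrow> real"
  assumes F: "smooth_on (ball x r) F" and t: "t > 0" and tr: "t * (norm u + norm v) < r"
  shows "\<exists>y \<in> ball x r. norm (y - x) \<le> t * (norm u + norm v) \<and>
    F (x + t *\<^sub>R u + t *\<^sub>R v) - F (x + t *\<^sub>R u) - F (x + t *\<^sub>R v) + F x
     = t\<^sup>2 * frechet_derivative (\<lambda>z. frechet_derivative F (at z) u) (at y) v"
proof -
  have inb: "x + a *\<^sub>R u + b *\<^sub>R v \<in> ball x r" "norm (a *\<^sub>R u + b *\<^sub>R v) \<le> t * (norm u + norm v)"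
    if "0 \<le> a" "a \<le> t" "0 \<le> b" "b \<le> t" for a b
  proof -
    have "norm (a *\<^sub>R u + b *\<^sub>R v) \<le> a * norm u + b * norm v"
      using that by (metis abs_of_nonneg norm_scaleR norm_triangle_ineq)
    also have "\<dots> \<le> t * norm u + t * norm v"
      using that by (intro add_mono mult_right_mono) auto
    finally show "norm (a *\<^sub>R u + b *\<^sub>R v) \<le> t * (norm u + norm v)" by (simp add: algebra_simps)
    moreover have "dist x (x + a *\<^sub>R u + b *\<^sub>R v) = norm (a *\<^sub>R u + b *\<^sub>R v)"
      unfolding dist_norm by (subst norm_minus_commute) (simp add: add.assoc)
    ultimately show "x + a *\<^sub>R u + b *\<^sub>R v \<in> ball x r" using tr by simp
  qed
  have line: "((\<lambda>s. G (w + s *\<^sub>R e)) has_derivative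
      (\<lambda>h. h * frechet_derivative G (at (w + s *\<^sub>R e)) e)) (at s within S)"
    if "smooth_on (ball x r) G" "w + s *\<^sub>R e \<in> ball x r"
    for G :: "'a \<Rightarrow> real" and w e s S
  proof -
    let ?D = "frechet_derivative G (at (w + s *\<^sub>R e))"
    have d: "G differentiable at (w + s *\<^sub>R e)" using that by (rule smooth_on_differentiable)
    have "((\<lambda>s. w + s *\<^sub>R e) has_derivative (\<lambda>h. h *\<^sub>R e)) (at s within S)"
      by (auto intro!: derivative_eq_intros)
    then have "((\<lambda>s. G (w + s *\<^sub>R e)) has_derivative (\<lambda>h. ?D (h *\<^sub>R e))) (at s within S)"
      by (rule has_derivative_compose) (use d in \<open>simp only: frechet_derivative_works\<close>)
    moreover have "?D (h *\<^sub>R e) = h * ?D e" for h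
      using linear_frechet_derivative[OF d] by (simp add: linear_cmul)
    ultimately show ?thesis by simp
  qed
  \<comment> \<open>The second difference is the increment over \<open>[0, t]\<close> of the first difference in direction \<open>v\<close>.\<close>
  define \<phi> where "\<phi> s = F ((x + t *\<^sub>R v) + s *\<^sub>R u) - F (x + s *\<^sub>R u)" for s
  have d\<phi>: "(\<phi> has_derivative (\<lambda>h. h * (frechet_derivative F (at (x + t *\<^sub>R v + s *\<^sub>R u)) u
      - frechet_derivative F (at (x + s *\<^sub>R u)) u))) (at s within {0..t})"
    if "0 \<le> s" "s \<le> t" for s
    unfolding \<phi>_def right_diff_distrib
    using that t inb(1)[of s t] inb(1)[of s 0]
    by (intro has_derivative_diff line F) (auto simp: algebra_simps)
  obtain \<sigma> where \<sigma>: "\<sigma> \<in> {0<..<t}" "\<phi> t - \<phi> 0 = (t - 0) *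
      (frechet_derivative F (at (x + t *\<^sub>R v + \<sigma> *\<^sub>R u)) u - frechet_derivative F (at (x + \<sigma> *\<^sub>R u)) u)"
    using mvt_simple[OF t d\<phi>] by blast
  define \<psi> where "\<psi> s = frechet_derivative F (at ((x + \<sigma> *\<^sub>R u) + s *\<^sub>R v)) u" for s
  have d\<psi>: "(\<psi> has_derivative (\<lambda>h. h * frechet_derivative (\<lambda>z. frechet_derivative F (at z) u)
      (at (x + \<sigma> *\<^sub>R u + s *\<^sub>R v)) v)) (at s within {0..t})" if "0 \<le> s" "s \<le> t" for s
    unfolding \<psi>_def using that \<sigma>(1) inb(1)[of \<sigma> s]
    by (intro line[where G = "\<lambda>z. frechet_derivative F (at z) u"] smooth_on_frechet_derivative F) auto
  obtain \<tau> where \<tau>: "\<tau> \<in> {0<..<t}" "\<psi> t - \<psi> 0 = (t - 0) *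
      frechet_derivative (\<lambda>z. frechet_derivative F (at z) u) (at (x + \<sigma> *\<^sub>R u + \<tau> *\<^sub>R v)) v"
    using mvt_simple[OF t d\<psi>] by blast
  have "F (x + t *\<^sub>R u + t *\<^sub>R v) - F (x + t *\<^sub>R u) - F (x + t *\<^sub>R v) + F x = \<phi> t - \<phi> 0"
    by (simp add: \<phi>_def algebra_simps)
  also have "\<dots> = t * (\<psi> t - \<psi> 0)"
    using \<sigma>(2) by (simp add: \<psi>_def algebra_simps)
  also have "\<dots> = t\<^sup>2 * frechet_derivative (\<lambda>z. frechet_derivative F (at z) u)
      (at (x + \<sigma> *\<^sub>R u + \<tau> *\<^sub>R v)) v"
    using \<tau>(2) by (simp add: power2_eq_square)
  finally show ?thesis
    using \<sigma>(1) \<tau>(1) inb[of \<sigma> \<tau>] by (intro bexI[of _ "x + \<sigma> *\<^sub>R u + \<tau> *\<^sub>R v"]) (auto simp: add.assoc)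
qed

text \<open>Both mixed derivatives, evaluated at suitable points arbitrarily close to \<open>x\<close>, equal the same
  second difference quotient; continuity transfers the equality to \<open>x\<close>.\<close>

lemma frechet_derivative_commute:
  fixes F :: "'a::real_normed_vector \<Rightarrow> real"
  assumes F: "smooth_on S F" and S: "open S" "x \<in> S"
  shows "frechet_derivative (\<lambda>z. frechet_derivative F (at z) u) (at x) v
       = frechet_derivative (\<lambda>z. frechet_derivative F (at z) v) (at x) u"
proof (rule ccontr)
  let ?P = "\<lambda>y. frechet_derivative (\<lambda>z. frechet_derivative F (at z) u) (at y) v"
  let ?Q = "\<lambda>y. frechet_derivative (\<lambda>z. frechet_derivative F (at z) v) (at y) u"
  define \<epsilon> where "\<epsilon> = \<bar>?P x - ?Q x\<bar> / 2"
  assume "?P x \<noteq> ?Q x"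
  then have \<epsilon>: "\<epsilon> > 0" by (simp add: \<epsilon>_def)
  have "isCont ?P x" "isCont ?Q x"
    using smooth_on_continuous_on[OF smooth_on_frechet_derivative[OF smooth_on_frechet_derivative[OF F]]] S
    by (auto simp: continuous_on_eq_continuous_at)
  then obtain d1 d2 where d: "d1 > 0" "\<And>y. dist y x < d1 \<Longrightarrow> dist (?P y) (?P x) < \<epsilon>"
      "d2 > 0" "\<And>y. dist y x < d2 \<Longrightarrow> dist (?Q y) (?Q x) < \<epsilon>"
    using \<epsilon> unfolding continuous_at_eps_delta by metis
  obtain r0 where r0: "r0 > 0" "ball x r0 \<subseteq> S" using S openE by blast
  define r where "r = min r0 (min d1 d2)"
  have r: "r > 0" using r0 d by (simp add: r_def)
  define t where "t = r / (2 * (norm u + norm v + 1))"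
  have t: "t > 0" using r by (simp add: t_def add_nonneg_pos)
  have "t * (norm u + norm v) \<le> t * (norm u + norm v + 1)" using t by (intro mult_left_mono) auto
  also have "\<dots> = r / 2" unfolding t_def using add_nonneg_pos[of "norm u + norm v" 1] by (simp add: field_simps)
  finally have tr: "t * (norm u + norm v) < r" using r by linarith
  have Fr: "smooth_on (ball x r) F" using r0(2) by (intro smooth_on_subset[OF F]) (auto simp: r_def)
  obtain y where y: "y \<in> ball x r"
    "F (x + t *\<^sub>R u + t *\<^sub>R v) - F (x + t *\<^sub>R u) - F (x + t *\<^sub>R v) + F x = t\<^sup>2 * ?P y"
    using second_difference_mean_value[OF Fr t tr] by blast
  obtain z where z: "z \<in> ball x r"
    "F (x + t *\<^sub>R v + t *\<^sub>R u) - F (x + t *\<^sub>R v) - F (x + t *\<^sub>R u) + F x = t\<^sup>2 * ?Q z"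
    using second_difference_mean_value[OF Fr t, of v u] tr by (auto simp: add.commute)
  have "t\<^sup>2 * ?P y = t\<^sup>2 * ?Q z" using y(2) z(2) by (simp add: algebra_simps)
  then have "?P y = ?Q z" using t by simp
  moreover have "dist (?P y) (?P x) < \<epsilon>" by (rule d(2)) (use y(1) in \<open>simp add: r_def dist_commute\<close>)
  moreover have "dist (?Q z) (?Q x) < \<epsilon>" by (rule d(4)) (use z(1) in \<open>simp add: r_def dist_commute\<close>)
  moreover have "\<bar>c - d\<bar> / 2 < e" if "a = b" "dist a c < e" "dist b d < e" for a b c d e :: real
    using that dist_triangle3[of c d b] by (simp add: dist_real_def)
  ultimately have "\<bar>?P x - ?Q x\<bar> / 2 < \<epsilon>" by blast
  then show False by (simp add: \<epsilon>_def)
qed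

section \<open>Manifolds and local frames\<close>

text \<open>What the algebraic part uses of a manifold: smooth functions form an algebra, tangent vectors
  are derivations of it, and around each point \<open>p\<close> there are a cutoff \<open>b\<close>, fields \<open>E i\<close> and functions
  \<open>x i\<close> with \<open>b v = \<Sum>\<^sub>i v(x i) E i\<close> for every tangent vector \<open>v\<close> of \<open>M\<close>. In a chart, \<open>E i\<close> is \<open>b \<partial>\<^sub>i\<close>
  and \<open>x i\<close> is the \<open>i\<close>-th coordinate, cut off further out. The cutoff is 1 near \<open>p\<close>, hence its
  derivatives vanish there and the \<open>E i\<close> commute at \<open>p\<close>.\<close>

locale smooth_frames =
  fixes A :: "('m::topological_space, 'e::real_inner) chart set"
  assumes const_smooth: "(\<lambda>p. c) \<in> smooth_functions A"
    and add_smooth: "f \<in> smooth_functions A \<Longrightarrow> g \<in> smooth_functions A \<Longrightarrow>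
      (\<lambda>p. f p + g p) \<in> smooth_functions A"
    and mult_smooth: "f \<in> smooth_functions A \<Longrightarrow> g \<in> smooth_functions A \<Longrightarrow>
      (\<lambda>p. f p * g p) \<in> smooth_functions A"
    and tangent_zero: "0 \<in> tangent_space A p"
    and tangent_add: "v \<in> tangent_space A p \<Longrightarrow> w \<in> tangent_space A p \<Longrightarrow> v + w \<in> tangent_space A p"
    and tangent_scale: "v \<in> tangent_space A p \<Longrightarrow> a *\<^sub>R v \<in> tangent_space A p"
    and tangent_not_smooth: "v \<in> tangent_space A p \<Longrightarrow> f \<notin> smooth_functions A \<Longrightarrow> v f = 0"
    and tangent_apply_const: "v \<in> tangent_space A p \<Longrightarrow> v (\<lambda>q. c) = 0"
    and tangent_apply_add: "v \<in> tangent_space A p \<Longrightarrow> f \<in> smooth_functions A \<Longrightarrow>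
      g \<in> smooth_functions A \<Longrightarrow> v (\<lambda>q. f q + g q) = v f + v g"
    and tangent_apply_mult: "v \<in> tangent_space A p \<Longrightarrow> f \<in> smooth_functions A \<Longrightarrow>
      g \<in> smooth_functions A \<Longrightarrow> v (\<lambda>q. f q * g q) = f p * v g + g p * v f"
    and frame: "\<exists>(I :: 'e set) b E x. finite I \<and> b \<in> smooth_functions A \<and> b p = 1 \<and>
      (\<forall>v\<in>tangent_space A p. v b = 0) \<and>
      (\<forall>i\<in>I. E i \<in> vector_fields A \<and> x i \<in> smooth_functions A) \<and>
      (\<forall>q. \<forall>v\<in>tangent_space A q. b q *\<^sub>R v = (\<Sum>i\<in>I. v (x i) *\<^sub>R E i q)) \<and>
      (\<forall>i\<in>I. \<forall>j\<in>I. \<forall>f\<in>smooth_functions A. E i p (\<lambda>q. E j q f) = E j p (\<lambda>q. E i q f))"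

definition coordinate_derivative ::
    "('m::topological_space, 'e::real_inner) chart set \<Rightarrow> ('m, 'e) chart \<Rightarrow> 'm \<Rightarrow> 'e \<Rightarrow> 'm tangent" where
  "coordinate_derivative A c p e = (\<lambda>f. if f \<in> smooth_functions A
     then frechet_derivative (f \<circ> inv_into (fst c) (snd c)) (at (snd c p)) e else 0)"

context
  fixes A :: "('m::{t2_space,second_countable_topology}, 'e::real_inner) chart set"
  assumes M: "smooth_manifold A"
begin

lemma chart_facts:
  assumes "(U, \<phi>) \<in> A"
  shows "open U" "open (\<phi> ` U)" "continuous_on U \<phi>" "continuous_on (\<phi> ` U) (inv_into U \<phi>)"
    "\<And>q. q \<in> U \<Longrightarrow> inv_into U \<phi> (\<phi> q) = q"
proof -
  have c: "open U" "open (\<phi> ` U)" "homeomorphism U (\<phi> ` U) \<phi> (inv_into U \<phi>)"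
    using M assms by (auto simp: smooth_manifold_def is_chart_def)
  then show "open U" "open (\<phi> ` U)" "continuous_on U \<phi>" "continuous_on (\<phi> ` U) (inv_into U \<phi>)"
    "\<And>q. q \<in> U \<Longrightarrow> inv_into U \<phi> (\<phi> q) = q"
    by (auto simp: homeomorphism_def)
qed

lemma chart_around: "\<exists>U \<phi>. (U, \<phi>) \<in> A \<and> p \<in> U"
proof -
  have "p \<in> (\<Union>(U, \<phi>)\<in>A. U)" using M by (simp add: smooth_manifold_def)
  then show ?thesis by auto
qed

lemma open_chart_image:
  assumes "(U, \<phi>) \<in> A" "open W" "W \<subseteq> U"
  shows "open (\<phi> ` W)"
proof -
  have "\<phi> ` W = inv_into U \<phi> -` W \<inter> \<phi> ` U"
    using chart_facts(5)[OF assms(1)] assms(3) by (force simp: image_iff)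
  moreover have "open (inv_into U \<phi> -` W \<inter> \<phi> ` U)"
    using continuous_on_open_vimage[OF chart_facts(2)[OF assms(1)]] chart_facts(4)[OF assms(1)] assms(2)
    by blast
  ultimately show ?thesis by simp
qed

lemma transition_smooth:
  assumes "(U, \<phi>) \<in> A" "(V, \<psi>) \<in> A"
  shows "smooth_on (\<phi> ` (U \<inter> V)) (\<psi> \<circ> inv_into U \<phi>)"
  using M assms unfolding smooth_manifold_def by blast

lemma smooth_in_chart:
  "f \<in> smooth_functions A \<Longrightarrow> (U, \<phi>) \<in> A \<Longrightarrow> smooth_on (\<phi> ` U) (f \<circ> inv_into U \<phi>)"
  by (auto simp: smooth_functions_def)

lemma parseval_model: "\<exists>B::'e set. parseval B"
  using M parseval_exists unfolding smooth_manifold_def by blast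

text \<open>The chain rule for the transition map. It shows that every chart around a point yields the same
  tangent space.\<close>

lemma coordinate_derivative_change:
  assumes c: "(U, \<phi>) \<in> A" "p \<in> U" and d: "(V, \<psi>) \<in> A" "p \<in> V"
  shows "coordinate_derivative A (V, \<psi>) p e = coordinate_derivative A (U, \<phi>) p
     (frechet_derivative (\<phi> \<circ> inv_into V \<psi>) (at (\<psi> p)) e)"
proof
  fix f
  show "coordinate_derivative A (V, \<psi>) p e f = coordinate_derivative A (U, \<phi>) p
     (frechet_derivative (\<phi> \<circ> inv_into V \<psi>) (at (\<psi> p)) e) f"
  proof (cases "f \<in> smooth_functions A")
    case True
    let ?W = "\<psi> ` (V \<inter> U)"
    have W: "open ?W" "\<psi> p \<in> ?W"
      using open_chart_image[OF d(1), of "V \<inter> U"] chart_facts(1)[OF c(1)] chart_facts(1)[OF d(1)] c d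
      by auto
    have tr: "(\<phi> \<circ> inv_into V \<psi>) differentiable at (\<psi> p)"
      using smooth_on_differentiable[OF transition_smooth[OF d(1) c(1)]] W(2) by blast
    have pt: "(\<phi> \<circ> inv_into V \<psi>) (\<psi> p) = \<phi> p"
      using chart_facts(5)[OF d] by simp
    have fd: "(f \<circ> inv_into U \<phi>) differentiable at ((\<phi> \<circ> inv_into V \<psi>) (\<psi> p))"
      unfolding pt using smooth_on_differentiable[OF smooth_in_chart[OF True c(1)]] c(2) by blast
    have fV: "(f \<circ> inv_into V \<psi>) differentiable at (\<psi> p)"
      using smooth_on_differentiable[OF smooth_in_chart[OF True d(1)]] d(2) by blast
    have "frechet_derivative (f \<circ> inv_into V \<psi>) (at (\<psi> p))
        = frechet_derivative ((f \<circ> inv_into U \<phi>) \<circ> (\<phi> \<circ> inv_into V \<psi>)) (at (\<psi> p))"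
      by (rule frechet_derivative_transform_within_open[OF fV W])
        (use chart_facts(5)[OF c(1)] chart_facts(5)[OF d(1)] in auto)
    also have "\<dots> = frechet_derivative (f \<circ> inv_into U \<phi>) (at (\<phi> p))
        \<circ> frechet_derivative (\<phi> \<circ> inv_into V \<psi>) (at (\<psi> p))"
      using frechet_derivative_compose[OF tr fd] unfolding pt .
    finally show ?thesis using True by (simp add: coordinate_derivative_def)
  qed (simp add: coordinate_derivative_def)
qed

lemma tangent_space_chart:
  assumes c: "(U, \<phi>) \<in> A" "p \<in> U"
  shows "tangent_space A p = range (coordinate_derivative A (U, \<phi>) p)"
proof
  show "range (coordinate_derivative A (U, \<phi>) p) \<subseteq> tangent_space A p"
    using c unfolding tangent_space_def coordinate_derivative_def by force
  show "tangent_space A p \<subseteq> range (coordinate_derivative A (U, \<phi>) p)"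
  proof
    fix v assume "v \<in> tangent_space A p"
    then obtain V \<psi> e where d: "(V, \<psi>) \<in> A" "p \<in> V" and "v = coordinate_derivative A (V, \<psi>) p e"
      unfolding tangent_space_def coordinate_derivative_def by fastforce
    then show "v \<in> range (coordinate_derivative A (U, \<phi>) p)"
      using coordinate_derivative_change[OF c d] by simp
  qed
qed

lemma smooth_functions_const: "(\<lambda>p. c) \<in> smooth_functions A"
  by (auto simp: smooth_functions_def o_def smooth_on_const)

lemma smooth_functionsI:
  "(\<And>U \<phi>. (U, \<phi>) \<in> A \<Longrightarrow> smooth_on (\<phi> ` U) (f \<circ> inv_into U \<phi>)) \<Longrightarrow> f \<in> smooth_functions A"
  by (auto simp: smooth_functions_def)

lemma smooth_functions_add:
  assumes "f \<in> smooth_functions A" "g \<in> smooth_functions A"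
  shows "(\<lambda>p. f p + g p) \<in> smooth_functions A"
proof (rule smooth_functionsI)
  fix U \<phi> assume c: "(U, \<phi>) \<in> A"
  show "smooth_on (\<phi> ` U) ((\<lambda>p. f p + g p) \<circ> inv_into U \<phi>)"
    using smooth_on_add[OF chart_facts(2)[OF c] assms[THEN smooth_in_chart, OF c]] by (simp add: o_def)
qed

lemma smooth_functions_mult:
  assumes "f \<in> smooth_functions A" "g \<in> smooth_functions A"
  shows "(\<lambda>p. f p * g p) \<in> smooth_functions A"
proof (rule smooth_functionsI)
  fix U \<phi> assume c: "(U, \<phi>) \<in> A"
  show "smooth_on (\<phi> ` U) ((\<lambda>p. f p * g p) \<circ> inv_into U \<phi>)"
    using smooth_on_mult[OF chart_facts(2)[OF c] assms[THEN smooth_in_chart, OF c]] by (simp add: o_def)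
qed

lemma coordinate_derivative_linear:
  assumes "(U, \<phi>) \<in> A" "p \<in> U"
  shows "linear (coordinate_derivative A (U, \<phi>) p)"
proof
  have d: "linear (frechet_derivative (f \<circ> inv_into U \<phi>) (at (\<phi> p)))" if "f \<in> smooth_functions A" for f
    using smooth_on_differentiable[OF smooth_in_chart[OF that assms(1)]] assms(2)
    by (auto intro: linear_frechet_derivative)
  show "coordinate_derivative A (U, \<phi>) p (x + y) =
      coordinate_derivative A (U, \<phi>) p x + coordinate_derivative A (U, \<phi>) p y" for x y
    using linear_add[OF d] by (fastforce simp: coordinate_derivative_def)
  show "coordinate_derivative A (U, \<phi>) p (r *\<^sub>R x) = r *\<^sub>R coordinate_derivative A (U, \<phi>) p x" for r x
    using linear_cmul[OF d] by (fastforce simp: coordinate_derivative_def scaleR_fun_def)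
qed

lemma coordinate_derivative_add:
  assumes c: "(U, \<phi>) \<in> A" "p \<in> U" and f: "f \<in> smooth_functions A" and g: "g \<in> smooth_functions A"
  shows "coordinate_derivative A (U, \<phi>) p e (\<lambda>q. f q + g q)
    = coordinate_derivative A (U, \<phi>) p e f + coordinate_derivative A (U, \<phi>) p e g"
proof -
  have d: "(h \<circ> inv_into U \<phi> has_derivative frechet_derivative (h \<circ> inv_into U \<phi>) (at (\<phi> p))) (at (\<phi> p))"
    if "h \<in> smooth_functions A" for h
    using smooth_on_differentiable[OF smooth_in_chart[OF that c(1)]] c(2)
    unfolding frechet_derivative_works by blast
  have "((\<lambda>q. f q + g q) \<circ> inv_into U \<phi> has_derivative
      (\<lambda>e. frechet_derivative (f \<circ> inv_into U \<phi>) (at (\<phi> p)) e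
        + frechet_derivative (g \<circ> inv_into U \<phi>) (at (\<phi> p)) e)) (at (\<phi> p))"
    using has_derivative_add[OF d[OF f] d[OF g]] by (simp add: o_def)
  from frechet_derivative_at[OF this, symmetric] show ?thesis
    using f g smooth_functions_add by (simp add: coordinate_derivative_def)
qed

lemma coordinate_derivative_mult:
  assumes c: "(U, \<phi>) \<in> A" "p \<in> U" and f: "f \<in> smooth_functions A" and g: "g \<in> smooth_functions A"
  shows "coordinate_derivative A (U, \<phi>) p e (\<lambda>q. f q * g q)
    = f p * coordinate_derivative A (U, \<phi>) p e g + g p * coordinate_derivative A (U, \<phi>) p e f"
proof -
  have d: "(h \<circ> inv_into U \<phi> has_derivative frechet_derivative (h \<circ> inv_into U \<phi>) (at (\<phi> p))) (at (\<phi> p))"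
    if "h \<in> smooth_functions A" for h
    using smooth_on_differentiable[OF smooth_in_chart[OF that c(1)]] c(2)
    unfolding frechet_derivative_works by blast
  have "((\<lambda>q. f q * g q) \<circ> inv_into U \<phi> has_derivative
      (\<lambda>e. f p * frechet_derivative (g \<circ> inv_into U \<phi>) (at (\<phi> p)) e
        + frechet_derivative (f \<circ> inv_into U \<phi>) (at (\<phi> p)) e * g p)) (at (\<phi> p))"
    using has_derivative_mult[OF d[OF f] d[OF g]] chart_facts(5)[OF c] by (simp add: o_def)
  from frechet_derivative_at[OF this, symmetric] show ?thesis
    using f g smooth_functions_mult by (simp add: coordinate_derivative_def mult.commute)
qed

text \<open>The preimage of \<open>K\<close> is compact, hence closed because the manifold is Hausdorff. So in any other
  chart the extended function is smooth on two open sets that cover: the overlap with \<open>U\<close>, and the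
  complement of this preimage, where it is 0.\<close>

lemma extension_by_zero_smooth:
  assumes c: "(U, \<phi>) \<in> A" and h: "smooth_on (\<phi> ` U) h"
    and K: "compact K" "K \<subseteq> \<phi> ` U" "\<And>y. y \<in> \<phi> ` U - K \<Longrightarrow> h y = 0"
  shows "(\<lambda>q. if q \<in> U then h (\<phi> q) else 0) \<in> smooth_functions A" (is "?f \<in> _")
proof (rule smooth_functionsI)
  fix V \<psi> assume d: "(V, \<psi>) \<in> A"
  obtain B :: "'e set" where B: "parseval B" using parseval_model by blast
  let ?K = "inv_into U \<phi> ` K"
  have "compact ?K"
    by (rule compact_continuous_image[OF continuous_on_subset[OF chart_facts(4)[OF c] K(2)] K(1)])
  then have "closed ?K" by (rule compact_imp_closed)
  then have op: "open (\<psi> ` (V \<inter> U))" "open (\<psi> ` (V - ?K))"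
    using chart_facts(1)[OF c] chart_facts(1)[OF d] by (auto intro!: open_chart_image[OF d])
  have "smooth_on (\<psi> ` (V \<inter> U)) (\<lambda>y. h ((\<phi> \<circ> inv_into V \<psi>) y))"
    using chart_facts(5)[OF d]
    by (intro smooth_on_compose[OF B op(1) _ transition_smooth[OF d c] h]) auto
  then have 1: "smooth_on (\<psi> ` (V \<inter> U)) (?f \<circ> inv_into V \<psi>)"
    by (rule smooth_on_cong[OF op(1), rotated]) (use chart_facts(5)[OF d] in auto)
  have zero: "?f q = 0" if "q \<notin> ?K" for q
  proof (cases "q \<in> U")
    case True
    then have "\<phi> q \<notin> K" using that chart_facts(5)[OF c] by (metis imageI)
    then show ?thesis using True K(3) by simp
  qed simp
  then have 2: "smooth_on (\<psi> ` (V - ?K)) (?f \<circ> inv_into V \<psi>)"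
    by (intro smooth_on_cong[OF op(2) _ smooth_on_const[of _ 0]])
      (use chart_facts(5)[OF d] zero in \<open>fastforce simp del: if_split\<close>)
  have "?K \<subseteq> U" using K(2) chart_facts(5)[OF c] by auto
  then have "V = (V \<inter> U) \<union> (V - ?K)" by blast
  then have "\<psi> ` V = \<psi> ` (V \<inter> U) \<union> \<psi> ` (V - ?K)" by (metis image_Un)
  then show "smooth_on (\<psi> ` V) (?f \<circ> inv_into V \<psi>)"
    using smooth_on_Un[OF op 1 2] by simp
qed

text \<open>The frame is \<open>E i = \<beta> \<partial>\<^sub>i\<close> and the dual functions are \<open>x i = \<beta>' y\<^sub>i\<close>, where the larger cutoff \<open>\<beta>'\<close>
  is 1 on an open set that contains all points with \<open>\<beta> \<noteq> 0\<close>; near such points the \<open>x i\<close> are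
  therefore true coordinates.\<close>

lemma frame_exists:
  "\<exists>(I :: 'e set) b E x. finite I \<and> b \<in> smooth_functions A \<and> b p = 1 \<and>
      (\<forall>v\<in>tangent_space A p. v b = 0) \<and>
      (\<forall>i\<in>I. E i \<in> vector_fields A \<and> x i \<in> smooth_functions A) \<and>
      (\<forall>q. \<forall>v\<in>tangent_space A q. b q *\<^sub>R v = (\<Sum>i\<in>I. v (x i) *\<^sub>R E i q)) \<and>
      (\<forall>i\<in>I. \<forall>j\<in>I. \<forall>f\<in>smooth_functions A. E i p (\<lambda>q. E j q f) = E j p (\<lambda>q. E i q f))"
proof -
  obtain U \<phi> where c: "(U, \<phi>) \<in> A" and p: "p \<in> U" using chart_around by blast
  obtain B :: "'e set" where B: "parseval B" using parseval_model by blast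
  have finB: "finite B" using B by (simp add: parseval_def)
  note U = chart_facts[OF c]
  let ?S = "\<phi> ` U" and ?\<iota> = "inv_into U \<phi>"
  obtain r0 where r0: "r0 > 0" "cball (\<phi> p) r0 \<subseteq> ?S"
    using open_contains_cball[of ?S] U(2) p by blast
  \<comment> \<open>Cutoffs are functions of the squared distance: \<open>\<beta>\<close> is supported in \<open>?n \<le> r\<close>, where \<open>\<beta>'\<close> is 1, and
    \<open>\<beta>'\<close> is supported in \<open>?n \<le> 2 r = r0\<^sup>2\<close>, the ball inside the chart.\<close>
  define r where "r = r0\<^sup>2 / 2"
  have r: "r > 0" using r0 by (simp add: r_def)
  let ?n = "\<lambda>y. (y - \<phi> p) \<bullet> (y - \<phi> p)"
  define \<beta> where "\<beta> y = cutoff r (?n y)" for y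
  define \<beta>' where "\<beta>' y = cutoff (2 * r) (?n y)" for y
  let ?K = "cball (\<phi> p) r0"
  have sm: "smooth_on UNIV \<beta>" "smooth_on UNIV \<beta>'"
    unfolding \<beta>_def \<beta>'_def by (intro smooth_on_cutoff_norm[OF B])+
  have smS: "smooth_on ?S \<beta>" "smooth_on ?S \<beta>'" using sm by (auto intro: smooth_on_subset)
  have outside: "?n y \<ge> 2 * r" if "y \<notin> ?K" for y
  proof -
    have "r0\<^sup>2 \<le> (norm (y - \<phi> p))\<^sup>2"
      using that r0(1) by (intro power_mono) (auto simp: dist_norm norm_minus_commute)
    then show ?thesis by (simp add: r_def power2_norm_eq_inner)
  qed
  have \<beta>0: "\<beta> y = 0" "\<beta>' y = 0" if "y \<notin> ?K" for y
    using outside[OF that] r by (auto simp: \<beta>_def \<beta>'_def intro!: cutoff_eq_0)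
  have K: "compact ?K" "?K \<subseteq> ?S" using compact_cball_finite_dim[OF B] r0 by auto
  note lift = extension_by_zero_smooth[OF c _ K]
  have cont_n: "continuous_on UNIV ?n" by (intro continuous_intros)
  have near: "open {y. ?n y < r / 2}" "open {y. ?n y < r}"
    by (intro open_Collect_less cont_n continuous_on_const)+
  define b where "b q = (if q \<in> U then \<beta> (\<phi> q) else 0)" for q
  define x where "x i q = (if q \<in> U then \<beta>' (\<phi> q) * (\<phi> q \<bullet> i) else 0)" for i q
  define E where "E i q = (if q \<in> U then \<beta> (\<phi> q) *\<^sub>R coordinate_derivative A (U, \<phi>) q i else 0)" for i q
  have b_smooth: "b \<in> smooth_functions A"
    unfolding b_def using \<beta>0 by (intro lift smS) auto
  have x_smooth: "x i \<in> smooth_functions A" for i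
    unfolding x_def using \<beta>0
    by (intro lift smooth_on_mult[OF U(2)] smS smooth_on_bounded_linear bounded_linear_inner_left) auto
  have E_apply: "(\<lambda>q. E i q f) = (\<lambda>q. if q \<in> U then
       \<beta> (\<phi> q) * frechet_derivative (f \<circ> ?\<iota>) (at (\<phi> q)) i else 0)"
    if "f \<in> smooth_functions A" for i f
    using that by (auto simp: E_def coordinate_derivative_def scaleR_fun_def)
  have E_smooth: "(\<lambda>q. E i q f) \<in> smooth_functions A" if "f \<in> smooth_functions A" for i f
    unfolding E_apply[OF that] using \<beta>0 
    by (intro lift smooth_on_mult[OF U(2)] smS smooth_on_frechet_derivative smooth_in_chart[OF that c]) auto
  have E_field: "E i \<in> vector_fields A" for i
  proof -
    have "E i q \<in> tangent_space A q" for q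
    proof (cases "q \<in> U")
      case True
      then show ?thesis
        by (simp add: E_def tangent_space_chart[OF c True]
            linear_cmul[OF coordinate_derivative_linear[OF c True], symmetric])
    next
      case False
      obtain V \<psi> where d: "(V, \<psi>) \<in> A" "q \<in> V" using chart_around by blast
      have "0 = coordinate_derivative A (V, \<psi>) q 0"
        using linear_0[OF coordinate_derivative_linear[OF d]] by simp
      then show ?thesis using False by (auto simp: E_def tangent_space_chart[OF d])
    qed
    then show ?thesis using E_smooth by (simp add: vector_fields_def)
  qed
  have b_p: "b p = 1" using p r by (simp add: b_def \<beta>_def cutoff_eq_1)
  have v_b: "v b = 0" if v: "v \<in> tangent_space A p" for v
  proof -
    obtain e where e: "v = coordinate_derivative A (U, \<phi>) p e"
      using v tangent_space_chart[OF c p] by auto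
    have "frechet_derivative (\<lambda>y. 1) (at (\<phi> p)) = frechet_derivative (b \<circ> ?\<iota>) (at (\<phi> p))"
      by (rule frechet_derivative_transform_within_open[OF _ open_Int[OF near(1) U(2)]])
        (use r p U(5) in \<open>auto simp: b_def \<beta>_def cutoff_eq_1\<close>)
    from this[symmetric] show ?thesis by (simp add: e coordinate_derivative_def)
  qed
  have dx: "coordinate_derivative A (U, \<phi>) q e (x i) = e \<bullet> i"
    if q: "q \<in> U" "\<beta> (\<phi> q) \<noteq> 0" for q e i
  proof -
    have "?n (\<phi> q) < r" using q(2) r cutoff_eq_0[of r "?n (\<phi> q)"] unfolding \<beta>_def by force
    then have "frechet_derivative (\<lambda>y. y \<bullet> i) (at (\<phi> q)) = frechet_derivative (x i \<circ> ?\<iota>) (at (\<phi> q))"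
      using r q(1) U(5)
      by (intro frechet_derivative_transform_within_open[OF _ open_Int[OF near(2) U(2)]])
        (auto simp: x_def \<beta>'_def cutoff_eq_1 intro!: bounded_linear_imp_differentiable bounded_linear_inner_left)
    moreover have "frechet_derivative (\<lambda>y. y \<bullet> i) (at (\<phi> q)) = (\<lambda>y. y \<bullet> i)"
      by (rule frechet_derivative_at[symmetric])
        (intro bounded_linear_imp_has_derivative bounded_linear_inner_left)
    ultimately have "frechet_derivative (x i \<circ> ?\<iota>) (at (\<phi> q)) e = e \<bullet> i" by metis
    then show ?thesis using x_smooth by (simp add: coordinate_derivative_def)
  qed
  have resolve: "b q *\<^sub>R v = (\<Sum>i\<in>B. v (x i) *\<^sub>R E i q)" if v: "v \<in> tangent_space A q" for q v
  proof (cases "q \<in> U \<and> \<beta> (\<phi> q) \<noteq> 0")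
    case True
    then have q: "q \<in> U" "\<beta> (\<phi> q) \<noteq> 0" by auto
    interpret D: linear "coordinate_derivative A (U, \<phi>) q"
      by (rule coordinate_derivative_linear[OF c q(1)])
    obtain e where e: "v = coordinate_derivative A (U, \<phi>) q e"
      using v tangent_space_chart[OF c q(1)] by auto
    have "e = (\<Sum>i\<in>B. (e \<bullet> i) *\<^sub>R i)" using B by (simp add: parseval_def)
    then have vsum: "v = (\<Sum>i\<in>B. (e \<bullet> i) *\<^sub>R coordinate_derivative A (U, \<phi>) q i)"
      unfolding e by (metis (no_types, lifting) D.scale D.sum sum.cong)
    have "b q *\<^sub>R v = (\<Sum>i\<in>B. (e \<bullet> i) *\<^sub>R E i q)"
      unfolding vsum using q by (simp add: b_def E_def scaleR_sum_right mult.commute)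
    moreover have "v (x i) = e \<bullet> i" for i unfolding e by (rule dx[OF q])
    ultimately show ?thesis by simp
  next
    case False
    then show ?thesis by (auto simp: b_def E_def)
  qed
  have EE: "E i p (\<lambda>q. E j q f) = frechet_derivative
      (\<lambda>z. frechet_derivative (f \<circ> ?\<iota>) (at z) j) (at (\<phi> p)) i"
    if f: "f \<in> smooth_functions A" for i j f
  proof -
    let ?Df = "\<lambda>z. frechet_derivative (f \<circ> ?\<iota>) (at z) j"
    have "?Df differentiable (at (\<phi> p))"
      using smooth_on_differentiable[OF smooth_on_frechet_derivative[OF smooth_in_chart[OF f c]]] p
      by blast
    then have "frechet_derivative ?Df (at (\<phi> p)) = frechet_derivative ((\<lambda>q. E j q f) \<circ> ?\<iota>) (at (\<phi> p))"
      by (rule frechet_derivative_transform_within_open[OF _ open_Int[OF near(1) U(2)]])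
        (use r p U(5) in \<open>auto simp: E_apply[OF f] \<beta>_def cutoff_eq_1\<close>)
    moreover have "\<beta> (\<phi> p) = 1" using r by (simp add: \<beta>_def cutoff_eq_1)
    ultimately show ?thesis
      using E_smooth[OF f] p by (simp add: E_def coordinate_derivative_def)
  qed
  have "E i p (\<lambda>q. E j q f) = E j p (\<lambda>q. E i q f)" if f: "f \<in> smooth_functions A" for i j f
    unfolding EE[OF f] using frechet_derivative_commute[OF smooth_in_chart[OF f c] U(2)] p by blast
  then show ?thesis
    using finB b_smooth b_p v_b E_field x_smooth resolve
    by (intro exI[of _ B] exI[of _ b] exI[of _ E] exI[of _ x] conjI ballI allI) auto
qed

lemma smooth_manifold_frames: "smooth_frames A"
proof
  fix p
  obtain U \<phi> where c: "(U, \<phi>) \<in> A" and p: "p \<in> U" using chart_around by blast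
  note T = tangent_space_chart[OF c p] and lin = coordinate_derivative_linear[OF c p]
  show "0 \<in> tangent_space A p" using linear_0[OF lin] unfolding T by (metis rangeI)
  show "v + w \<in> tangent_space A p" if "v \<in> tangent_space A p" "w \<in> tangent_space A p" for v w
    using that unfolding T by (auto simp: linear_add[OF lin, symmetric])
  show "a *\<^sub>R v \<in> tangent_space A p" if "v \<in> tangent_space A p" for a v
    using that unfolding T by (auto simp: linear_cmul[OF lin, symmetric])
  show "v f = 0" if "v \<in> tangent_space A p" "f \<notin> smooth_functions A" for v f
    using that unfolding T by (auto simp: coordinate_derivative_def)
  show "v (\<lambda>q. f q + g q) = v f + v g"
    if "v \<in> tangent_space A p" "f \<in> smooth_functions A" "g \<in> smooth_functions A" for v f g
    using that coordinate_derivative_add[OF c p] unfolding T by auto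
  show "v (\<lambda>q. f q * g q) = f p * v g + g p * v f"
    if "v \<in> tangent_space A p" "f \<in> smooth_functions A" "g \<in> smooth_functions A" for v f g
    using that coordinate_derivative_mult[OF c p] unfolding T by auto
  show "v (\<lambda>q. c) = 0" if "v \<in> tangent_space A p" for v c
    using that unfolding T by (auto simp: coordinate_derivative_def o_def)
qed (intro smooth_functions_const smooth_functions_add smooth_functions_mult frame_exists | assumption)+

end

section \<open>Fibrewise linear maps\<close>

lemma sum_fun_apply: "(\<Sum>i\<in>I. g i) x = (\<Sum>i\<in>I. (g i x :: 'b::comm_monoid_add))"
  by (induction I rule: infinite_finite_induct) (auto simp: zero_fun_def plus_fun_def)

lemma scaleR_fun_apply [simp]: "(c *\<^sub>R f) x = c *\<^sub>R f x"
  by (simp add: scaleR_fun_def)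

lemma linear_betweenD:
  assumes "linear_between S T h"
  shows linear_between_mem: "u \<in> S \<Longrightarrow> h u \<in> T"
    and linear_between_add: "u \<in> S \<Longrightarrow> v \<in> S \<Longrightarrow> h (u + v) = h u + h v"
    and linear_between_scale: "u \<in> S \<Longrightarrow> h (c *\<^sub>R u) = c *\<^sub>R h u"
  using assms by (auto simp: linear_between_def)

lemma linear_between_zero: "linear_between S T h \<Longrightarrow> subspace S \<Longrightarrow> h 0 = 0"
  using linear_between_scale[of S T h 0 0] by (simp add: subspace_0)

lemma linear_between_diff:
  assumes "linear_between S T h" "subspace S" "u \<in> S" "v \<in> S"
  shows "h (u - v) = h u - h v"
  using linear_between_add[OF assms(1), of u "(-1) *\<^sub>R v"] assms linear_between_scale[OF assms(1,4), of "-1"]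
  by (simp add: subspace_neg)

lemma linear_between_sum:
  assumes "linear_between S T h" "subspace S" "\<And>i. i \<in> I \<Longrightarrow> u i \<in> S"
  shows "h (\<Sum>i\<in>I. u i) = (\<Sum>i\<in>I. h (u i))"
  using assms(3)
  by (induction I rule: infinite_finite_induct)
    (auto simp: linear_between_zero[OF assms(1,2)] linear_between_add[OF assms(1)] subspace_sum[OF assms(2)])

section \<open>Calculus from local frames\<close>

context smooth_frames
begin

abbreviation "\<C> \<equiv> smooth_functions A"
abbreviation "\<X> \<equiv> vector_fields A"
abbreviation "\<F> \<equiv> one_forms A"
abbreviation "T \<equiv> tangent_space A"
abbreviation "T' \<equiv> cotangent_space A"

subsection \<open>Tangent and cotangent spaces\<close>

lemma subspace_tangent: "subspace (T p)"
  by (simp add: subspace_def tangent_zero tangent_add tangent_scale)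

lemma linear_between_cotangent: "\<xi> \<in> T' p \<Longrightarrow> linear_between (T p) UNIV \<xi>"
  by (simp add: cotangent_space_def)

lemmas cotangent_apply_add = linear_between_add[OF linear_between_cotangent]
  and cotangent_apply_scale = linear_between_scale[OF linear_between_cotangent]
  and cotangent_apply_zero = linear_between_zero[OF linear_between_cotangent subspace_tangent]
  and cotangent_apply_diff = linear_between_diff[OF linear_between_cotangent subspace_tangent]
  and cotangent_apply_sum = linear_between_sum[OF linear_between_cotangent subspace_tangent]

lemma cotangent_outside: "\<xi> \<in> T' p \<Longrightarrow> v \<notin> T p \<Longrightarrow> \<xi> v = 0"
  by (simp add: cotangent_space_def)

lemma subspace_cotangent: "subspace (T' p)"
  unfolding subspace_def cotangent_space_def linear_between_def
  by (auto simp: zero_fun_def plus_fun_def scaleR_fun_def algebra_simps)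

lemma tangent_eqI:
  assumes "v \<in> T p" "w \<in> T p" "\<And>f. f \<in> \<C> \<Longrightarrow> v f = w f"
  shows "v = w"
proof
  show "v f = w f" for f
    by (cases "f \<in> \<C>") (simp_all add: assms tangent_not_smooth[OF assms(1)] tangent_not_smooth[OF assms(2)])
qed

lemma cotangent_eqI:
  assumes "\<xi> \<in> T' p" "\<eta> \<in> T' p" "\<And>v. v \<in> T p \<Longrightarrow> \<xi> v = \<eta> v"
  shows "\<xi> = \<eta>"
proof
  show "\<xi> v = \<eta> v" for v
    by (cases "v \<in> T p") (simp_all add: assms(3) cotangent_outside[OF assms(1)] cotangent_outside[OF assms(2)])
qed

lemma tangent_apply_cmult: "v \<in> T p \<Longrightarrow> f \<in> \<C> \<Longrightarrow> v (\<lambda>q. c * f q) = c * v f"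
  using tangent_apply_mult[OF _ const_smooth] by (simp add: tangent_apply_const)

lemma cmult_smooth: "f \<in> \<C> \<Longrightarrow> (\<lambda>q. c * f q) \<in> \<C>"
  using mult_smooth[OF const_smooth] .

lemma uminus_smooth: "f \<in> \<C> \<Longrightarrow> (\<lambda>q. - f q) \<in> \<C>"
  using cmult_smooth[of f "-1"] by simp

lemma tangent_apply_uminus: "v \<in> T p \<Longrightarrow> f \<in> \<C> \<Longrightarrow> v (\<lambda>q. - f q) = - v f"
  using tangent_apply_cmult[of v p f "-1"] by simp

lemma diff_smooth: "f \<in> \<C> \<Longrightarrow> g \<in> \<C> \<Longrightarrow> (\<lambda>q. f q - g q) \<in> \<C>"
  using add_smooth[OF _ uminus_smooth, of f g] by simp

lemma sum_smooth: "(\<And>i. i \<in> I \<Longrightarrow> f i \<in> \<C>) \<Longrightarrow> (\<lambda>q. \<Sum>i\<in>I. f i q) \<in> \<C>"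
  by (induction I rule: infinite_finite_induct) (auto intro: const_smooth add_smooth)

lemma tangent_apply_sum:
  assumes "v \<in> T p" "\<And>i. i \<in> I \<Longrightarrow> f i \<in> \<C>"
  shows "v (\<lambda>q. \<Sum>i\<in>I. f i q) = (\<Sum>i\<in>I. v (f i))"
  using assms(2)
  by (induction I rule: infinite_finite_induct)
    (auto simp: tangent_apply_const[OF assms(1)] tangent_apply_add[OF assms(1)] sum_smooth)

subsection \<open>Vector fields and one-forms\<close>

lemma frame_at:
  obtains I :: "'e set" and b E x where "finite I" "b \<in> \<C>" "b p = 1" "\<And>v. v \<in> T p \<Longrightarrow> v b = 0"
      "\<And>i. i \<in> I \<Longrightarrow> E i \<in> \<X>" "\<And>i. i \<in> I \<Longrightarrow> x i \<in> \<C>"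
      "\<And>q v. v \<in> T q \<Longrightarrow> b q *\<^sub>R v = (\<Sum>i\<in>I. v (x i) *\<^sub>R E i q)"
      "\<And>i j f. i \<in> I \<Longrightarrow> j \<in> I \<Longrightarrow> f \<in> \<C> \<Longrightarrow> E i p (\<lambda>q. E j q f) = E j p (\<lambda>q. E i q f)"
proof -
  from frame[of p] obtain I :: "'e set" and b E x where *: "finite I \<and> b \<in> \<C> \<and> b p = 1 \<and>
      (\<forall>v\<in>T p. v b = 0) \<and> (\<forall>i\<in>I. E i \<in> \<X> \<and> x i \<in> \<C>) \<and>
      (\<forall>q. \<forall>v\<in>T q. b q *\<^sub>R v = (\<Sum>i\<in>I. v (x i) *\<^sub>R E i q)) \<and>
      (\<forall>i\<in>I. \<forall>j\<in>I. \<forall>f\<in>\<C>. E i p (\<lambda>q. E j q f) = E j p (\<lambda>q. E i q f))"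
    by (elim exE) (rule that)
  show ?thesis by (rule that[of I b E x]) (simp_all add: *)
qed

lemma field_tangent: "X \<in> \<X> \<Longrightarrow> X p \<in> T p"
  and field_smooth: "X \<in> \<X> \<Longrightarrow> f \<in> \<C> \<Longrightarrow> (\<lambda>p. X p f) \<in> \<C>"
  by (simp_all add: vector_fields_def)

lemma form_cotangent: "\<xi> \<in> \<F> \<Longrightarrow> \<xi> p \<in> T' p"
  and form_smooth: "\<xi> \<in> \<F> \<Longrightarrow> X \<in> \<X> \<Longrightarrow> (\<lambda>p. \<xi> p (X p)) \<in> \<C>"
  by (simp_all add: one_forms_def)

lemma fieldI: "(\<And>p. X p \<in> T p) \<Longrightarrow> (\<And>f. f \<in> \<C> \<Longrightarrow> (\<lambda>p. X p f) \<in> \<C>) \<Longrightarrow> X \<in> \<X>"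
  by (simp add: vector_fields_def)

lemma formI: "(\<And>p. \<xi> p \<in> T' p) \<Longrightarrow> (\<And>X. X \<in> \<X> \<Longrightarrow> (\<lambda>p. \<xi> p (X p)) \<in> \<C>) \<Longrightarrow> \<xi> \<in> \<F>"
  by (simp add: one_forms_def)

lemma field_add:
  assumes "X \<in> \<X>" "Y \<in> \<X>"
  shows "(\<lambda>p. X p + Y p) \<in> \<X>"
proof (rule fieldI)
  show "X p + Y p \<in> T p" for p
    using subspace_add[OF subspace_tangent] field_tangent assms by blast
qed (simp add: plus_fun_def add_smooth field_smooth assms)

lemma field_mult:
  assumes "f \<in> \<C>" "X \<in> \<X>"
  shows "(\<lambda>p. f p *\<^sub>R X p) \<in> \<X>"
proof (rule fieldI)
  show "f p *\<^sub>R X p \<in> T p" for p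
    using subspace_scale[OF subspace_tangent] field_tangent assms by blast
qed (simp add: scaleR_fun_def mult_smooth field_smooth assms)

lemma field_scale: "X \<in> \<X> \<Longrightarrow> (\<lambda>p. c *\<^sub>R X p) \<in> \<X>"
  using field_mult[OF const_smooth] .

lemma field_diff: "X \<in> \<X> \<Longrightarrow> Y \<in> \<X> \<Longrightarrow> (\<lambda>p. X p - Y p) \<in> \<X>"
  using field_add[OF _ field_scale, of X Y "-1"] by simp

lemma field_zero: "(\<lambda>p. 0) \<in> \<X>"
  by (rule fieldI) (simp_all add: subspace_0[OF subspace_tangent] const_smooth)

lemma field_sum: "(\<And>i. i \<in> I \<Longrightarrow> X i \<in> \<X>) \<Longrightarrow> (\<lambda>p. \<Sum>i\<in>I. X i p) \<in> \<X>"
  by (induction I rule: infinite_finite_induct) (auto intro: field_zero field_add)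

lemma form_add:
  assumes "\<xi> \<in> \<F>" "\<eta> \<in> \<F>"
  shows "(\<lambda>p. \<xi> p + \<eta> p) \<in> \<F>"
proof (rule formI)
  show "\<xi> p + \<eta> p \<in> T' p" for p
    using subspace_add[OF subspace_cotangent] form_cotangent assms by blast
qed (simp add: plus_fun_def add_smooth form_smooth assms)

lemma form_mult:
  assumes "f \<in> \<C>" "\<xi> \<in> \<F>"
  shows "(\<lambda>p. f p *\<^sub>R \<xi> p) \<in> \<F>"
proof (rule formI)
  show "f p *\<^sub>R \<xi> p \<in> T' p" for p
    using subspace_scale[OF subspace_cotangent] form_cotangent assms by blast
qed (simp add: scaleR_fun_def mult_smooth form_smooth assms)

lemma form_scale: "\<xi> \<in> \<F> \<Longrightarrow> (\<lambda>p. c *\<^sub>R \<xi> p) \<in> \<F>"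
  using form_mult[OF const_smooth] .

lemma form_diff: "\<xi> \<in> \<F> \<Longrightarrow> \<eta> \<in> \<F> \<Longrightarrow> (\<lambda>p. \<xi> p - \<eta> p) \<in> \<F>"
  using form_add[OF _ form_scale, of \<xi> \<eta> "-1"] by simp

lemma form_zero: "(\<lambda>p. 0) \<in> \<F>"
  by (rule formI) (simp_all add: subspace_0[OF subspace_cotangent] const_smooth)

lemma form_sum: "(\<And>i. i \<in> I \<Longrightarrow> \<xi> i \<in> \<F>) \<Longrightarrow> (\<lambda>p. \<Sum>i\<in>I. \<xi> i p) \<in> \<F>"
  by (induction I rule: infinite_finite_induct) (auto intro: form_zero form_add)

lemma d0_form: "f \<in> \<C> \<Longrightarrow> d0 A f \<in> \<F>"
proof (rule formI)
  show "d0 A f p \<in> T' p" for p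
    using tangent_add[of _ p] tangent_scale[of _ p]
    by (auto simp: d0_def cotangent_space_def linear_between_def)

qed (simp add: d0_def field_tangent field_smooth)

lemma d0_apply: "v \<in> T p \<Longrightarrow> d0 A f p v = v f"
  by (simp add: d0_def)

subsection \<open>Extension of vectors and covectors\<close>

text \<open>The field with the constant components \<open>v (x i)\<close> in the frame at \<open>p\<close>.\<close>

lemma tangent_extends:
  assumes "v \<in> T p"
  shows "\<exists>X\<in>\<X>. X p = v"
proof -
  obtain I b E x where fr: "finite (I::'e set)" "b \<in> \<C>" "b p = 1" "\<And>v. v \<in> T p \<Longrightarrow> v b = 0"
      "\<And>i. i \<in> I \<Longrightarrow> E i \<in> \<X>" "\<And>i. i \<in> I \<Longrightarrow> x i \<in> \<C>"
      "\<And>q v. v \<in> T q \<Longrightarrow> b q *\<^sub>R v = (\<Sum>i\<in>I. v (x i) *\<^sub>R E i q)"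
      "\<And>i j f. i \<in> I \<Longrightarrow> j \<in> I \<Longrightarrow> f \<in> \<C> \<Longrightarrow> E i p (\<lambda>q. E j q f) = E j p (\<lambda>q. E i q f)"
    by (rule frame_at[of p]) (rule that)
  show ?thesis
  proof
    show "(\<lambda>q. \<Sum>i\<in>I. v (x i) *\<^sub>R E i q) \<in> \<X>" by (intro field_sum field_scale fr(5))
    show "(\<Sum>i\<in>I. v (x i) *\<^sub>R E i p) = v" using fr(7)[OF assms] fr(3) by simp
  qed
qed

lemma extend_tangent:
  assumes "v \<in> T p"
  shows "extend_tangent A p v \<in> \<X>" "extend_tangent A p v p = v"
  using someI_ex[of "\<lambda>Z. Z \<in> \<X> \<and> Z p = v"] tangent_extends[OF assms]
  unfolding extend_tangent_def by blast+

lemma form_eqI: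
  assumes "\<xi> \<in> \<F>" "\<eta> \<in> \<F>" "\<And>p Z. Z \<in> \<X> \<Longrightarrow> \<xi> p (Z p) = \<eta> p (Z p)"
  shows "\<xi> = \<eta>"
proof
  fix p show "\<xi> p = \<eta> p"
    by (rule cotangent_eqI[OF form_cotangent[OF assms(1)] form_cotangent[OF assms(2)]])
      (use assms(3) tangent_extends in blast)
qed

text \<open>The function with the constant partial derivatives \<open>\<xi> (E i p)\<close> in the frame at \<open>p\<close>. This is why
  it suffices to test tensorial identities on exact forms.\<close>

lemma covector_exact:
  assumes "\<xi> \<in> T' p"
  shows "\<exists>g\<in>\<C>. d0 A g p = \<xi>"
proof -
  obtain I b E x where fr: "finite (I::'e set)" "b \<in> \<C>" "b p = 1" "\<And>v. v \<in> T p \<Longrightarrow> v b = 0"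
      "\<And>i. i \<in> I \<Longrightarrow> E i \<in> \<X>" "\<And>i. i \<in> I \<Longrightarrow> x i \<in> \<C>"
      "\<And>q v. v \<in> T q \<Longrightarrow> b q *\<^sub>R v = (\<Sum>i\<in>I. v (x i) *\<^sub>R E i q)"
      "\<And>i j f. i \<in> I \<Longrightarrow> j \<in> I \<Longrightarrow> f \<in> \<C> \<Longrightarrow> E i p (\<lambda>q. E j q f) = E j p (\<lambda>q. E i q f)"
    by (rule frame_at[of p]) (rule that)
  let ?g = "\<lambda>q. \<Sum>i\<in>I. \<xi> (E i p) * x i q"
  show ?thesis
  proof
    show g: "?g \<in> \<C>" by (intro sum_smooth cmult_smooth fr(6))
    show "d0 A ?g p = \<xi>"
    proof (rule cotangent_eqI[OF form_cotangent[OF d0_form[OF g]] assms])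
      fix v assume v: "v \<in> T p"
      have "\<xi> v = \<xi> (\<Sum>i\<in>I. v (x i) *\<^sub>R E i p)" using fr(7)[OF v] fr(3) by simp
      also have "\<dots> = (\<Sum>i\<in>I. v (x i) * \<xi> (E i p))"
        using fr(5) by (simp add: cotangent_apply_sum[OF assms] cotangent_apply_scale[OF assms]
            tangent_scale field_tangent)
      also have "\<dots> = (\<Sum>i\<in>I. \<xi> (E i p) * v (x i))"
        by (intro sum.cong refl mult.commute)
      also have "\<dots> = v ?g"
        using fr(6) by (simp add: tangent_apply_sum[OF v] tangent_apply_cmult[OF v] cmult_smooth)
      finally show "d0 A ?g p v = \<xi> v" by (simp add: d0_apply[OF v])
    qed
  qed
qed

subsection \<open>Tensoriality\<close>

text \<open>After multiplication by the cutoff, which does not change \<open>F\<close>, a field is the combination of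
  the frame fields with coefficients \<open>X(x i)\<close>, so \<open>F X\<close> depends only on the numbers \<open>X p (x i)\<close>.\<close>

lemma field_tensorial:
  fixes F :: "('m \<Rightarrow> 'm tangent) \<Rightarrow> real"
  assumes add: "\<And>X Y. X \<in> \<X> \<Longrightarrow> Y \<in> \<X> \<Longrightarrow> F (\<lambda>q. X q + Y q) = F X + F Y"
    and mult: "\<And>f X. f \<in> \<C> \<Longrightarrow> X \<in> \<X> \<Longrightarrow> F (\<lambda>q. f q *\<^sub>R X q) = f p * F X"
    and X: "X \<in> \<X>" and Y: "Y \<in> \<X>" and eq: "X p = Y p"
  shows "F X = F Y"
proof -
  obtain I b E x where fr: "finite (I::'e set)" "b \<in> \<C>" "b p = 1" "\<And>v. v \<in> T p \<Longrightarrow> v b = 0"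
      "\<And>i. i \<in> I \<Longrightarrow> E i \<in> \<X>" "\<And>i. i \<in> I \<Longrightarrow> x i \<in> \<C>"
      "\<And>q v. v \<in> T q \<Longrightarrow> b q *\<^sub>R v = (\<Sum>i\<in>I. v (x i) *\<^sub>R E i q)"
      "\<And>i j f. i \<in> I \<Longrightarrow> j \<in> I \<Longrightarrow> f \<in> \<C> \<Longrightarrow> E i p (\<lambda>q. E j q f) = E j p (\<lambda>q. E i q f)"
    by (rule frame_at[of p]) (rule that)
  have F0: "F (\<lambda>q. 0) = 0" using mult[OF const_smooth field_zero, of 0] by simp
  have Fsum: "F (\<lambda>q. \<Sum>i\<in>J. Z i q) = (\<Sum>i\<in>J. F (Z i))" if "\<And>i. i \<in> J \<Longrightarrow> Z i \<in> \<X>"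
    for J :: "'e set" and Z
    using that by (induction J rule: infinite_finite_induct) (auto simp: F0 add field_sum)
  have "F Z = (\<Sum>i\<in>I. Z p (x i) * F (E i))" if Z: "Z \<in> \<X>" for Z
  proof -
    have "F Z = F (\<lambda>q. b q *\<^sub>R Z q)" using mult[OF fr(2) Z] fr(3) by simp
    also have "\<dots> = F (\<lambda>q. \<Sum>i\<in>I. Z q (x i) *\<^sub>R E i q)" using fr(7)[OF field_tangent[OF Z]] by simp
    also have "\<dots> = (\<Sum>i\<in>I. Z p (x i) * F (E i))"
      using fr by (simp add: Fsum mult field_mult field_smooth Z)
    finally show ?thesis .
  qed
  then show ?thesis using X Y eq by simp
qed

text \<open>Dual to the argument for fields: \<open>b \<xi> = \<Sum>\<^sub>i \<xi>(E i) d(x i)\<close>.\<close>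

lemma form_tensorial:
  fixes F :: "('m \<Rightarrow> 'm cotangent) \<Rightarrow> real"
  assumes add: "\<And>\<xi> \<eta>. \<xi> \<in> \<F> \<Longrightarrow> \<eta> \<in> \<F> \<Longrightarrow> F (\<lambda>q. \<xi> q + \<eta> q) = F \<xi> + F \<eta>"
    and mult: "\<And>f \<xi>. f \<in> \<C> \<Longrightarrow> \<xi> \<in> \<F> \<Longrightarrow> F (\<lambda>q. f q *\<^sub>R \<xi> q) = f p * F \<xi>"
    and \<xi>: "\<xi> \<in> \<F>" and \<eta>: "\<eta> \<in> \<F>" and eq: "\<xi> p = \<eta> p"
  shows "F \<xi> = F \<eta>"
proof -
  obtain I b E x where fr: "finite (I::'e set)" "b \<in> \<C>" "b p = 1" "\<And>v. v \<in> T p \<Longrightarrow> v b = 0"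
      "\<And>i. i \<in> I \<Longrightarrow> E i \<in> \<X>" "\<And>i. i \<in> I \<Longrightarrow> x i \<in> \<C>"
      "\<And>q v. v \<in> T q \<Longrightarrow> b q *\<^sub>R v = (\<Sum>i\<in>I. v (x i) *\<^sub>R E i q)"
      "\<And>i j f. i \<in> I \<Longrightarrow> j \<in> I \<Longrightarrow> f \<in> \<C> \<Longrightarrow> E i p (\<lambda>q. E j q f) = E j p (\<lambda>q. E i q f)"
    by (rule frame_at[of p]) (rule that)
  have F0: "F (\<lambda>q. 0) = 0" using mult[OF const_smooth form_zero, of 0] by simp
  have Fsum: "F (\<lambda>q. \<Sum>i\<in>J. \<zeta> i q) = (\<Sum>i\<in>J. F (\<zeta> i))" if "\<And>i. i \<in> J \<Longrightarrow> \<zeta> i \<in> \<F>"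
    for J :: "'e set" and \<zeta>
    using that by (induction J rule: infinite_finite_induct) (auto simp: F0 add form_sum)
  have "F \<zeta> = (\<Sum>i\<in>I. \<zeta> p (E i p) * F (d0 A (x i)))" if \<zeta>: "\<zeta> \<in> \<F>" for \<zeta>
  proof -
    have "(\<lambda>q. b q *\<^sub>R \<zeta> q) = (\<lambda>q. \<Sum>i\<in>I. \<zeta> q (E i q) *\<^sub>R d0 A (x i) q)"
    proof (rule form_eqI)
      show "(\<lambda>q. b q *\<^sub>R \<zeta> q) \<in> \<F>" "(\<lambda>q. \<Sum>i\<in>I. \<zeta> q (E i q) *\<^sub>R d0 A (x i) q) \<in> \<F>"
        using form_mult[OF fr(2) \<zeta>]
        by (simp_all add: form_sum form_mult[OF form_smooth[OF \<zeta> fr(5)] d0_form[OF fr(6)]])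
      fix q Z assume Z: "Z \<in> \<X>"
      note \<zeta>q = form_cotangent[OF \<zeta>] and Zq = field_tangent[OF Z]
      have "b q * \<zeta> q (Z q) = \<zeta> q (b q *\<^sub>R Z q)"
        by (simp add: cotangent_apply_scale[OF \<zeta>q Zq])
      also have "\<dots> = \<zeta> q (\<Sum>i\<in>I. Z q (x i) *\<^sub>R E i q)"
        using fr(7)[OF Zq] by simp
      also have "\<dots> = (\<Sum>i\<in>I. \<zeta> q (E i q) * Z q (x i))"
        using fr(5) by (simp add: cotangent_apply_sum[OF \<zeta>q] cotangent_apply_scale[OF \<zeta>q]
            tangent_scale field_tangent mult.commute)
      finally show "(b q *\<^sub>R \<zeta> q) (Z q) = (\<Sum>i\<in>I. \<zeta> q (E i q) *\<^sub>R d0 A (x i) q) (Z q)"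
        by (simp add: sum_fun_apply scaleR_fun_def d0_apply[OF Zq])
    qed
    then have "F (\<lambda>q. b q *\<^sub>R \<zeta> q) = (\<Sum>i\<in>I. \<zeta> p (E i p) * F (d0 A (x i)))"
      using fr by (simp add: Fsum mult form_mult form_smooth d0_form \<zeta>)
    then show ?thesis using mult[OF fr(2) \<zeta>] fr(3) by simp
  qed
  then show ?thesis using \<xi> \<eta> eq by simp
qed

text \<open>Lie derivative and exterior derivative are defined by a formula in a chosen extension of the
  argument vector. If the formula is linear over smooth functions, it defines a one-form, and the
  chosen extension may be replaced by any vector field.\<close>

lemma tensorial_form:
  fixes F :: "'m \<Rightarrow> ('m \<Rightarrow> 'm tangent) \<Rightarrow> real"
  assumes \<theta>: "\<And>p v. \<theta> p v = (if v \<in> T p then F p (extend_tangent A p v) else 0)"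
    and add: "\<And>p X Y. X \<in> \<X> \<Longrightarrow> Y \<in> \<X> \<Longrightarrow> F p (\<lambda>q. X q + Y q) = F p X + F p Y"
    and mult: "\<And>p f X. f \<in> \<C> \<Longrightarrow> X \<in> \<X> \<Longrightarrow> F p (\<lambda>q. f q *\<^sub>R X q) = f p * F p X"
    and smooth: "\<And>X. X \<in> \<X> \<Longrightarrow> (\<lambda>p. F p X) \<in> \<C>"
  shows "\<theta> \<in> \<F>" and "Z \<in> \<X> \<Longrightarrow> \<theta> p (Z p) = F p Z"
proof -
  have eval: "\<theta> p (Z p) = F p Z" if "Z \<in> \<X>" for p Z
    unfolding \<theta> using that extend_tangent[OF field_tangent[OF that]]
    by (auto simp: field_tangent intro: field_tensorial[OF add mult])
  then show "Z \<in> \<X> \<Longrightarrow> \<theta> p (Z p) = F p Z" .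
  show "\<theta> \<in> \<F>"
  proof (rule formI)
    show "(\<lambda>p. \<theta> p (X p)) \<in> \<C>" if "X \<in> \<X>" for X using smooth[OF that] by (simp add: eval that)
    show "\<theta> p \<in> T' p" for p
      unfolding cotangent_space_def linear_between_def
    proof (intro CollectI conjI ballI allI impI)
      fix v assume v: "v \<in> T p"
      then obtain X where X: "X \<in> \<X>" "X p = v" using tangent_extends by blast
      show "\<theta> p (c *\<^sub>R v) = c *\<^sub>R \<theta> p v" for c
        using eval[OF field_scale[OF X(1)], of p c] eval[OF X(1), of p] mult[OF const_smooth X(1), of p c] X(2)
        by simp
      fix w assume "w \<in> T p"
      then obtain Y where Y: "Y \<in> \<X>" "Y p = w" using tangent_extends by blast
      show "\<theta> p (v + w) = \<theta> p v + \<theta> p w"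
        using eval[OF field_add[OF X(1) Y(1)], of p] eval[OF X(1), of p] eval[OF Y(1), of p] X Y add
        by simp
    qed (simp_all add: \<theta>)
  qed
qed

subsection \<open>The Lie bracket\<close>

lemma lie_bracket_apply: "lie_bracket X Y p f = X p (\<lambda>q. Y q f) - Y p (\<lambda>q. X q f)"
  by (simp add: lie_bracket_def vf_apply_def)

lemma lie_bracket_not_smooth:
  "X \<in> \<X> \<Longrightarrow> Y \<in> \<X> \<Longrightarrow> f \<notin> \<C> \<Longrightarrow> lie_bracket X Y p f = 0"
  by (simp add: lie_bracket_apply tangent_not_smooth[OF field_tangent] tangent_apply_const[OF field_tangent])

text \<open>A bracket of fields is a derivation, but it has to be exhibited as a tangent vector. In the frame at
  \<open>p\<close> the first-order terms have the components \<open>[X, Y](x i)\<close>, and the second-order terms cancel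
  because the frame fields commute at \<open>p\<close>.\<close>

lemma lie_bracket_field:
  assumes X: "X \<in> \<X>" and Y: "Y \<in> \<X>"
  shows "lie_bracket X Y \<in> \<X>"
proof (rule fieldI)
  fix f assume f: "f \<in> \<C>"
  show "(\<lambda>p. lie_bracket X Y p f) \<in> \<C>"
    unfolding lie_bracket_apply by (simp add: diff_smooth field_smooth X Y f)
next
  fix p
  obtain I b E x where fr: "finite (I::'e set)" "b \<in> \<C>" "b p = 1" "\<And>v. v \<in> T p \<Longrightarrow> v b = 0"
      "\<And>i. i \<in> I \<Longrightarrow> E i \<in> \<X>" "\<And>i. i \<in> I \<Longrightarrow> x i \<in> \<C>"
      "\<And>q v. v \<in> T q \<Longrightarrow> b q *\<^sub>R v = (\<Sum>i\<in>I. v (x i) *\<^sub>R E i q)"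
      "\<And>i j f. i \<in> I \<Longrightarrow> j \<in> I \<Longrightarrow> f \<in> \<C> \<Longrightarrow> E i p (\<lambda>q. E j q f) = E j p (\<lambda>q. E i q f)"
    by (rule frame_at[of p]) (rule that)
  let ?c = "\<lambda>i. lie_bracket X Y p (x i)"
  \<comment> \<open>Expand \<open>W\<close> in the frame near \<open>p\<close>, differentiate, and expand \<open>V\<close> at \<open>p\<close>. The cutoff in the first
    expansion does not contribute, as its derivatives at \<open>p\<close> vanish.\<close>
  have second: "V p (\<lambda>q. W q f) = (\<Sum>i\<in>I. E i p f * V p (\<lambda>q. W q (x i)))
      + (\<Sum>i\<in>I. \<Sum>j\<in>I. W p (x i) * V p (x j) * E j p (\<lambda>q. E i q f))"
    if V: "V \<in> \<X>" and W: "W \<in> \<X>" and f: "f \<in> \<C>" for V W f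
  proof -
    have Vp: "V p \<in> T p" using field_tangent[OF V] .
    have Wf: "(\<lambda>q. W q f) \<in> \<C>" by (rule field_smooth[OF W f])
    have EV: "V p h = (\<Sum>j\<in>I. V p (x j) * E j p h)" for h
      using fun_cong[OF fr(7)[OF Vp], of h] fr(3) by (simp add: sum_fun_apply scaleR_fun_def)
    have bW: "b q * W q f = (\<Sum>i\<in>I. W q (x i) * E i q f)" for q
      using fun_cong[OF fr(7)[OF field_tangent[OF W]], of q f] by (simp add: sum_fun_apply scaleR_fun_def)
    have "V p (\<lambda>q. W q f) = V p (\<lambda>q. b q * W q f)"
      using tangent_apply_mult[OF Vp fr(2) Wf] fr(3) fr(4)[OF Vp] by simp
    also have "\<dots> = (\<Sum>i\<in>I. V p (\<lambda>q. W q (x i) * E i q f))"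
      unfolding bW
      by (rule tangent_apply_sum[OF Vp], rule mult_smooth[OF field_smooth[OF W fr(6)] field_smooth[OF fr(5) f]])
    also have "\<dots> = (\<Sum>i\<in>I. E i p f * V p (\<lambda>q. W q (x i)) + W p (x i) * V p (\<lambda>q. E i q f))"
      using tangent_apply_mult[OF Vp field_smooth[OF W fr(6)] field_smooth[OF fr(5) f]]
      by (simp add: add.commute)
    also have "\<dots> = (\<Sum>i\<in>I. E i p f * V p (\<lambda>q. W q (x i)))
        + (\<Sum>i\<in>I. W p (x i) * (\<Sum>j\<in>I. V p (x j) * E j p (\<lambda>q. E i q f)))"
      unfolding sum.distrib using EV by metis
    finally show ?thesis by (simp add: sum_distrib_left mult.assoc)
  qed
  have "lie_bracket X Y p = (\<Sum>i\<in>I. ?c i *\<^sub>R E i p)"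
  proof
    fix f
    show "lie_bracket X Y p f = (\<Sum>i\<in>I. ?c i *\<^sub>R E i p) f"
    proof (cases "f \<in> \<C>")
      case True
      have "(\<Sum>i\<in>I. \<Sum>j\<in>I. Y p (x i) * X p (x j) * E j p (\<lambda>q. E i q f))
          = (\<Sum>i\<in>I. \<Sum>j\<in>I. X p (x i) * Y p (x j) * E j p (\<lambda>q. E i q f))"
        by (subst sum.swap) (intro sum.cong refl, simp add: fr(8)[OF _ _ True] mult_ac)
      then show ?thesis
        unfolding lie_bracket_apply[of X Y p f] second[OF X Y True] second[OF Y X True]
        by (simp add: sum_fun_apply scaleR_fun_def lie_bracket_apply sum_subtractf algebra_simps)
    next
      case False
      then show ?thesis
        using fr(5) by (simp add: lie_bracket_not_smooth X Y sum_fun_apply scaleR_fun_def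
            tangent_not_smooth[OF field_tangent])
    qed
  qed
  moreover have "(\<Sum>i\<in>I. ?c i *\<^sub>R E i p) \<in> T p"
    by (intro subspace_sum[OF subspace_tangent] tangent_scale field_tangent[OF fr(5)])
  ultimately show "lie_bracket X Y p \<in> T p" by (simp only:)
qed

lemma lie_bracket_antisym: "lie_bracket X Y p = - lie_bracket Y X p"
  by (rule ext) (simp add: lie_bracket_apply)

lemma lie_bracket_add_right:
  assumes "X \<in> \<X>" "Y \<in> \<X>" "Z \<in> \<X>"
  shows "lie_bracket X (\<lambda>q. Y q + Z q) p = lie_bracket X Y p + lie_bracket X Z p"
proof (rule tangent_eqI[of _ p])
  fix f assume "f \<in> \<C>"
  then show "lie_bracket X (\<lambda>q. Y q + Z q) p f = (lie_bracket X Y p + lie_bracket X Z p) f"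
    using assms by (simp add: lie_bracket_apply plus_fun_def
        tangent_apply_add[OF field_tangent[OF assms(1)]] field_smooth)
qed (simp_all add: assms tangent_add field_tangent lie_bracket_field field_add)

lemma lie_bracket_mult_right:
  assumes "X \<in> \<X>" "Z \<in> \<X>" "g \<in> \<C>"
  shows "lie_bracket X (\<lambda>q. g q *\<^sub>R Z q) p = X p g *\<^sub>R Z p + g p *\<^sub>R lie_bracket X Z p"
proof (rule tangent_eqI[of _ p])
  fix f assume "f \<in> \<C>"
  then show "lie_bracket X (\<lambda>q. g q *\<^sub>R Z q) p f = (X p g *\<^sub>R Z p + g p *\<^sub>R lie_bracket X Z p) f"
    using assms by (simp add: lie_bracket_apply plus_fun_def scaleR_fun_def
        tangent_apply_mult[OF field_tangent[OF assms(1)]] field_smooth algebra_simps)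
qed (simp_all add: assms tangent_add tangent_scale field_tangent lie_bracket_field field_mult)

lemma lie_bracket_add_left:
  assumes "X \<in> \<X>" "Y \<in> \<X>" "Z \<in> \<X>"
  shows "lie_bracket (\<lambda>q. X q + Y q) Z p = lie_bracket X Z p + lie_bracket Y Z p"
  using lie_bracket_add_right[OF assms(3,1,2), of p]
  by (simp add: lie_bracket_antisym[of _ Z])

lemma lie_bracket_mult_left:
  assumes "X \<in> \<X>" "Z \<in> \<X>" "g \<in> \<C>"
  shows "lie_bracket (\<lambda>q. g q *\<^sub>R X q) Z p = g p *\<^sub>R lie_bracket X Z p - Z p g *\<^sub>R X p"
  using lie_bracket_mult_right[OF assms(2,1,3), of p]
  by (simp add: lie_bracket_antisym[of _ Z])

lemma lie_bracket_scale:
  assumes "X \<in> \<X>" "Y \<in> \<X>"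
  shows "lie_bracket (\<lambda>q. c *\<^sub>R X q) Y p = c *\<^sub>R lie_bracket X Y p"
    and "lie_bracket X (\<lambda>q. c *\<^sub>R Y q) p = c *\<^sub>R lie_bracket X Y p"
  using lie_bracket_mult_left[OF assms const_smooth, of c p]
    lie_bracket_mult_right[OF assms const_smooth, of c p]
  by (simp_all add: tangent_apply_const[OF field_tangent] assms)

subsection \<open>Lie derivative and exterior derivative of one-forms\<close>

lemma
  assumes X: "X \<in> \<X>" and \<eta>: "\<eta> \<in> \<F>"
  shows lie_derivative_form: "lie_derivative A X \<eta> \<in> \<F>"
    and lie_derivative_apply: "Z \<in> \<X> \<Longrightarrow> lie_derivative A X \<eta> p (Z p) = X p (\<lambda>q. \<eta> q (Z q)) - \<eta> p (lie_bracket X Z p)"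
proof -
  let ?F = "\<lambda>p Z. X p (\<lambda>q. \<eta> q (Z q)) - \<eta> p (lie_bracket X Z p)"
  note \<eta>p = form_cotangent[OF \<eta>] and Xp = field_tangent[OF X]
  have def_eq: "lie_derivative A X \<eta> p v = (if v \<in> T p then ?F p (extend_tangent A p v) else 0)" for p v
    by (simp add: lie_derivative_def Let_def contract_def)
  have add: "?F p (\<lambda>q. Y q + Z q) = ?F p Y + ?F p Z" if "Y \<in> \<X>" "Z \<in> \<X>" for p Y Z
    using that by (simp add: lie_bracket_add_right X cotangent_apply_add[OF \<eta>p] field_tangent
        tangent_apply_add[OF Xp] form_smooth \<eta> lie_bracket_field)
  have mult: "?F p (\<lambda>q. g q *\<^sub>R Z q) = g p * ?F p Z" if "g \<in> \<C>" "Z \<in> \<X>" for p g Z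
    using that by (simp add: lie_bracket_mult_right X cotangent_apply_add[OF \<eta>p]
        cotangent_apply_scale[OF \<eta>p] tangent_scale field_tangent
        tangent_apply_mult[OF Xp] form_smooth \<eta> lie_bracket_field algebra_simps)
  have smooth: "(\<lambda>p. ?F p Z) \<in> \<C>" if "Z \<in> \<X>" for Z
    using that by (simp add: diff_smooth field_smooth form_smooth X \<eta> lie_bracket_field)
  show "lie_derivative A X \<eta> \<in> \<F>"
    by (rule tensorial_form(1)[where F = ?F, OF def_eq add mult smooth])
  show "lie_derivative A X \<eta> p (Z p) = ?F p Z" if "Z \<in> \<X>"
    by (rule tensorial_form(2)[where F = ?F, OF def_eq add mult smooth that])
qed

lemma
  assumes Y: "Y \<in> \<X>" and \<xi>: "\<xi> \<in> \<F>"
  shows interior_d_form: "interior_d A Y \<xi> \<in> \<F>"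
    and interior_d_apply: "Z \<in> \<X> \<Longrightarrow> interior_d A Y \<xi> p (Z p) =
      Y p (\<lambda>q. \<xi> q (Z q)) - Z p (\<lambda>q. \<xi> q (Y q)) - \<xi> p (lie_bracket Y Z p)"
proof -
  let ?F = "\<lambda>p Z. Y p (\<lambda>q. \<xi> q (Z q)) - Z p (\<lambda>q. \<xi> q (Y q)) - \<xi> p (lie_bracket Y Z p)"
  note \<xi>p = form_cotangent[OF \<xi>] and Yp = field_tangent[OF Y]
  have def_eq: "interior_d A Y \<xi> p v = (if v \<in> T p then ?F p (extend_tangent A p v) else 0)" for p v
    by (simp add: interior_d_def d1_def contract_def)
  have add: "?F p (\<lambda>q. W q + Z q) = ?F p W + ?F p Z" if "W \<in> \<X>" "Z \<in> \<X>" for p W Z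
    using that by (simp add: lie_bracket_add_right Y cotangent_apply_add[OF \<xi>p] field_tangent
        tangent_apply_add[OF Yp] form_smooth \<xi> lie_bracket_field)
  have mult: "?F p (\<lambda>q. g q *\<^sub>R Z q) = g p * ?F p Z" if "g \<in> \<C>" "Z \<in> \<X>" for p g Z
    using that by (simp add: lie_bracket_mult_right Y cotangent_apply_add[OF \<xi>p]
        cotangent_apply_scale[OF \<xi>p] tangent_scale field_tangent scaleR_fun_def[of "g p" "Z p"]
        tangent_apply_mult[OF Yp] form_smooth \<xi> lie_bracket_field algebra_simps)
  have smooth: "(\<lambda>p. ?F p Z) \<in> \<C>" if "Z \<in> \<X>" for Z
    using that by (simp add: diff_smooth field_smooth form_smooth Y \<xi> lie_bracket_field)
  show "interior_d A Y \<xi> \<in> \<F>"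
    by (rule tensorial_form(1)[where F = ?F, OF def_eq add mult smooth])
  show "interior_d A Y \<xi> p (Z p) = ?F p Z" if "Z \<in> \<X>"
    by (rule tensorial_form(2)[where F = ?F, OF def_eq add mult smooth that])
qed

lemma lie_derivative_add:
  assumes "X \<in> \<X>" "\<eta> \<in> \<F>" "\<zeta> \<in> \<F>"
  shows "lie_derivative A X (\<lambda>q. \<eta> q + \<zeta> q) p = lie_derivative A X \<eta> p + lie_derivative A X \<zeta> p"
proof -
  have "lie_derivative A X (\<lambda>q. \<eta> q + \<zeta> q) = (\<lambda>p. lie_derivative A X \<eta> p + lie_derivative A X \<zeta> p)"
  proof (rule form_eqI)
    fix p Z assume "Z \<in> \<X>"
    then show "lie_derivative A X (\<lambda>q. \<eta> q + \<zeta> q) p (Z p)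
        = (lie_derivative A X \<eta> p + lie_derivative A X \<zeta> p) (Z p)"
      using assms tangent_apply_add[OF field_tangent[OF assms(1)]
          form_smooth[OF assms(2)] form_smooth[OF assms(3)]]
      by (simp add: lie_derivative_apply form_add)
  qed (simp_all add: assms form_add lie_derivative_form)
  then show ?thesis by simp
qed

lemma lie_derivative_scale:
  assumes "X \<in> \<X>" "\<eta> \<in> \<F>"
  shows "lie_derivative A X (\<lambda>q. c *\<^sub>R \<eta> q) p = c *\<^sub>R lie_derivative A X \<eta> p"
proof -
  have "lie_derivative A X (\<lambda>q. c *\<^sub>R \<eta> q) = (\<lambda>p. c *\<^sub>R lie_derivative A X \<eta> p)"
  proof (rule form_eqI)
    fix p Z assume "Z \<in> \<X>"
    then show "lie_derivative A X (\<lambda>q. c *\<^sub>R \<eta> q) p (Z p) = (c *\<^sub>R lie_derivative A X \<eta> p) (Z p)"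
      using assms tangent_apply_cmult[OF field_tangent[OF assms(1)] form_smooth[OF assms(2)]]
      by (simp add: lie_derivative_apply form_scale algebra_simps)
  qed (simp_all add: assms form_scale lie_derivative_form)
  then show ?thesis by simp
qed

lemma interior_d_add:
  assumes "X \<in> \<X>" "\<eta> \<in> \<F>" "\<zeta> \<in> \<F>"
  shows "interior_d A X (\<lambda>q. \<eta> q + \<zeta> q) p = interior_d A X \<eta> p + interior_d A X \<zeta> p"
proof -
  have "interior_d A X (\<lambda>q. \<eta> q + \<zeta> q) = (\<lambda>p. interior_d A X \<eta> p + interior_d A X \<zeta> p)"
  proof (rule form_eqI)
    fix p Z assume Z: "Z \<in> \<X>"
    then show "interior_d A X (\<lambda>q. \<eta> q + \<zeta> q) p (Z p)
        = (interior_d A X \<eta> p + interior_d A X \<zeta> p) (Z p)"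
      using assms tangent_apply_add[OF field_tangent[OF assms(1)]
          form_smooth[OF assms(2) Z] form_smooth[OF assms(3) Z]]
        tangent_apply_add[OF field_tangent[OF Z]
          form_smooth[OF assms(2,1)] form_smooth[OF assms(3,1)]]
      by (simp add: interior_d_apply form_add)
  qed (simp_all add: assms form_add interior_d_form)
  then show ?thesis by simp
qed

lemma interior_d_scale:
  assumes "X \<in> \<X>" "\<eta> \<in> \<F>"
  shows "interior_d A X (\<lambda>q. c *\<^sub>R \<eta> q) p = c *\<^sub>R interior_d A X \<eta> p"
proof -
  have "interior_d A X (\<lambda>q. c *\<^sub>R \<eta> q) = (\<lambda>p. c *\<^sub>R interior_d A X \<eta> p)"
  proof (rule form_eqI)
    fix p Z assume Z: "Z \<in> \<X>"
    then show "interior_d A X (\<lambda>q. c *\<^sub>R \<eta> q) p (Z p) = (c *\<^sub>R interior_d A X \<eta> p) (Z p)"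
      using assms tangent_apply_cmult[OF field_tangent[OF assms(1)] form_smooth[OF assms(2) Z]]
        tangent_apply_cmult[OF field_tangent[OF Z] form_smooth[OF assms(2,1)]]
      by (simp add: interior_d_apply form_scale algebra_simps)
  qed (simp_all add: assms form_scale interior_d_form)
  then show ?thesis by simp
qed

lemma lie_derivative_diff:
  assumes "X \<in> \<X>" "\<eta> \<in> \<F>" "\<zeta> \<in> \<F>"
  shows "lie_derivative A X (\<lambda>q. \<eta> q - \<zeta> q) p = lie_derivative A X \<eta> p - lie_derivative A X \<zeta> p"
  using lie_derivative_add[OF assms(1,2) form_scale[OF assms(3), where c = "-1"]]
  by (simp add: lie_derivative_scale[OF assms(1,3), where c = "-1", simplified])

lemma interior_d_diff:
  assumes "X \<in> \<X>" "\<eta> \<in> \<F>" "\<zeta> \<in> \<F>"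
  shows "interior_d A X (\<lambda>q. \<eta> q - \<zeta> q) p = interior_d A X \<eta> p - interior_d A X \<zeta> p"
  using interior_d_add[OF assms(1,2) form_scale[OF assms(3), where c = "-1"]]
  by (simp add: interior_d_scale[OF assms(1,3), where c = "-1", simplified])

lemma Cartan_zero:
  assumes "X \<in> \<X>" "\<eta> \<in> \<F>"
  shows "lie_derivative A X (\<lambda>q. 0) p = 0" "interior_d A X (\<lambda>q. 0) p = 0"
    "lie_derivative A (\<lambda>q. 0) \<eta> p = 0" "interior_d A (\<lambda>q. 0) \<eta> p = 0"
    "lie_bracket X (\<lambda>q. 0) p = 0" "lie_bracket (\<lambda>q. 0) X p = 0"
proof -
  have b: "lie_bracket Y (\<lambda>q. 0) p = 0" "lie_bracket (\<lambda>q. 0) Y p = 0" if "Y \<in> \<X>" for Y p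
    using lie_bracket_scale[OF that that, of 0 p] by simp_all
  show "lie_bracket X (\<lambda>q. 0) p = 0" "lie_bracket (\<lambda>q. 0) X p = 0" by (simp_all add: b assms)
  show "lie_derivative A X (\<lambda>q. 0) p = 0" "interior_d A X (\<lambda>q. 0) p = 0"
    using lie_derivative_scale[OF assms, of 0 p] interior_d_scale[OF assms, of 0 p] by simp_all
  have z: "\<eta> q 0 = 0" for q using cotangent_apply_zero[OF form_cotangent[OF assms(2)]] .
  have "lie_derivative A (\<lambda>q. 0) \<eta> = (\<lambda>p. 0)"
    by (rule form_eqI)
      (simp_all add: lie_derivative_form lie_derivative_apply field_zero form_zero assms b z)
  then show "lie_derivative A (\<lambda>q. 0) \<eta> p = 0" by simp
  have "interior_d A (\<lambda>q. 0) \<eta> = (\<lambda>p. 0)"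
    by (rule form_eqI)
      (simp_all add: interior_d_form interior_d_apply field_zero form_zero assms b z
        tangent_apply_const[OF field_tangent])
  then show "interior_d A (\<lambda>q. 0) \<eta> p = 0" by simp
qed

subsection \<open>Bundle maps\<close>

lemma map_T_TD:
  assumes "map_T_T A h"
  shows map_T_T_field: "X \<in> \<X> \<Longrightarrow> (\<lambda>p. h p (X p)) \<in> \<X>"
    and map_T_T_linear: "linear_between (T p) (T p) (h p)"
  using assms by (simp_all add: bundle_map_def)

lemma map_T_TstarD:
  assumes "map_T_Tstar A h"
  shows map_T_Tstar_form: "X \<in> \<X> \<Longrightarrow> (\<lambda>p. h p (X p)) \<in> \<F>"
    and map_T_Tstar_linear: "linear_between (T p) (T' p) (h p)"
  using assms by (simp_all add: bundle_map_def)

lemma map_Tstar_TD: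
  assumes "map_Tstar_T A h"
  shows map_Tstar_T_field: "\<xi> \<in> \<F> \<Longrightarrow> (\<lambda>p. h p (\<xi> p)) \<in> \<X>"
    and map_Tstar_T_linear: "linear_between (T' p) (T p) (h p)"
  using assms by (simp_all add: bundle_map_def)

lemma bcomp_apply: "bcomp g h p u = g p (h p u)"
  by (simp add: bcomp_def)

lemma bcomp_map_T_Tstar: "map_T_Tstar A \<Omega> \<Longrightarrow> map_T_T A h \<Longrightarrow> map_T_Tstar A (bcomp \<Omega> h)"
  by (auto simp: bundle_map_def linear_between_def bcomp_def)

lemma bcomp_map_Tstar_T: "map_T_T A h \<Longrightarrow> map_Tstar_T A \<Lambda> \<Longrightarrow> map_Tstar_T A (bcomp h \<Lambda>)"
  by (auto simp: bundle_map_def linear_between_def bcomp_def)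

lemma dual_map_apply: "v \<in> T p \<Longrightarrow> dual_map A h p \<xi> v = \<xi> (h p v)"
  by (simp add: dual_map_def)

lemma dual_map_cotangent:
  assumes h: "map_T_T A h" and \<xi>: "\<xi> \<in> T' p"
  shows "dual_map A h p \<xi> \<in> T' p"
  using linear_between_mem[OF map_T_T_linear[OF h]] linear_between_add[OF map_T_T_linear[OF h]]
    linear_between_scale[OF map_T_T_linear[OF h]]
  by (auto simp: cotangent_space_def[of A p] linear_between_def dual_map_def tangent_add tangent_scale
      cotangent_apply_add[OF \<xi>] cotangent_apply_scale[OF \<xi>, unfolded real_scaleR_def])

lemma dual_map_form:
  assumes h: "map_T_T A h" and \<xi>: "\<xi> \<in> \<F>"
  shows "(\<lambda>p. dual_map A h p (\<xi> p)) \<in> \<F>"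
proof (rule formI)
  show "dual_map A h p (\<xi> p) \<in> T' p" for p by (rule dual_map_cotangent[OF h form_cotangent[OF \<xi>]])
  show "(\<lambda>p. dual_map A h p (\<xi> p) (X p)) \<in> \<C>" if X: "X \<in> \<X>" for X
    using form_smooth[OF \<xi> map_T_T_field[OF h X]] by (simp add: dual_map_apply field_tangent[OF X])
qed

lemma dual_map_linear:
  assumes "map_T_T A h"
  shows "linear_between (T' p) (T' p) (dual_map A h p)"
  unfolding linear_between_def
  using dual_map_cotangent[OF assms]
  by (auto simp: dual_map_def plus_fun_def scaleR_fun_def)

text \<open>The assumption at \<open>f = 1\<close> gives \<open>dh = 0\<close> at \<open>p\<close>, so the Leibniz rule leaves \<open>h p df = 0\<close>. A nonzero
  tangent vector provides an \<open>f\<close> with \<open>df \<noteq> 0\<close>.\<close>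

lemma tensorial_symmetric_vanishes:
  assumes h: "h \<in> \<C>" and d: "\<And>f Z. f \<in> \<C> \<Longrightarrow> Z \<in> \<X> \<Longrightarrow> Z p (\<lambda>q. f q * h q) = 0"
    and v: "v \<in> T p" "v \<noteq> 0"
  shows "h p = 0"
proof -
  obtain Z where Z: "Z \<in> \<X>" "Z p = v" using tangent_extends[OF v(1)] by blast
  obtain f where f: "f \<in> \<C>" "v f \<noteq> 0"
    using tangent_eqI[OF v(1) tangent_zero] v(2) by (auto simp: zero_fun_def)
  have "v h = 0" using d[OF const_smooth Z(1), of 1] Z(2) by simp
  moreover have "f p * v h + h p * v f = 0"
    using d[OF f(1) Z(1)] tangent_apply_mult[OF v(1) f(1) h] Z(2) by simp
  ultimately show ?thesis using f(2) by simp
qed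

section \<open>Closed two-forms\<close>

text \<open>The cotangent part of the deformed Courant bracket of two vector fields. For skew \<open>\<Omega>\<close> it is the
  contraction of \<open>d\<Omega>\<close> with \<open>X\<close> and \<open>Y\<close>, but it is also meaningful when skewness is not yet known.\<close>

definition closed_defect ::
    "('m \<Rightarrow> 'm tangent \<Rightarrow> 'm cotangent) \<Rightarrow> ('m \<Rightarrow> 'm tangent) \<Rightarrow> ('m \<Rightarrow> 'm tangent) \<Rightarrow> 'm \<Rightarrow> 'm cotangent" where
  "closed_defect \<Omega> X Y = (\<lambda>p. lie_derivative A X (\<lambda>q. \<Omega> q (Y q)) p
     - interior_d A Y (\<lambda>q. \<Omega> q (X q)) p - \<Omega> p (lie_bracket X Y p))"

context
  fixes \<Omega>
  assumes \<Omega>: "map_T_Tstar A \<Omega>"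
begin

lemma closed_defect_form:
  "X \<in> \<X> \<Longrightarrow> Y \<in> \<X> \<Longrightarrow> closed_defect \<Omega> X Y \<in> \<F>"
  unfolding closed_defect_def
  by (simp add: form_diff lie_derivative_form interior_d_form map_T_Tstar_form[OF \<Omega>] lie_bracket_field)

lemma closed_defect_apply:
  assumes "X \<in> \<X>" "Y \<in> \<X>" "Z \<in> \<X>"
  shows "closed_defect \<Omega> X Y p (Z p) =
    X p (\<lambda>q. \<Omega> q (Y q) (Z q)) - \<Omega> p (Y p) (lie_bracket X Z p)
    - (Y p (\<lambda>q. \<Omega> q (X q) (Z q)) - Z p (\<lambda>q. \<Omega> q (X q) (Y q)) - \<Omega> p (X p) (lie_bracket Y Z p))
    - \<Omega> p (lie_bracket X Y p) (Z p)"
  unfolding closed_defect_def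
  using assms by (simp add: lie_derivative_apply interior_d_apply map_T_Tstar_form[OF \<Omega>])

text \<open>The sum of the defects for \<open>(X, Y)\<close> and \<open>(Y, X)\<close> is the differential of \<open>\<Omega>(X, Y) + \<Omega>(Y, X)\<close>.
  Since this vanishes for all fields, also for \<open>f Y\<close> in place of \<open>Y\<close>, the symmetric part is 0.\<close>

lemma skew_if_no_closed_defect:
  assumes K: "\<And>X Y. X \<in> \<X> \<Longrightarrow> Y \<in> \<X> \<Longrightarrow> closed_defect \<Omega> X Y = 0"
  shows "skew_T_Tstar A \<Omega>"
  unfolding skew_T_Tstar_def
proof (intro allI ballI)
  fix p v w assume v: "v \<in> T p" and w: "w \<in> T p"
  obtain X Y where X: "X \<in> \<X>" "X p = v" and Y: "Y \<in> \<X>" "Y p = w"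
    using tangent_extends v w by meson
  define s where "s Y q = \<Omega> q (X q) (Y q) + \<Omega> q (Y q) (X q)" for Y q
  have s_smooth: "s Y \<in> \<C>" if "Y \<in> \<X>" for Y
    unfolding s_def
    using add_smooth[OF form_smooth[OF map_T_Tstar_form[OF \<Omega> X(1)] that]
        form_smooth[OF map_T_Tstar_form[OF \<Omega> that] X(1)]] .
  have ds: "Z p (s Y) = 0" if Y: "Y \<in> \<X>" and Z: "Z \<in> \<X>" for Y Z
  proof -
    note \<Omega>p = form_cotangent[OF map_T_Tstar_form[OF \<Omega>]]
    have "0 = closed_defect \<Omega> X Y p (Z p) + closed_defect \<Omega> Y X p (Z p)"
      using K X(1) Y by simp
    also have "\<dots> = Z p (\<lambda>q. \<Omega> q (X q) (Y q)) + Z p (\<lambda>q. \<Omega> q (Y q) (X q))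
        - (\<Omega> p (lie_bracket X Y p) (Z p) + \<Omega> p (lie_bracket Y X p) (Z p))"
      using X(1) Y Z by (simp add: closed_defect_apply)
    also have "\<Omega> p (lie_bracket X Y p) (Z p) + \<Omega> p (lie_bracket Y X p) (Z p) = 0"
    proof -
      have "\<Omega> p (lie_bracket X Y p) + \<Omega> p (lie_bracket Y X p)
          = \<Omega> p (lie_bracket X Y p + lie_bracket Y X p)"
        using linear_between_add[OF map_T_Tstar_linear[OF \<Omega>]] lie_bracket_field X(1) Y field_tangent
        by metis
      also have "\<dots> = 0"
        using lie_bracket_antisym[of X Y p] linear_between_zero[OF map_T_Tstar_linear[OF \<Omega>] subspace_tangent]
        by simp
      finally show ?thesis by (metis plus_fun_apply zero_fun_apply)
    qed
    also have "Z p (\<lambda>q. \<Omega> q (X q) (Y q)) + Z p (\<lambda>q. \<Omega> q (Y q) (X q)) = Z p (s Y)"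
      unfolding s_def
      using tangent_apply_add[OF field_tangent[OF Z] form_smooth[OF map_T_Tstar_form[OF \<Omega> X(1)] Y]
          form_smooth[OF map_T_Tstar_form[OF \<Omega> Y] X(1)]] by simp
    finally show ?thesis by simp
  qed
  \<comment> \<open>If \<open>v = 0\<close> there need not be a nonzero tangent vector at \<open>p\<close>, but then \<open>s\<close> is trivially 0.\<close>
  have "s Y p = 0"
  proof (cases "v = 0")
    case True
    then show ?thesis
      using X(2) cotangent_apply_zero[OF form_cotangent[OF map_T_Tstar_form[OF \<Omega> Y(1)], of p]]
        linear_between_zero[OF map_T_Tstar_linear[OF \<Omega>] subspace_tangent, of p]
      by (simp add: s_def)
  next
    case False
    show ?thesis
    proof (rule tensorial_symmetric_vanishes[OF s_smooth[OF Y(1)] _ v False])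
      fix f Z assume f: "f \<in> \<C>" and Z: "Z \<in> \<X>"
      have "s (\<lambda>q. f q *\<^sub>R Y q) = (\<lambda>q. f q * s Y q)"
        using Y(1) X(1) linear_between_scale[OF map_T_Tstar_linear[OF \<Omega>]]
          cotangent_apply_scale[OF form_cotangent[OF map_T_Tstar_form[OF \<Omega>]]]
        by (simp add: fun_eq_iff s_def field_tangent distrib_left)
      then show "Z p (\<lambda>q. f q * s Y q) = 0" using ds[OF field_mult[OF f Y(1)] Z] by simp
    qed
  qed
  then show "\<Omega> p v w = - \<Omega> p w v" using X Y by (simp add: s_def)
qed

lemma closed_defect_eq_d2:
  assumes "skew_T_Tstar A \<Omega>" "X \<in> \<X>" "Y \<in> \<X>" "Z \<in> \<X>"
  shows "closed_defect \<Omega> X Y p (Z p) = d2 \<Omega> X Y Z p"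
proof -
  have sk: "\<Omega> p v w = - \<Omega> p w v" if "v \<in> T p" "w \<in> T p" for v w
    using assms(1) that unfolding skew_T_Tstar_def by blast
  have "\<Omega> p (Y p) (lie_bracket X Z p) = - \<Omega> p (lie_bracket X Z p) (Y p)"
    "\<Omega> p (X p) (lie_bracket Y Z p) = - \<Omega> p (lie_bracket Y Z p) (X p)"
    by (intro sk field_tangent lie_bracket_field assms)+
  then show ?thesis using assms(2-4)
    by (simp add: closed_defect_apply d2_def Let_def contract_def bapp_def)
qed

text \<open>A two-form has to be skew, which follows from the vanishing of the defect.\<close>

lemma closed_two_form_iff:
  "closed_two_form A \<Omega> \<longleftrightarrow> (\<forall>X\<in>\<X>. \<forall>Y\<in>\<X>. closed_defect \<Omega> X Y = 0)"
proof
  assume c: "closed_two_form A \<Omega>"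
  have "closed_defect \<Omega> X Y = 0" if "X \<in> \<X>" "Y \<in> \<X>" for X Y
  proof (rule form_eqI)
    show "(0 :: 'm \<Rightarrow> 'm cotangent) \<in> \<F>" using form_zero by (simp add: zero_fun_def)
    show "closed_defect \<Omega> X Y p (Z p) = (0 :: 'm \<Rightarrow> 'm cotangent) p (Z p)" if "Z \<in> \<X>" for p Z
      using c that \<open>X \<in> \<X>\<close> \<open>Y \<in> \<X>\<close> by (simp add: closed_two_form_def closed_defect_eq_d2)
  qed (intro closed_defect_form that)
  then show "\<forall>X\<in>\<X>. \<forall>Y\<in>\<X>. closed_defect \<Omega> X Y = 0" by blast
next
  assume K: "\<forall>X\<in>\<X>. \<forall>Y\<in>\<X>. closed_defect \<Omega> X Y = 0"
  then have sk: "skew_T_Tstar A \<Omega>" by (intro skew_if_no_closed_defect) auto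
  have "d2 \<Omega> X Y Z = 0" if "X \<in> \<X>" "Y \<in> \<X>" "Z \<in> \<X>" for X Y Z
    using closed_defect_eq_d2[OF sk that] K that by (auto simp: fun_eq_iff)
  with sk \<Omega> show "closed_two_form A \<Omega>" by (simp add: closed_two_form_def)
qed

end

section \<open>Poisson tensors\<close>

lemma form_bracket_form:
  assumes "map_Tstar_T A P" "\<xi> \<in> \<F>" "\<eta> \<in> \<F>"
  shows "form_bracket A P \<xi> \<eta> \<in> \<F>"
  using form_diff[OF lie_derivative_form[OF map_Tstar_T_field[OF assms(1,2)] assms(3)]
      interior_d_form[OF map_Tstar_T_field[OF assms(1,3)] assms(2)]]
  by (simp add: form_bracket_def bapp_def fun_diff_def)

lemma form_bracket_apply:
  assumes "map_Tstar_T A P" "\<xi> \<in> \<F>" "\<eta> \<in> \<F>" "Z \<in> \<X>"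
  shows "form_bracket A P \<xi> \<eta> p (Z p) =
    P p (\<xi> p) (\<lambda>q. \<eta> q (Z q)) - \<eta> p (lie_bracket (\<lambda>q. P q (\<xi> q)) Z p)
    - P p (\<eta> p) (\<lambda>q. \<xi> q (Z q)) + Z p (\<lambda>q. \<xi> q (P q (\<eta> q)))
    + \<xi> p (lie_bracket (\<lambda>q. P q (\<eta> q)) Z p)"
  using lie_derivative_apply[OF map_Tstar_T_field[OF assms(1,2)] assms(3,4)]
    interior_d_apply[OF map_Tstar_T_field[OF assms(1,3)] assms(2,4)]
  by (simp add: form_bracket_def bapp_def)

lemma form_bracket_antisym:
  assumes P: "map_Tstar_T A P" and sk: "skew_Tstar_T A P" and \<xi>: "\<xi> \<in> \<F>" and \<eta>: "\<eta> \<in> \<F>"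
  shows "form_bracket A P \<eta> \<xi> = (\<lambda>p. - form_bracket A P \<xi> \<eta> p)"
proof (rule form_eqI)
  show "form_bracket A P \<eta> \<xi> \<in> \<F>" by (rule form_bracket_form[OF P \<eta> \<xi>])
  show "(\<lambda>p. - form_bracket A P \<xi> \<eta> p) \<in> \<F>"
    using form_scale[OF form_bracket_form[OF P \<xi> \<eta>], of "-1"] by simp
  fix p Z assume Z: "Z \<in> \<X>"
  have "(\<lambda>q. \<eta> q (P q (\<xi> q))) = (\<lambda>q. - \<xi> q (P q (\<eta> q)))"
    using sk form_cotangent[OF \<xi>] form_cotangent[OF \<eta>] unfolding skew_Tstar_T_def by blast
  then have "Z p (\<lambda>q. \<eta> q (P q (\<xi> q))) = - Z p (\<lambda>q. \<xi> q (P q (\<eta> q)))"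
    using tangent_apply_uminus[OF field_tangent[OF Z] form_smooth[OF \<xi> map_Tstar_T_field[OF P \<eta>]]] by simp
  then show "form_bracket A P \<eta> \<xi> p (Z p) = (- form_bracket A P \<xi> \<eta> p) (Z p)"
    by (simp add: form_bracket_apply[OF P] \<xi> \<eta> Z)
qed

lemma form_bracket_add_right:
  assumes P: "map_Tstar_T A P" and f: "\<xi> \<in> \<F>" "\<eta> \<in> \<F>" "\<zeta> \<in> \<F>"
  shows "form_bracket A P \<xi> (\<lambda>q. \<eta> q + \<zeta> q) p = form_bracket A P \<xi> \<eta> p + form_bracket A P \<xi> \<zeta> p"
proof -
  note [simp] = linear_between_add[OF map_Tstar_T_linear[OF P]] form_cotangent form_add f
    map_Tstar_T_field[OF P] field_tangent
  have "form_bracket A P \<xi> (\<lambda>q. \<eta> q + \<zeta> q) = (\<lambda>p. form_bracket A P \<xi> \<eta> p + form_bracket A P \<xi> \<zeta> p)"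
  proof (rule form_eqI)
    fix p Z assume Z: "Z \<in> \<X>"
    have 1: "P p (\<xi> p) (\<lambda>q. \<eta> q (Z q) + \<zeta> q (Z q)) = P p (\<xi> p) (\<lambda>q. \<eta> q (Z q)) + P p (\<xi> p) (\<lambda>q. \<zeta> q (Z q))"
      by (rule tangent_apply_add[OF field_tangent[OF map_Tstar_T_field[OF P f(1)]]])
        (simp_all add: form_smooth Z)
    have 2: "Z p (\<lambda>q. \<xi> q (P q (\<eta> q) + P q (\<zeta> q))) = Z p (\<lambda>q. \<xi> q (P q (\<eta> q))) + Z p (\<lambda>q. \<xi> q (P q (\<zeta> q)))"
      using tangent_apply_add[OF field_tangent[OF Z] form_smooth[OF f(1) map_Tstar_T_field[OF P f(2)]]
          form_smooth[OF f(1) map_Tstar_T_field[OF P f(3)]]]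
        cotangent_apply_add[OF form_cotangent[OF f(1)] field_tangent[OF map_Tstar_T_field[OF P f(2)]]
          field_tangent[OF map_Tstar_T_field[OF P f(3)]]] by simp
    have 3: "\<xi> p (lie_bracket (\<lambda>q. P q (\<eta> q) + P q (\<zeta> q)) Z p)
        = \<xi> p (lie_bracket (\<lambda>q. P q (\<eta> q)) Z p) + \<xi> p (lie_bracket (\<lambda>q. P q (\<zeta> q)) Z p)"
      using Z by (simp add: lie_bracket_add_left cotangent_apply_add[of "\<xi> p" p] lie_bracket_field)
    show "form_bracket A P \<xi> (\<lambda>q. \<eta> q + \<zeta> q) p (Z p)
        = (form_bracket A P \<xi> \<eta> p + form_bracket A P \<xi> \<zeta> p) (Z p)"
      using 1 2 3 by (simp add: form_bracket_apply[OF P] Z)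
  qed (simp_all add: form_bracket_form[OF P])
  then show ?thesis by simp
qed

text \<open>The Leibniz rule of the bracket on one-forms. The terms with a derivative of \<open>g\<close> in direction \<open>Z\<close>
  cancel between the exterior derivative and the Lie bracket.\<close>

lemma form_bracket_mult_right:
  assumes P: "map_Tstar_T A P" and f: "\<xi> \<in> \<F>" "\<eta> \<in> \<F>" and g: "g \<in> \<C>"
  shows "form_bracket A P \<xi> (\<lambda>q. g q *\<^sub>R \<eta> q) p
    = P p (\<xi> p) g *\<^sub>R \<eta> p + g p *\<^sub>R form_bracket A P \<xi> \<eta> p"
proof -
  note fP = map_Tstar_T_field[OF P] 
  have lin: "P q (c *\<^sub>R \<eta> q) = c *\<^sub>R P q (\<eta> q)" for q c
    by (rule linear_between_scale[OF map_Tstar_T_linear[OF P] form_cotangent[OF f(2)]])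
  have "form_bracket A P \<xi> (\<lambda>q. g q *\<^sub>R \<eta> q)
      = (\<lambda>p. P p (\<xi> p) g *\<^sub>R \<eta> p + g p *\<^sub>R form_bracket A P \<xi> \<eta> p)"
  proof (rule form_eqI)
    show "form_bracket A P \<xi> (\<lambda>q. g q *\<^sub>R \<eta> q) \<in> \<F>"
      by (rule form_bracket_form[OF P f(1) form_mult[OF g f(2)]])
    show "(\<lambda>p. P p (\<xi> p) g *\<^sub>R \<eta> p + g p *\<^sub>R form_bracket A P \<xi> \<eta> p) \<in> \<F>"
      by (rule form_add[OF form_mult[OF field_smooth[OF fP[OF f(1)] g] f(2)]
            form_mult[OF g form_bracket_form[OF P f]]])
    fix p Z assume Z: "Z \<in> \<X>"
    have 1: "P p (\<xi> p) (\<lambda>q. g q * \<eta> q (Z q)) = g p * P p (\<xi> p) (\<lambda>q. \<eta> q (Z q)) + \<eta> p (Z p) * P p (\<xi> p) g"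
      by (rule tangent_apply_mult[OF field_tangent[OF fP[OF f(1)]] g form_smooth[OF f(2) Z]])
    have 2: "Z p (\<lambda>q. \<xi> q (g q *\<^sub>R P q (\<eta> q))) = g p * Z p (\<lambda>q. \<xi> q (P q (\<eta> q))) + \<xi> p (P p (\<eta> p)) * Z p g"
      using tangent_apply_mult[OF field_tangent[OF Z] g form_smooth[OF f(1) fP[OF f(2)]]]
        cotangent_apply_scale[OF form_cotangent[OF f(1)] field_tangent[OF fP[OF f(2)]]] by simp
    have 3: "\<xi> p (lie_bracket (\<lambda>q. g q *\<^sub>R P q (\<eta> q)) Z p)
        = g p * \<xi> p (lie_bracket (\<lambda>q. P q (\<eta> q)) Z p) - Z p g * \<xi> p (P p (\<eta> p))"
      unfolding lie_bracket_mult_left[OF fP[OF f(2)] Z g]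
      using form_cotangent[OF f(1), of p] field_tangent[OF lie_bracket_field[OF fP[OF f(2)] Z], of p]
        field_tangent[OF fP[OF f(2)], of p]
      by (simp add: cotangent_apply_diff cotangent_apply_scale tangent_scale)
    show "form_bracket A P \<xi> (\<lambda>q. g q *\<^sub>R \<eta> q) p (Z p)
        = (P p (\<xi> p) g *\<^sub>R \<eta> p + g p *\<^sub>R form_bracket A P \<xi> \<eta> p) (Z p)"
      using 1 2 3
      by (simp add: form_bracket_apply[OF P] f form_mult[OF g] Z lin algebra_simps)
  qed
  then show ?thesis by simp
qed

text \<open>On exact forms the bracket is the differential of the Poisson bracket.\<close>

lemma form_bracket_exact:
  assumes P: "map_Tstar_T A P" and f: "f \<in> \<C>" and g: "g \<in> \<C>"
  shows "form_bracket A P (d0 A f) (d0 A g) = d0 A (\<lambda>q. P q (d0 A f q) g)"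
proof (rule form_eqI)
  note df = d0_form[OF f] and dg = d0_form[OF g] and fP = map_Tstar_T_field[OF P]
  show "form_bracket A P (d0 A f) (d0 A g) \<in> \<F>" by (rule form_bracket_form[OF P df dg])
  show "d0 A (\<lambda>q. P q (d0 A f q) g) \<in> \<F>" by (rule d0_form[OF field_smooth[OF fP[OF df] g]])
  fix p Z assume Z: "Z \<in> \<X>"
  have d: "d0 A h q (X q) = X q h" if "X \<in> \<X>" for h q X
    using d0_apply[OF field_tangent[OF that]] .
  show "form_bracket A P (d0 A f) (d0 A g) p (Z p) = d0 A (\<lambda>q. P q (d0 A f q) g) p (Z p)"
    unfolding form_bracket_apply[OF P df dg Z]
    by (simp add: d[OF Z] d[OF fP[OF dg]] d[OF lie_bracket_field[OF fP[OF df] Z]]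
        d[OF lie_bracket_field[OF fP[OF dg] Z]] lie_bracket_apply)
qed

text \<open>The failure of \<open>P\<close> to be a morphism from the bracket of one-forms to the Lie bracket.\<close>

definition hamiltonian_defect ::
    "('m \<Rightarrow> 'm cotangent \<Rightarrow> 'm tangent) \<Rightarrow> ('m \<Rightarrow> 'm cotangent) \<Rightarrow> ('m \<Rightarrow> 'm cotangent) \<Rightarrow> 'm \<Rightarrow> 'm tangent" where
  "hamiltonian_defect P \<xi> \<eta> = (\<lambda>p. lie_bracket (\<lambda>q. P q (\<xi> q)) (\<lambda>q. P q (\<eta> q)) p
     - P p (form_bracket A P \<xi> \<eta> p))"

lemma hamiltonian_defect_antisym:
  assumes P: "map_Tstar_T A P" and sk: "skew_Tstar_T A P" and \<xi>: "\<xi> \<in> \<F>" and \<eta>: "\<eta> \<in> \<F>"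
  shows "hamiltonian_defect P \<eta> \<xi> p = - hamiltonian_defect P \<xi> \<eta> p"
  using linear_between_scale[OF map_Tstar_T_linear[OF P] form_cotangent[OF form_bracket_form[OF P \<xi> \<eta>], of p], where c = "-1"]
  by (simp add: hamiltonian_defect_def form_bracket_antisym[OF assms] lie_bracket_antisym[of _ "\<lambda>q. P q (\<xi> q)"])

text \<open>Both terms of the defect satisfy the same Leibniz rule in \<open>\<eta>\<close>, so their difference is linear over
  smooth functions.\<close>

lemma hamiltonian_defect_tensorial:
  assumes P: "map_Tstar_T A P" and \<xi>: "\<xi> \<in> \<F>" and \<eta>: "\<eta> \<in> \<F>" and \<zeta>: "\<zeta> \<in> \<F>" and eq: "\<eta> p = \<zeta> p"
  shows "hamiltonian_defect P \<xi> \<eta> p = hamiltonian_defect P \<xi> \<zeta> p"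
proof
  fix h
  note fP = map_Tstar_T_field[OF P] and lP = map_Tstar_T_linear[OF P]
  show "hamiltonian_defect P \<xi> \<eta> p h = hamiltonian_defect P \<xi> \<zeta> p h"
  proof (rule form_tensorial[OF _ _ \<eta> \<zeta> eq])
    fix \<alpha> \<beta> assume a: "\<alpha> \<in> \<F>" "\<beta> \<in> \<F>"
    have 1: "P q (\<alpha> q + \<beta> q) = P q (\<alpha> q) + P q (\<beta> q)" for q
      by (rule linear_between_add[OF lP form_cotangent[OF a(1)] form_cotangent[OF a(2)]])
    have 2: "P p (form_bracket A P \<xi> \<alpha> p + form_bracket A P \<xi> \<beta> p)
        = P p (form_bracket A P \<xi> \<alpha> p) + P p (form_bracket A P \<xi> \<beta> p)"
      by (rule linear_between_add[OF lP]) (intro form_cotangent form_bracket_form[OF P \<xi>] a)+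
    show "hamiltonian_defect P \<xi> (\<lambda>q. \<alpha> q + \<beta> q) p h
        = hamiltonian_defect P \<xi> \<alpha> p h + hamiltonian_defect P \<xi> \<beta> p h"
      by (simp add: hamiltonian_defect_def 1 2 form_bracket_add_right[OF P \<xi> a]
          lie_bracket_add_right[OF fP[OF \<xi>] fP[OF a(1)] fP[OF a(2)]])
  next
    fix g \<alpha> assume g: "g \<in> \<C>" and a: "\<alpha> \<in> \<F>"
    have 1: "P q (c *\<^sub>R \<alpha> q) = c *\<^sub>R P q (\<alpha> q)" for q c
      by (rule linear_between_scale[OF lP form_cotangent[OF a]])
    have 2: "P p (c *\<^sub>R \<alpha> p + d *\<^sub>R form_bracket A P \<xi> \<alpha> p)
        = c *\<^sub>R P p (\<alpha> p) + d *\<^sub>R P p (form_bracket A P \<xi> \<alpha> p)" for c d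
      using form_cotangent[OF a, of p] form_cotangent[OF form_bracket_form[OF P \<xi> a], of p]
      by (simp add: linear_between_add[OF lP] linear_between_scale[OF lP]
          subspace_scale[OF subspace_cotangent])
    show "hamiltonian_defect P \<xi> (\<lambda>q. g q *\<^sub>R \<alpha> q) p h = g p * hamiltonian_defect P \<xi> \<alpha> p h"
      by (simp add: hamiltonian_defect_def 1 2 form_bracket_mult_right[OF P \<xi> a g]
          lie_bracket_mult_right[OF fP[OF \<xi>] fP[OF a] g] algebra_simps)
  qed
qed

text \<open>For \<open>\<xi> = df\<close> and \<open>\<eta> = dg\<close> the defect is \<open>[X\<^sub>f, X\<^sub>g] - X\<^bsub>{f,g}\<^esub>\<close>, which applied to \<open>h\<close> is the
  Jacobiator.\<close>

lemma hamiltonian_defect_exact: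
  assumes P: "map_Tstar_T A P" and sk: "skew_Tstar_T A P"
    and f: "f \<in> \<C>" and g: "g \<in> \<C>" and h: "h \<in> \<C>"
  shows "hamiltonian_defect P (d0 A f) (d0 A g) p h =
     (poisson_bracket A P f (poisson_bracket A P g h)
      + poisson_bracket A P g (poisson_bracket A P h f)
      + poisson_bracket A P h (poisson_bracket A P f g)) p"
proof -
  note fP = map_Tstar_T_field[OF P]
  let ?X = "\<lambda>f p. P p (d0 A f p)"
  have pb: "poisson_bracket A P a b = (\<lambda>p. ?X a p b)" if "a \<in> \<C>" for a b
    by (simp add: poisson_bracket_def contract_def bapp_def d0_apply[OF field_tangent[OF fP[OF d0_form[OF that]]]])
  have sm: "(\<lambda>p. ?X a p b) \<in> \<C>" if "a \<in> \<C>" "b \<in> \<C>" for a b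
    by (rule field_smooth[OF fP[OF d0_form[OF that(1)]] that(2)])
  have anti: "?X a p b = - ?X b p a" if "a \<in> \<C>" "b \<in> \<C>" for a b p
  proof -
    have "d0 A b p (?X a p) = - d0 A a p (?X b p)"
      using sk form_cotangent[OF d0_form] that unfolding skew_Tstar_T_def by blast
    then show ?thesis
      by (simp add: d0_apply[OF field_tangent[OF fP[OF d0_form]]] that)
  qed
  have "?X g p (\<lambda>q. ?X h q f) = - ?X g p (\<lambda>q. ?X f q h)"
    unfolding anti[OF h f] using tangent_apply_uminus[OF field_tangent[OF fP[OF d0_form[OF g]]] sm[OF f h]] .
  moreover have "?X h p (\<lambda>q. ?X f q g) = - ?X (\<lambda>q. ?X f q g) p h"
    by (rule anti[OF h sm[OF f g]])
  ultimately show ?thesis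
    by (simp add: hamiltonian_defect_def form_bracket_exact[OF P f g] pb f g h sm lie_bracket_apply)
qed

text \<open>The Jacobi identity is the vanishing of the defect on exact forms. By tensoriality, and since
  every covector is the value of an exact form, it then vanishes on all one-forms.\<close>

lemma poisson_tensor_iff:
  assumes P: "map_Tstar_T A P" and sk: "skew_Tstar_T A P"
  shows "poisson_tensor A P \<longleftrightarrow> (\<forall>\<xi>\<in>\<F>. \<forall>\<eta>\<in>\<F>. hamiltonian_defect P \<xi> \<eta> = 0)"
proof
  assume H: "\<forall>\<xi>\<in>\<F>. \<forall>\<eta>\<in>\<F>. hamiltonian_defect P \<xi> \<eta> = 0"
  show "poisson_tensor A P"
    unfolding poisson_tensor_def
  proof (intro conjI ballI P sk ext)
    fix f g h p assume f: "f \<in> \<C>" "g \<in> \<C>" "h \<in> \<C>"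
    show "(poisson_bracket A P f (poisson_bracket A P g h)
      + poisson_bracket A P g (poisson_bracket A P h f)
      + poisson_bracket A P h (poisson_bracket A P f g)) p = 0 p"
      using hamiltonian_defect_exact[OF P sk f, of p] H d0_form f by simp
  qed
next
  assume J: "poisson_tensor A P"
  show "\<forall>\<xi>\<in>\<F>. \<forall>\<eta>\<in>\<F>. hamiltonian_defect P \<xi> \<eta> = 0"
  proof (intro ballI ext)
    fix \<xi> \<eta> p h assume \<xi>: "\<xi> \<in> \<F>" and \<eta>: "\<eta> \<in> \<F>"
    obtain f g where f: "f \<in> \<C>" "\<xi> p = d0 A f p" and g: "g \<in> \<C>" "\<eta> p = d0 A g p"
      using covector_exact[OF form_cotangent[OF \<xi>], of p] covector_exact[OF form_cotangent[OF \<eta>], of p] by metis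
    note df = d0_form[OF f(1)] and dg = d0_form[OF g(1)]
    have "hamiltonian_defect P \<xi> \<eta> p = hamiltonian_defect P \<xi> (d0 A g) p"
      by (rule hamiltonian_defect_tensorial[OF P \<xi> \<eta> dg g(2)])
    also have "\<dots> = - hamiltonian_defect P (d0 A g) \<xi> p"
      by (rule hamiltonian_defect_antisym[OF P sk dg \<xi>])
    also have "\<dots> = - hamiltonian_defect P (d0 A g) (d0 A f) p"
      by (simp add: hamiltonian_defect_tensorial[OF P dg \<xi> df f(2)])
    finally have e: "hamiltonian_defect P \<xi> \<eta> p = - hamiltonian_defect P (d0 A g) (d0 A f) p" .
    show "hamiltonian_defect P \<xi> \<eta> p h = 0 p h"
    proof (cases "h \<in> \<C>")
      case True
      show ?thesis
        using e J hamiltonian_defect_exact[OF P sk g(1) f(1) True, of p] f(1) g(1) True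
        by (simp add: poisson_tensor_def fun_eq_iff)
    next
      case False
      have "hamiltonian_defect P \<xi> \<eta> p \<in> T p"
        unfolding hamiltonian_defect_def
        by (intro subspace_diff[OF subspace_tangent] field_tangent[OF lie_bracket_field]
            linear_between_mem[OF map_Tstar_T_linear[OF P]] form_cotangent[OF form_bracket_form[OF P]]
            map_Tstar_T_field[OF P] \<xi> \<eta>)
      then show ?thesis using tangent_not_smooth False by simp
    qed
  qed
qed

section \<open>Compatibility of a bivector with an endomorphism\<close>

text \<open>The cotangent part of the torsion on one-forms, with the dual of \<open>h\<close> in place of the cotangent
  block. On the identity the same expression vanishes by definition of the bracket, so of the cotangent
  block \<open>c/2 - N0\<^sup>*\<close> only \<open>N0\<close> contributes to the torsion.\<close>

definition dual_defect ::
    "('m \<Rightarrow> 'm cotangent \<Rightarrow> 'm tangent) \<Rightarrow> ('m \<Rightarrow> 'm tangent \<Rightarrow> 'm tangent) \<Rightarrow>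
     ('m \<Rightarrow> 'm cotangent) \<Rightarrow> ('m \<Rightarrow> 'm cotangent) \<Rightarrow> 'm \<Rightarrow> 'm cotangent" where
  "dual_defect P h \<xi> \<eta> = (\<lambda>p. lie_derivative A (\<lambda>q. P q (\<xi> q)) (\<lambda>q. dual_map A h q (\<eta> q)) p
     - interior_d A (\<lambda>q. P q (\<eta> q)) (\<lambda>q. dual_map A h q (\<xi> q)) p
     - dual_map A h p (form_bracket A P \<xi> \<eta> p))"

context
  fixes P :: "'m \<Rightarrow> 'm cotangent \<Rightarrow> 'm tangent" and h :: "'m \<Rightarrow> 'm tangent \<Rightarrow> 'm tangent"
  assumes P: "map_Tstar_T A P" and skP: "skew_Tstar_T A P" and h: "map_T_T A h"
begin

lemma dual_defect_form:
  "\<xi> \<in> \<F> \<Longrightarrow> \<eta> \<in> \<F> \<Longrightarrow> dual_defect P h \<xi> \<eta> \<in> \<F>"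
  unfolding dual_defect_def
  by (simp add: form_diff lie_derivative_form interior_d_form map_Tstar_T_field[OF P]
      dual_map_form[OF h] form_bracket_form[OF P])

lemma dual_defect_apply:
  assumes \<xi>: "\<xi> \<in> \<F>" and \<eta>: "\<eta> \<in> \<F>" and Z: "Z \<in> \<X>"
  shows "dual_defect P h \<xi> \<eta> p (Z p) =
    P p (\<xi> p) (\<lambda>q. \<eta> q (h q (Z q))) - \<eta> p (h p (lie_bracket (\<lambda>q. P q (\<xi> q)) Z p))
    - P p (\<eta> p) (\<lambda>q. \<xi> q (h q (Z q))) + Z p (\<lambda>q. \<xi> q (h q (P q (\<eta> q))))
    + \<xi> p (h p (lie_bracket (\<lambda>q. P q (\<eta> q)) Z p)) - form_bracket A P \<xi> \<eta> p (h p (Z p))"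
  unfolding dual_defect_def
  by (simp add: lie_derivative_apply interior_d_apply map_Tstar_T_field[OF P] dual_map_form[OF h] \<xi> \<eta> Z
      dual_map_apply field_tangent[OF map_Tstar_T_field[OF P]] field_tangent[OF Z]
      field_tangent[OF lie_bracket_field])

text \<open>Symmetrization in \<open>\<xi>\<close> and \<open>\<eta>\<close> removes the bracket, which is antisymmetric because \<open>P\<close> is skew,
  and leaves the differential of \<open>\<eta>(hP\<xi>) + \<xi>(hP\<eta>)\<close>.\<close>

lemma skew_if_no_dual_defect:
  assumes Q: "\<And>\<xi> \<eta>. \<xi> \<in> \<F> \<Longrightarrow> \<eta> \<in> \<F> \<Longrightarrow> dual_defect P h \<xi> \<eta> = 0"
  shows "skew_Tstar_T A (bcomp h P)"
  unfolding skew_Tstar_T_def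
proof (intro allI ballI)
  fix p \<xi>\<^sub>p \<eta>\<^sub>p assume "\<xi>\<^sub>p \<in> T' p" "\<eta>\<^sub>p \<in> T' p"
  then obtain \<xi> \<eta> where \<xi>: "\<xi> \<in> \<F>" "\<xi> p = \<xi>\<^sub>p" and \<eta>: "\<eta> \<in> \<F>" "\<eta> p = \<eta>\<^sub>p"
    using covector_exact d0_form by meson
  have hP: "(\<lambda>q. h q (P q (\<zeta> q))) \<in> \<X>" if "\<zeta> \<in> \<F>" for \<zeta>
    by (rule map_T_T_field[OF h map_Tstar_T_field[OF P that]])
  define t where "t \<eta> q = \<eta> q (h q (P q (\<xi> q))) + \<xi> q (h q (P q (\<eta> q)))" for \<eta> q
  have t_smooth: "t \<zeta> \<in> \<C>" if "\<zeta> \<in> \<F>" for \<zeta>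
    unfolding t_def
    using add_smooth[OF form_smooth[OF that hP[OF \<xi>(1)]] form_smooth[OF \<xi>(1) hP[OF that]]] .
  have dt: "Z p (t \<zeta>) = 0" if \<zeta>: "\<zeta> \<in> \<F>" and Z: "Z \<in> \<X>" for \<zeta> Z
  proof -
    have "0 = dual_defect P h \<xi> \<zeta> p (Z p) + dual_defect P h \<zeta> \<xi> p (Z p)"
      using Q \<xi>(1) \<zeta> by simp
    also have "\<dots> = Z p (\<lambda>q. \<zeta> q (h q (P q (\<xi> q)))) + Z p (\<lambda>q. \<xi> q (h q (P q (\<zeta> q))))"
      using \<xi>(1) \<zeta> Z by (simp add: dual_defect_apply form_bracket_antisym[OF P skP \<xi>(1) \<zeta>])
    also have "\<dots> = Z p (t \<zeta>)"
      unfolding t_def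
      using tangent_apply_add[OF field_tangent[OF Z] form_smooth[OF \<zeta> hP[OF \<xi>(1)]]
          form_smooth[OF \<xi>(1) hP[OF \<zeta>]]] by simp
    finally show ?thesis by simp
  qed
  \<comment> \<open>Either both summands are values at 0, or a nonzero tangent vector exists at \<open>p\<close>.\<close>
  have "t \<eta> p = 0"
  proof (cases "h p (P p (\<xi> p)) = 0 \<and> h p (P p (\<eta> p)) = 0")
    case True
    then show ?thesis
      using cotangent_apply_zero[OF form_cotangent[OF \<xi>(1)]] cotangent_apply_zero[OF form_cotangent[OF \<eta>(1)]]
      by (simp add: t_def)
  next
    case False
    then obtain v where v: "v \<in> T p" "v \<noteq> 0"
      using field_tangent[OF hP[OF \<xi>(1)]] field_tangent[OF hP[OF \<eta>(1)]] by blast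
    show ?thesis
    proof (rule tensorial_symmetric_vanishes[OF t_smooth[OF \<eta>(1)] _ v])
      fix f Z assume f: "f \<in> \<C>" and Z: "Z \<in> \<X>"
      have "t (\<lambda>q. f q *\<^sub>R \<eta> q) = (\<lambda>q. f q * t \<eta> q)"
        using linear_between_scale[OF map_Tstar_T_linear[OF P] form_cotangent[OF \<eta>(1)]]
          linear_between_scale[OF map_T_T_linear[OF h] field_tangent[OF map_Tstar_T_field[OF P \<eta>(1)]]]
          cotangent_apply_scale[OF form_cotangent[OF \<xi>(1)] field_tangent[OF hP[OF \<eta>(1)]]]
        by (intro ext) (simp add: t_def distrib_left)
      then show "Z p (\<lambda>q. f q * t \<eta> q) = 0" using dt[OF form_mult[OF f \<eta>(1)] Z] by simp
    qed
  qed
  then show "\<eta>\<^sub>p (bcomp h P p \<xi>\<^sub>p) = - \<xi>\<^sub>p (bcomp h P p \<eta>\<^sub>p)" using \<xi> \<eta> by (simp add: t_def bcomp_def)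
qed

text \<open>Skewness of \<open>h P\<close> is the intertwining relation \<open>P h\<^sup>* = h P\<close>.\<close>

lemma skew_comp_commute:
  assumes sk: "skew_Tstar_T A (bcomp h P)" and \<xi>: "\<xi> \<in> T' p"
  shows "P p (dual_map A h p \<xi>) = h p (P p \<xi>)"
proof (rule tangent_eqI)
  note memP = linear_between_mem[OF map_Tstar_T_linear[OF P]]
    and memh = linear_between_mem[OF map_T_T_linear[OF h]]
  show m: "P p (dual_map A h p \<xi>) \<in> T p" "h p (P p \<xi>) \<in> T p"
    by (intro memP memh dual_map_cotangent[OF h] \<xi>)+
  fix f assume f: "f \<in> \<C>"
  let ?\<eta> = "d0 A f p"
  have \<eta>: "?\<eta> \<in> T' p" by (rule form_cotangent[OF d0_form[OF f]])
  have "?\<eta> (P p (dual_map A h p \<xi>)) = - dual_map A h p \<xi> (P p ?\<eta>)"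
    using skP dual_map_cotangent[OF h \<xi>] \<eta> unfolding skew_Tstar_T_def by blast
  also have "\<dots> = - \<xi> (h p (P p ?\<eta>))" by (simp add: dual_map_apply memP \<eta>)
  also have "\<dots> = ?\<eta> (h p (P p \<xi>))"
    using sk \<xi> \<eta> unfolding skew_Tstar_T_def bcomp_def by force
  finally show "P p (dual_map A h p \<xi>) f = h p (P p \<xi>) f" using m by (simp add: d0_apply)
qed

text \<open>With \<open>P h\<^sup>* = h P\<close>, the terms of the deformed bracket that contain \<open>P h\<^sup>* \<xi>\<close> or \<open>P h\<^sup>* \<eta>\<close> make up the
  bracket of \<open>h P\<close>, and the remaining terms are the defect.\<close>

lemma deformed_form_bracket_eq:
  assumes sk: "skew_Tstar_T A (bcomp h P)" and \<xi>: "\<xi> \<in> \<F>" and \<eta>: "\<eta> \<in> \<F>"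
  shows "deformed_form_bracket A P h \<xi> \<eta> p
    = form_bracket A (bcomp h P) \<xi> \<eta> p + dual_defect P h \<xi> \<eta> p"
proof -
  let ?d = "\<lambda>\<xi> q. dual_map A h q (\<xi> q)"
  note hP = bcomp_map_Tstar_T[OF h P]
  note d\<xi> = dual_map_form[OF h \<xi>] and d\<eta> = dual_map_form[OF h \<eta>]
  have D: "deformed_form_bracket A P h \<xi> \<eta> = (\<lambda>p. form_bracket A P (?d \<xi>) \<eta> p
      + form_bracket A P \<xi> (?d \<eta>) p - dual_map A h p (form_bracket A P \<xi> \<eta> p))"
    by (simp add: deformed_form_bracket_def bapp_def fun_eq_iff)
  have comm: "P q (dual_map A h q (\<zeta> q)) = h q (P q (\<zeta> q))" if "\<zeta> \<in> \<F>" for q \<zeta>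
    by (rule skew_comp_commute[OF sk form_cotangent[OF that]])
  have "deformed_form_bracket A P h \<xi> \<eta>
      = (\<lambda>p. form_bracket A (bcomp h P) \<xi> \<eta> p + dual_defect P h \<xi> \<eta> p)"
  proof (rule form_eqI)
    show "deformed_form_bracket A P h \<xi> \<eta> \<in> \<F>"
      unfolding D
      by (intro form_diff form_add form_bracket_form[OF P] dual_map_form[OF h] \<xi> \<eta>)
    show "(\<lambda>p. form_bracket A (bcomp h P) \<xi> \<eta> p + dual_defect P h \<xi> \<eta> p) \<in> \<F>"
      by (intro form_add form_bracket_form[OF hP] dual_defect_form \<xi> \<eta>)
    fix p Z assume Z: "Z \<in> \<X>"
    show "deformed_form_bracket A P h \<xi> \<eta> p (Z p)
        = (form_bracket A (bcomp h P) \<xi> \<eta> p + dual_defect P h \<xi> \<eta> p) (Z p)"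
      unfolding D
      by (simp add: form_bracket_apply[OF P d\<xi> \<eta> Z] form_bracket_apply[OF P \<xi> d\<eta> Z]
          form_bracket_apply[OF hP \<xi> \<eta> Z] dual_defect_apply[OF \<xi> \<eta> Z] comm[OF \<xi>] comm[OF \<eta>] bcomp_apply
          dual_map_apply field_tangent[OF Z] field_tangent[OF map_Tstar_T_field[OF P]]
          field_tangent[OF lie_bracket_field] map_Tstar_T_field[OF P] \<xi> \<eta> Z)
  qed
  then show ?thesis by simp
qed

lemma poisson_nijenhuis_iff:
  "poisson_nijenhuis A h P \<longleftrightarrow> nijenhuis_tensor A h \<and>
     (\<forall>\<xi>\<in>\<F>. \<forall>\<eta>\<in>\<F>. hamiltonian_defect P \<xi> \<eta> = 0 \<and> dual_defect P h \<xi> \<eta> = 0)"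
proof -
  have *: "deformed_form_bracket A P h \<xi> \<eta> = form_bracket A (bcomp h P) \<xi> \<eta> \<longleftrightarrow> dual_defect P h \<xi> \<eta> = 0"
    if "skew_Tstar_T A (bcomp h P)" "\<xi> \<in> \<F>" "\<eta> \<in> \<F>" for \<xi> \<eta>
    using deformed_form_bracket_eq[OF that] by (simp add: fun_eq_iff)
  show ?thesis
    unfolding poisson_nijenhuis_def poisson_tensor_iff[OF P skP]
    using * skew_if_no_dual_defect by blast
qed

end

section \<open>Nijenhuis torsion and shifts by the identity\<close>

definition deformed_lie_bracket ::
    "('m \<Rightarrow> 'm tangent \<Rightarrow> 'm tangent) \<Rightarrow> ('m \<Rightarrow> 'm tangent) \<Rightarrow> ('m \<Rightarrow> 'm tangent) \<Rightarrow> 'm \<Rightarrow> 'm tangent" where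
  "deformed_lie_bracket h X Y = (\<lambda>p. lie_bracket (\<lambda>q. h q (X q)) Y p + lie_bracket X (\<lambda>q. h q (Y q)) p
      - h p (lie_bracket X Y p))"

definition shift :: "real \<Rightarrow> ('m \<Rightarrow> 'm tangent \<Rightarrow> 'm tangent) \<Rightarrow> 'm \<Rightarrow> 'm tangent \<Rightarrow> 'm tangent" where
  "shift c h = (\<lambda>p v. c *\<^sub>R v + h p v)"

lemma nijenhuis_tensor_iff:
  "nijenhuis_tensor A h \<longleftrightarrow> map_T_T A h \<and> (\<forall>X\<in>\<X>. \<forall>Y\<in>\<X>. \<forall>p.
     lie_bracket (\<lambda>q. h q (X q)) (\<lambda>q. h q (Y q)) p = h p (deformed_lie_bracket h X Y p))"
  by (simp add: nijenhuis_tensor_def bapp_def deformed_lie_bracket_def fun_eq_iff[of "lie_bracket _ _"])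

context
  fixes h :: "'m \<Rightarrow> 'm tangent \<Rightarrow> 'm tangent"
  assumes h: "map_T_T A h"
begin

lemma shift_map: "map_T_T A (shift c h)"
proof -
  have "linear_between (T p) (T p) (shift c h p)" for p
    using map_T_T_linear[OF h, of p]
    by (auto simp: linear_between_def shift_def tangent_add tangent_scale scaleR_add_right algebra_simps)
  moreover have "(\<lambda>p. shift c h p (X p)) \<in> \<X>" if "X \<in> \<X>" for X
    unfolding shift_def by (intro field_add field_scale map_T_T_field[OF h] that)
  ultimately show ?thesis by (simp add: bundle_map_def)
qed

lemma deformed_lie_bracket_field:
  "X \<in> \<X> \<Longrightarrow> Y \<in> \<X> \<Longrightarrow> deformed_lie_bracket h X Y \<in> \<X>"
  unfolding deformed_lie_bracket_def
  by (simp add: field_add field_diff lie_bracket_field map_T_T_field[OF h])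

text \<open>The torsion does not see multiples of the identity.\<close>

lemma nijenhuis_shift:
  assumes X: "X \<in> \<X>" and Y: "Y \<in> \<X>"
  shows "lie_bracket (\<lambda>q. shift c h q (X q)) (\<lambda>q. shift c h q (Y q)) p
      - shift c h p (deformed_lie_bracket (shift c h) X Y p)
    = lie_bracket (\<lambda>q. h q (X q)) (\<lambda>q. h q (Y q)) p - h p (deformed_lie_bracket h X Y p)"
proof -
  note hX = map_T_T_field[OF h X] and hY = map_T_T_field[OF h Y]
  note b = lie_bracket_field
  have bX: "lie_bracket (\<lambda>q. c *\<^sub>R X q + h q (X q)) W p = c *\<^sub>R lie_bracket X W p + lie_bracket (\<lambda>q. h q (X q)) W p"
    if "W \<in> \<X>" for W
    using that by (simp add: lie_bracket_add_left[OF field_scale[OF X] hX] lie_bracket_scale X)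
  have bY: "lie_bracket W (\<lambda>q. c *\<^sub>R Y q + h q (Y q)) p = c *\<^sub>R lie_bracket W Y p + lie_bracket W (\<lambda>q. h q (Y q)) p"
    if "W \<in> \<X>" for W
    using that by (simp add: lie_bracket_add_right[OF _ field_scale[OF Y] hY] lie_bracket_scale Y)
  have D: "deformed_lie_bracket (shift c h) X Y p
      = c *\<^sub>R lie_bracket X Y p + deformed_lie_bracket h X Y p"
    by (simp add: deformed_lie_bracket_def shift_def bX[OF Y] bY[OF X])
  have hD: "h p (c *\<^sub>R lie_bracket X Y p + deformed_lie_bracket h X Y p)
     = c *\<^sub>R h p (lie_bracket X Y p) + h p (deformed_lie_bracket h X Y p)"
    by (simp add: linear_between_add[OF map_T_T_linear[OF h]] linear_between_scale[OF map_T_T_linear[OF h]]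
        field_tangent[OF b[OF X Y]] tangent_scale field_tangent[OF deformed_lie_bracket_field[OF X Y]])
  have "lie_bracket (\<lambda>q. shift c h q (X q)) (\<lambda>q. shift c h q (Y q)) p
    = c *\<^sub>R (c *\<^sub>R lie_bracket X Y p + lie_bracket X (\<lambda>q. h q (Y q)) p)
     + (c *\<^sub>R lie_bracket (\<lambda>q. h q (X q)) Y p + lie_bracket (\<lambda>q. h q (X q)) (\<lambda>q. h q (Y q)) p)"
    by (simp add: shift_def bX[OF field_add[OF field_scale[OF Y] hY]] bY[OF X] bY[OF hX])
  then show ?thesis
    unfolding D unfolding shift_def hD by (simp add: deformed_lie_bracket_def algebra_simps)
qed

lemma closed_defect_shift:
  assumes \<Omega>: "map_T_Tstar A \<Omega>" and X: "X \<in> \<X>" and Y: "Y \<in> \<X>"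
  shows "closed_defect (bcomp \<Omega> (shift c h)) X Y p
    = c *\<^sub>R closed_defect \<Omega> X Y p + closed_defect (bcomp \<Omega> h) X Y p"
proof -
  note hX = map_T_T_field[OF h X] and hY = map_T_T_field[OF h Y] and F = map_T_Tstar_form[OF \<Omega>]
  have lin: "\<Omega> q (c *\<^sub>R v + h q v) = c *\<^sub>R \<Omega> q v + \<Omega> q (h q v)" if "v \<in> T q" for q v
    using that by (simp add: linear_between_add[OF map_T_Tstar_linear[OF \<Omega>]]
        linear_between_scale[OF map_T_Tstar_linear[OF \<Omega>]] tangent_scale
        linear_between_mem[OF map_T_T_linear[OF h]])
  show ?thesis
    by (simp add: closed_defect_def bcomp_def shift_def lin field_tangent X Y lie_bracket_field
        lie_derivative_add lie_derivative_scale interior_d_add interior_d_scale F hX hY form_scale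
        algebra_simps)
qed

text \<open>When \<open>K \<Omega> = 0\<close>, the defects at \<open>(hX, Y)\<close> and \<open>(X, hY)\<close> express \<open>L_{hX} \<Omega>Y\<close> and \<open>i_{hY} d\<Omega>X\<close>
  through \<open>\<Omega> h\<close>; what remains is the defect of \<open>\<Omega> h\<close>, up to sign.\<close>

lemma closed_defect_comp:
  assumes \<Omega>: "map_T_Tstar A \<Omega>" and K: "\<And>X Y. X \<in> \<X> \<Longrightarrow> Y \<in> \<X> \<Longrightarrow> closed_defect \<Omega> X Y = 0"
    and X: "X \<in> \<X>" and Y: "Y \<in> \<X>"
  shows "lie_derivative A (\<lambda>q. h q (X q)) (\<lambda>q. \<Omega> q (Y q)) p
     - interior_d A (\<lambda>q. h q (Y q)) (\<lambda>q. \<Omega> q (X q)) p - \<Omega> p (deformed_lie_bracket h X Y p)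
     = - closed_defect (bcomp \<Omega> h) X Y p"
proof -
  note hX = map_T_T_field[OF h X] and hY = map_T_T_field[OF h Y]
  have 1: "closed_defect \<Omega> (\<lambda>q. h q (X q)) Y p = 0" "closed_defect \<Omega> X (\<lambda>q. h q (Y q)) p = 0"
    using K[OF hX Y] K[OF X hY] by simp_all
  have "\<Omega> p (deformed_lie_bracket h X Y p) = \<Omega> p (lie_bracket (\<lambda>q. h q (X q)) Y p)
      + \<Omega> p (lie_bracket X (\<lambda>q. h q (Y q)) p) - \<Omega> p (h p (lie_bracket X Y p))"
    unfolding deformed_lie_bracket_def
    by (simp add: linear_between_add[OF map_T_Tstar_linear[OF \<Omega>]]
        linear_between_diff[OF map_T_Tstar_linear[OF \<Omega>] subspace_tangent] tangent_add
        field_tangent[OF lie_bracket_field] hX hY X Y linear_between_mem[OF map_T_T_linear[OF h]])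
  then show ?thesis using 1 by (simp add: closed_defect_def bcomp_def algebra_simps)
qed

end

section \<open>Block decomposition of paired tensors\<close>

lemma subspace_big: "subspace (big_space A p)"
  unfolding big_space_def by (intro subspace_Times subspace_tangent subspace_cotangent)

lemma big_section_iff: "(\<lambda>p. (X p, \<xi> p)) \<in> big_sections A \<longleftrightarrow> X \<in> \<X> \<and> \<xi> \<in> \<F>"
  by (simp add: big_sections_def)

lemma sub_sections_tangent:
  "sub_sections A (\<lambda>p. T p \<times> {0}) = {\<lambda>p. (X p, 0) | X. X \<in> \<X>}"
proof (intro equalityI subsetI)
  fix U assume U: "U \<in> sub_sections A (\<lambda>p. T p \<times> {0})"
  then have "U = (\<lambda>p. (fst (U p), 0))"
    by (auto simp: sub_sections_def fun_eq_iff prod_eq_iff mem_Times_iff)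
  moreover have "(\<lambda>p. fst (U p)) \<in> \<X>" using U by (simp add: sub_sections_def big_sections_def)
  ultimately show "U \<in> {\<lambda>p. (X p, 0) | X. X \<in> \<X>}"
    by (intro CollectI exI[of _ "\<lambda>p. fst (U p)"] conjI)
qed (auto simp: sub_sections_def big_sections_def form_zero field_tangent)

lemma sub_sections_cotangent:
  "sub_sections A (\<lambda>p. {0} \<times> T' p) = {\<lambda>p. (0, \<xi> p) | \<xi>. \<xi> \<in> \<F>}"
proof (intro equalityI subsetI)
  fix U assume U: "U \<in> sub_sections A (\<lambda>p. {0} \<times> T' p)"
  then have "U = (\<lambda>p. (0, snd (U p)))"
    by (auto simp: sub_sections_def fun_eq_iff prod_eq_iff mem_Times_iff)
  moreover have "(\<lambda>p. snd (U p)) \<in> \<F>" using U by (simp add: sub_sections_def big_sections_def)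
  ultimately show "U \<in> {\<lambda>p. (0, \<xi> p) | \<xi>. \<xi> \<in> \<F>}"
    by (intro CollectI exI[of _ "\<lambda>p. snd (U p)"] conjI)
qed (auto simp: sub_sections_def big_sections_def field_zero form_cotangent)

lemma courant_pair:
  "courant A (\<lambda>p. (X p, \<xi> p)) (\<lambda>p. (Y p, \<eta> p))
    = (\<lambda>p. (lie_bracket X Y p, lie_derivative A X \<eta> p - interior_d A Y \<xi> p))"
  by (simp add: courant_def Let_def)

text \<open>Polarize \<open>\<langle>N u, w\<rangle> + \<langle>u, N w\<rangle> = c \<langle>u, w\<rangle>\<close>: two vectors give skewness of \<open>\<Omega>\<close>, two covectors that of
  \<open>\<Lambda>\<close>, and a vector with a covector determines the cotangent block. Subtracting \<open>c/2\<close> from the tangent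
  block makes the scalar parts of the two diagonal blocks equal.\<close>

lemma paired_blocks:
  assumes N: "map_big A N" and pN: "paired A N"
  shows "\<exists>c N0 \<Lambda> \<Omega>. map_T_T A N0 \<and> map_Tstar_T A \<Lambda> \<and> map_T_Tstar A \<Omega> \<and>
    skew_T_Tstar A \<Omega> \<and> skew_Tstar_T A \<Lambda> \<and>
    (\<forall>p. \<forall>u\<in>big_space A p. N p u = block_map A c N0 \<Lambda> \<Omega> p u)"
proof -
  obtain Nadj c where adj: "is_adjoint A N Nadj"
    and sum: "\<And>p u. u \<in> big_space A p \<Longrightarrow> N p u + Nadj p u = c *\<^sub>R u"
    using pN unfolding paired_def by blast
  have linN: "linear_between (big_space A p) (big_space A p) (N p)" for p
    using N by (simp add: bundle_map_def)
  have secN: "(\<lambda>p. N p (U p)) \<in> big_sections A" if "U \<in> big_sections A" for U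
    using N that by (simp add: bundle_map_def)
  have inT: "(v, 0) \<in> big_space A p" if "v \<in> T p" for v p
    using that by (simp add: big_space_def subspace_0[OF subspace_cotangent])
  have inT': "(0, \<xi>) \<in> big_space A p" if "\<xi> \<in> T' p" for \<xi> p
    using that by (simp add: big_space_def tangent_zero)
  have pair: "pairing (N p u) w + pairing u (N p w) = c * pairing u w"
    if u: "u \<in> big_space A p" and w: "w \<in> big_space A p" for p u w
  proof -
    have Nw: "N p w \<in> big_space A p" "Nadj p w = c *\<^sub>R w - N p w"
      using linear_between_mem[OF linN w] sum[OF w] by (auto simp: algebra_simps)
    have "pairing (N p u) w = pairing u (Nadj p w)"
      using adj u w unfolding is_adjoint_def by blast
    also have "\<dots> = c * pairing u w - pairing u (N p w)"
      unfolding Nw(2) using u w Nw(1)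
      by (auto simp: pairing_def big_space_def mem_Times_iff cotangent_apply_diff cotangent_apply_scale
          tangent_scale algebra_simps)
    finally show ?thesis by simp
  qed
  define N0 where "N0 p v = fst (N p (v, 0)) - (c / 2) *\<^sub>R v" for p v
  define \<Omega> where "\<Omega> p v = snd (N p (v, 0))" for p v
  define \<Lambda> where "\<Lambda> p \<xi> = fst (N p (0, \<xi>))" for p \<xi>
  have NT: "N p (v, 0) = (N0 p v + (c / 2) *\<^sub>R v, \<Omega> p v)" for p v
    by (simp add: N0_def \<Omega>_def)
  have memT: "N p (v, 0) \<in> big_space A p" if "v \<in> T p" for v p
    by (rule linear_between_mem[OF linN inT[OF that]])
  have memT': "N p (0, \<xi>) \<in> big_space A p" if "\<xi> \<in> T' p" for \<xi> p
    by (rule linear_between_mem[OF linN inT'[OF that]])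
  have addT: "N p (v + w, 0) = N p (v, 0) + N p (w, 0)" if "v \<in> T p" "w \<in> T p" for v w p
    using linear_between_add[OF linN inT[OF that(1)] inT[OF that(2)]] by simp
  have scaleT: "N p (a *\<^sub>R v, 0) = a *\<^sub>R N p (v, 0)" if "v \<in> T p" for a v p
    using linear_between_scale[OF linN inT[OF that]] by simp
  have addT': "N p (0, \<xi> + \<eta>) = N p (0, \<xi>) + N p (0, \<eta>)" if "\<xi> \<in> T' p" "\<eta> \<in> T' p" for \<xi> \<eta> p
    using linear_between_add[OF linN inT'[OF that(1)] inT'[OF that(2)]] by simp
  have scaleT': "N p (0, a *\<^sub>R \<xi>) = a *\<^sub>R N p (0, \<xi>)" if "\<xi> \<in> T' p" for a \<xi> p
    using linear_between_scale[OF linN inT'[OF that]] by simp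
  have secT: "(\<lambda>p. fst (N p (X p, 0))) \<in> \<X>" "(\<lambda>p. snd (N p (X p, 0))) \<in> \<F>" if "X \<in> \<X>" for X
    using secN[of "\<lambda>p. (X p, 0)"] that form_zero by (simp_all add: big_sections_def)
  have secT': "(\<lambda>p. fst (N p (0, \<xi> p))) \<in> \<X>" if "\<xi> \<in> \<F>" for \<xi>
    using secN[of "\<lambda>p. (0, \<xi> p)"] that field_zero by (simp_all add: big_sections_def)
  have mN0: "map_T_T A N0"
    unfolding bundle_map_def linear_between_def N0_def
    using memT by (auto simp: addT scaleT algebra_simps big_space_def mem_Times_iff
        intro!: subspace_diff[OF subspace_tangent] tangent_scale field_diff field_scale secT)
  have m\<Omega>: "map_T_Tstar A \<Omega>"
    unfolding bundle_map_def linear_between_def \<Omega>_def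
    using memT by (auto simp: addT scaleT big_space_def mem_Times_iff intro!: secT)
  have m\<Lambda>: "map_Tstar_T A \<Lambda>"
    unfolding bundle_map_def linear_between_def \<Lambda>_def
    using memT' by (auto simp: addT' scaleT' big_space_def mem_Times_iff intro!: secT')
  have z: "\<xi> 0 = 0" if "\<xi> \<in> T' p" for \<xi> p using cotangent_apply_zero[OF that] .
  have sk\<Omega>: "skew_T_Tstar A \<Omega>"
    unfolding skew_T_Tstar_def
  proof (intro allI ballI)
    fix p v w assume v: "v \<in> T p" "w \<in> T p"
    show "\<Omega> p v w = - \<Omega> p w v"
      using pair[OF inT[OF v(1)] inT[OF v(2)]] by (simp add: pairing_def \<Omega>_def)
  qed
  have sk\<Lambda>: "skew_Tstar_T A \<Lambda>"
    unfolding skew_Tstar_T_def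
  proof (intro allI ballI)
    fix p \<xi> \<eta> assume x: "\<xi> \<in> T' p" "\<eta> \<in> T' p"
    have "snd (N p (0, \<xi>)) 0 = 0" "snd (N p (0, \<eta>)) 0 = 0"
      using memT'[OF x(1)] memT'[OF x(2)] z by (auto simp: big_space_def mem_Times_iff)
    then show "\<eta> (\<Lambda> p \<xi>) = - \<xi> (\<Lambda> p \<eta>)"
      using pair[OF inT'[OF x(1)] inT'[OF x(2)]] z[OF x(1)] z[OF x(2)] by (simp add: pairing_def \<Lambda>_def)
  qed
  have \<delta>: "snd (N p (0, \<xi>)) = (c / 2) *\<^sub>R \<xi> - dual_map A N0 p \<xi>" if \<xi>: "\<xi> \<in> T' p" for p \<xi>
  proof (rule cotangent_eqI)
    show "snd (N p (0, \<xi>)) \<in> T' p" using memT'[OF \<xi>] by (simp add: big_space_def mem_Times_iff)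
    show "(c / 2) *\<^sub>R \<xi> - dual_map A N0 p \<xi> \<in> T' p"
      by (intro subspace_diff[OF subspace_cotangent] subspace_scale[OF subspace_cotangent]
          dual_map_cotangent[OF mN0] \<xi>)
    fix v assume v: "v \<in> T p"
    have "\<Omega> p v 0 = 0" using z[OF linear_between_mem[OF map_T_Tstar_linear[OF m\<Omega>] v]] .
    moreover have "\<xi> (N0 p v + (c / 2) *\<^sub>R v) = \<xi> (N0 p v) + c / 2 * \<xi> v"
      using linear_between_mem[OF map_T_T_linear[OF mN0] v]
      by (simp add: cotangent_apply_add[OF \<xi>] cotangent_apply_scale[OF \<xi>] tangent_scale v)
    ultimately show "snd (N p (0, \<xi>)) v = ((c / 2) *\<^sub>R \<xi> - dual_map A N0 p \<xi>) v"
      using pair[OF inT[OF v] inT'[OF \<xi>]] by (simp add: pairing_def NT dual_map_apply v)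
  qed
  have "N p u = block_map A c N0 \<Lambda> \<Omega> p u" if um: "u \<in> big_space A p" for p u
  proof -
    obtain v \<xi> where u: "u = (v, \<xi>)" "v \<in> T p" "\<xi> \<in> T' p"
      using um by (auto simp: big_space_def)
    have "N p u = N p (v, 0) + N p (0, \<xi>)"
      using linear_between_add[OF linN inT[OF u(2)] inT'[OF u(3)]] by (simp add: u(1))
    also have "N p (0, \<xi>) = (\<Lambda> p \<xi>, (c / 2) *\<^sub>R \<xi> - dual_map A N0 p \<xi>)"
      using \<delta>[OF u(3)] by (simp add: \<Lambda>_def prod_eq_iff)
    finally have "N p u = (N0 p v + (c / 2) *\<^sub>R v, \<Omega> p v)
        + (\<Lambda> p \<xi>, (c / 2) *\<^sub>R \<xi> - dual_map A N0 p \<xi>)" unfolding NT .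
    then show ?thesis by (simp add: block_map_def u(1) add_ac)
  qed
  with mN0 m\<Lambda> m\<Omega> sk\<Omega> sk\<Lambda> show ?thesis by blast
qed

context
  fixes c N0 \<Lambda> \<Omega> N
  assumes N0: "map_T_T A N0" and \<Lambda>: "map_Tstar_T A \<Lambda>" and \<Omega>: "map_T_Tstar A \<Omega>"
    and sk\<Omega>: "skew_T_Tstar A \<Omega>" and sk\<Lambda>: "skew_Tstar_T A \<Lambda>"
    and N: "\<And>p u. u \<in> big_space A p \<Longrightarrow> N p u = block_map A c N0 \<Lambda> \<Omega> p u"
begin

definition \<delta> :: "'m \<Rightarrow> 'm cotangent \<Rightarrow> 'm cotangent" where
  "\<delta> p \<xi> = (c / 2) *\<^sub>R \<xi> - dual_map A N0 p \<xi>"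

abbreviation "\<alpha> \<equiv> shift (c / 2) N0"

lemma block_apply:
  "v \<in> T p \<Longrightarrow> \<xi> \<in> T' p \<Longrightarrow> N p (v, \<xi>) = (\<alpha> p v + \<Lambda> p \<xi>, \<Omega> p v + \<delta> p \<xi>)"
  by (simp add: N big_space_def block_map_def shift_def \<delta>_def)

lemma \<delta>_linear: "linear_between (T' p) (T' p) (\<delta> p)"
  using dual_map_linear[OF N0, of p] subspace_cotangent[of p]
  by (auto simp: linear_between_def \<delta>_def algebra_simps subspace_diff subspace_scale)

lemma \<delta>_form: "\<xi> \<in> \<F> \<Longrightarrow> (\<lambda>p. \<delta> p (\<xi> p)) \<in> \<F>"
  unfolding \<delta>_def by (intro form_diff form_scale dual_map_form[OF N0])

lemma block_sections:
  "X \<in> \<X> \<Longrightarrow> \<xi> \<in> \<F> \<Longrightarrow> bapp N (\<lambda>p. (X p, \<xi> p))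
    = (\<lambda>p. (\<alpha> p (X p) + \<Lambda> p (\<xi> p), \<Omega> p (X p) + \<delta> p (\<xi> p)))"
  by (simp add: bapp_def block_apply field_tangent form_cotangent)

lemma block_zero: "\<Lambda> p 0 = 0" "\<delta> p 0 = 0" "\<alpha> p 0 = 0" "\<Omega> p 0 = 0"
  using linear_between_zero[OF map_Tstar_T_linear[OF \<Lambda>] subspace_cotangent]
    linear_between_zero[OF \<delta>_linear subspace_cotangent]
    linear_between_zero[OF map_T_T_linear[OF shift_map[OF N0]] subspace_tangent]
    linear_between_zero[OF map_T_Tstar_linear[OF \<Omega>] subspace_tangent] by auto

lemma block_fields: "X \<in> \<X> \<Longrightarrow> bapp N (\<lambda>p. (X p, 0)) = (\<lambda>p. (\<alpha> p (X p), \<Omega> p (X p)))"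
  using block_sections[OF _ form_zero] by (simp add: block_zero)

lemma block_forms: "\<xi> \<in> \<F> \<Longrightarrow> bapp N (\<lambda>p. (0, \<xi> p)) = (\<lambda>p. (\<Lambda> p (\<xi> p), \<delta> p (\<xi> p)))"
  using block_sections[OF field_zero] by (simp add: block_zero)

lemma block_map_big: "map_big A N"
  unfolding bundle_map_def
proof (intro conjI allI ballI)
  note l = map_T_T_linear[OF shift_map[OF N0]] map_Tstar_T_linear[OF \<Lambda>] map_T_Tstar_linear[OF \<Omega>] \<delta>_linear
  show "linear_between (big_space A p) (big_space A p) (N p)" for p
    unfolding linear_between_def
  proof (intro conjI allI ballI)
    fix u assume "u \<in> big_space A p"
    then obtain v \<xi> where u: "u = (v, \<xi>)" "v \<in> T p" "\<xi> \<in> T' p" by (auto simp: big_space_def)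
    show "N p u \<in> big_space A p"
      using l[THEN linear_between_mem] u
      by (simp add: block_apply big_space_def tangent_add subspace_add[OF subspace_cotangent])
    show "N p (r *\<^sub>R u) = r *\<^sub>R N p u" for r
      using u by (simp add: block_apply tangent_scale subspace_scale[OF subspace_cotangent]
          l[THEN linear_between_scale] scaleR_add_right)
    fix w assume "w \<in> big_space A p"
    then obtain v' \<xi>' where w: "w = (v', \<xi>')" "v' \<in> T p" "\<xi>' \<in> T' p" by (auto simp: big_space_def)
    show "N p (u + w) = N p u + N p w"
      using u w by (simp add: block_apply tangent_add subspace_add[OF subspace_cotangent]
          l[THEN linear_between_add])
  qed
  fix U assume U: "U \<in> big_sections A"
  have X: "(\<lambda>p. fst (U p)) \<in> \<X>" and \<xi>: "(\<lambda>p. snd (U p)) \<in> \<F>"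
    using U by (simp_all add: big_sections_def)
  have "(\<lambda>p. N p (U p)) = (\<lambda>p. (\<alpha> p (fst (U p)) + \<Lambda> p (snd (U p)), \<Omega> p (fst (U p)) + \<delta> p (snd (U p))))"
    using block_sections[OF X \<xi>] by (simp add: bapp_def)
  then show "(\<lambda>p. N p (U p)) \<in> big_sections A"
    using field_add[OF map_T_T_field[OF shift_map[OF N0] X] map_Tstar_T_field[OF \<Lambda> \<xi>]]
      form_add[OF map_T_Tstar_form[OF \<Omega> X] \<delta>_form[OF \<xi>]]
    by (simp add: big_section_iff)
qed

text \<open>The adjoint is \<open>c I - N\<close>.\<close>

lemma block_paired: "paired A N"
proof -
  let ?M = "\<lambda>p u. c *\<^sub>R u - N p u"
  have linN: "linear_between (big_space A p) (big_space A p) (N p)" for p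
    using block_map_big by (simp add: bundle_map_def)
  have "map_big A ?M"
    unfolding bundle_map_def
  proof (intro conjI allI ballI)
    show "linear_between (big_space A p) (big_space A p) (?M p)" for p
      using linN[of p] subspace_big[of p]
      by (auto simp: linear_between_def subspace_diff subspace_scale algebra_simps)
    fix U assume U: "U \<in> big_sections A"
    then have "(\<lambda>p. N p (U p)) \<in> big_sections A" using block_map_big by (simp add: bundle_map_def)
    with U show "(\<lambda>p. ?M p (U p)) \<in> big_sections A"
      by (simp add: big_sections_def field_diff field_scale form_diff form_scale)
  qed
  moreover have "pairing (N p u) w = pairing u (?M p w)"
    if um: "u \<in> big_space A p" and wm: "w \<in> big_space A p" for p u w
  proof -
    obtain v \<xi> where u: "u = (v, \<xi>)" "v \<in> T p" "\<xi> \<in> T' p" using um by (auto simp: big_space_def)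
    obtain v' \<xi>' where w: "w = (v', \<xi>')" "v' \<in> T p" "\<xi>' \<in> T' p" using wm by (auto simp: big_space_def)
    have mem: "N0 p x \<in> T p" "\<Lambda> p \<zeta> \<in> T p" "\<Omega> p x \<in> T' p" if "x \<in> T p" "\<zeta> \<in> T' p" for x \<zeta>
      using that linear_between_mem[OF map_T_T_linear[OF N0]] linear_between_mem[OF map_Tstar_T_linear[OF \<Lambda>]]
        linear_between_mem[OF map_T_Tstar_linear[OF \<Omega>]] by auto
    have s: "\<Omega> p v v' = - \<Omega> p v' v" "\<xi>' (\<Lambda> p \<xi>) = - \<xi> (\<Lambda> p \<xi>')"
      using sk\<Omega> sk\<Lambda> u w unfolding skew_T_Tstar_def skew_Tstar_T_def by blast+
    have e: "\<zeta> (\<alpha> p x + \<Lambda> p \<theta>) = c / 2 * \<zeta> x + \<zeta> (N0 p x) + \<zeta> (\<Lambda> p \<theta>)"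
      if "x \<in> T p" "\<zeta> \<in> T' p" "\<theta> \<in> T' p" for x \<zeta> \<theta>
      using that mem by (simp add: shift_def cotangent_apply_add[OF that(2)] cotangent_apply_scale[OF that(2)]
          tangent_add tangent_scale)
    have "pairing (N p u) w + pairing u (N p w) = c * pairing u w"
      using s u w e[OF u(2) w(3) u(3)] e[OF w(2) u(3) w(3)]
      by (simp add: pairing_def block_apply \<delta>_def dual_map_apply field_simps)
    moreover have "pairing u (?M p w) = c * pairing u w - pairing u (N p w)"
      using u w linear_between_mem[OF linN wm]
      by (auto simp: pairing_def big_space_def mem_Times_iff cotangent_apply_diff cotangent_apply_scale
          tangent_scale algebra_simps)
    ultimately show ?thesis by simp
  qed
  ultimately show ?thesis
    unfolding paired_def is_adjoint_def by (intro exI[of _ ?M] exI[of _ c]) simp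
qed

text \<open>The deformed bracket of two fields stays in \<open>TM\<close> iff \<open>K \<Omega> = 0\<close>. Granted this for all fields, the
  torsion consists of the torsion of the tangent block and of \<open>- K (\<Omega> N0)\<close>.\<close>

lemma outer_nijenhuis_tangent_iff:
  "outer_nijenhuis A N (\<lambda>p. T p \<times> {0}) \<longleftrightarrow>
    (\<forall>X\<in>\<X>. \<forall>Y\<in>\<X>. closed_defect \<Omega> X Y = 0 \<and> closed_defect (bcomp \<Omega> N0) X Y = 0 \<and>
       (\<forall>p. lie_bracket (\<lambda>q. N0 q (X q)) (\<lambda>q. N0 q (Y q)) p = N0 p (deformed_lie_bracket N0 X Y p)))"
    (is "?outer \<longleftrightarrow> ?cond")
proof -
  note am = shift_map[OF N0, of "c / 2"]
  note aX = map_T_T_field[OF am]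
  let ?D = "deformed_lie_bracket \<alpha>" and ?K = "closed_defect \<Omega>"
  have c0: "courant A (\<lambda>p. (X p, 0)) (\<lambda>p. (Y p, 0)) = (\<lambda>p. (lie_bracket X Y p, 0))"
    if X: "X \<in> \<X>" and Y: "Y \<in> \<X>" for X Y
    using courant_pair[of X "\<lambda>p. 0" Y "\<lambda>p. 0"] Cartan_zero[OF X form_zero] Cartan_zero[OF Y form_zero] by simp
  have d: "deformed_courant A N (\<lambda>p. (X p, 0)) (\<lambda>p. (Y p, 0)) = (\<lambda>p. (?D X Y p, ?K X Y p))"
    if X: "X \<in> \<X>" and Y: "Y \<in> \<X>" for X Y
    unfolding deformed_courant_def c0[OF X Y] block_fields[OF X] block_fields[OF Y]
      block_fields[OF lie_bracket_field[OF X Y]] courant_pair[where \<xi> = "\<lambda>p. 0"] courant_pair[where \<eta> = "\<lambda>p. 0"]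
    by (simp add: fun_eq_iff[where 'a = 'm and 'b = "'m tangent \<times> 'm cotangent"]
        deformed_lie_bracket_def closed_defect_def Cartan_zero[OF X form_zero] Cartan_zero[OF Y form_zero]
        Cartan_zero[OF aX[OF X] form_zero] Cartan_zero[OF aX[OF Y] form_zero])
  have t: "nijenhuis_torsion A N (\<lambda>p. (X p, 0)) (\<lambda>p. (Y p, 0)) = (\<lambda>p.
      (lie_bracket (\<lambda>q. \<alpha> q (X q)) (\<lambda>q. \<alpha> q (Y q)) p - (\<alpha> p (?D X Y p) + \<Lambda> p (?K X Y p)),
       lie_derivative A (\<lambda>q. \<alpha> q (X q)) (\<lambda>q. \<Omega> q (Y q)) p
       - interior_d A (\<lambda>q. \<alpha> q (Y q)) (\<lambda>q. \<Omega> q (X q)) p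
       - (\<Omega> p (?D X Y p) + \<delta> p (?K X Y p))))"
    if X: "X \<in> \<X>" and Y: "Y \<in> \<X>" for X Y
    unfolding nijenhuis_torsion_def d[OF X Y] block_fields[OF X] block_fields[OF Y] courant_pair
      block_sections[OF deformed_lie_bracket_field[OF am X Y] closed_defect_form[OF \<Omega> X Y]]
    by (simp add: fun_eq_iff[where 'a = 'm and 'b = "'m tangent \<times> 'm cotangent"])
  have closedness: "deformed_courant A N (\<lambda>p. (X p, 0)) (\<lambda>p. (Y p, 0)) \<in> sub_sections A (\<lambda>p. T p \<times> {0})
      \<longleftrightarrow> ?K X Y = 0" if X: "X \<in> \<X>" and Y: "Y \<in> \<X>" for X Y
    using deformed_lie_bracket_field[OF am X Y]
    by (auto simp: d[OF X Y] sub_sections_tangent fun_eq_iff[where 'a = 'm])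
  have torsion: "nijenhuis_torsion A N (\<lambda>p. (X p, 0)) (\<lambda>p. (Y p, 0)) = 0 \<longleftrightarrow>
      closed_defect (bcomp \<Omega> N0) X Y = 0 \<and>
      (\<forall>p. lie_bracket (\<lambda>q. N0 q (X q)) (\<lambda>q. N0 q (Y q)) p = N0 p (deformed_lie_bracket N0 X Y p))"
    if K: "\<And>X Y. X \<in> \<X> \<Longrightarrow> Y \<in> \<X> \<Longrightarrow> ?K X Y = 0" and X: "X \<in> \<X>" and Y: "Y \<in> \<X>" for X Y
  proof -
    have K0: "?K X Y p = 0" for p using K[OF X Y] by simp
    have second: "lie_derivative A (\<lambda>q. \<alpha> q (X q)) (\<lambda>q. \<Omega> q (Y q)) p
       - interior_d A (\<lambda>q. \<alpha> q (Y q)) (\<lambda>q. \<Omega> q (X q)) p - \<Omega> p (?D X Y p)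
       = - closed_defect (bcomp \<Omega> N0) X Y p" for p
      using closed_defect_comp[OF am \<Omega> K X Y, of p] closed_defect_shift[OF N0 \<Omega> X Y, of "c / 2" p]
      by (simp add: K0)
    have "nijenhuis_torsion A N (\<lambda>p. (X p, 0)) (\<lambda>p. (Y p, 0))
        = (\<lambda>p. (lie_bracket (\<lambda>q. N0 q (X q)) (\<lambda>q. N0 q (Y q)) p - N0 p (deformed_lie_bracket N0 X Y p),
                - closed_defect (bcomp \<Omega> N0) X Y p))"
      unfolding t[OF X Y] K0 block_zero add_0_right nijenhuis_shift[OF N0 X Y] second ..
    then show ?thesis by (auto simp: fun_eq_iff[where 'a = 'm and 'b = "'m tangent \<times> 'm cotangent"]
          fun_eq_iff[where 'a = 'm and 'b = "'m cotangent"] prod_eq_iff)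
  qed
  have ball: "(\<forall>U\<in>sub_sections A (\<lambda>p. T p \<times> {0}). Q U) \<longleftrightarrow> (\<forall>X\<in>\<X>. Q (\<lambda>p. (X p, 0)))" for Q
    unfolding sub_sections_tangent by blast
  have cc: "courant A (\<lambda>p. (X p, 0)) (\<lambda>p. (Y p, 0)) \<in> sub_sections A (\<lambda>p. T p \<times> {0})"
    if X: "X \<in> \<X>" and Y: "Y \<in> \<X>" for X Y
    using lie_bracket_field[OF X Y] by (auto simp: c0[OF X Y] sub_sections_tangent)
  have "?outer \<longleftrightarrow> (\<forall>X\<in>\<X>. \<forall>Y\<in>\<X>. ?K X Y = 0 \<and>
      nijenhuis_torsion A N (\<lambda>p. (X p, 0)) (\<lambda>p. (Y p, 0)) = 0)"
    unfolding outer_nijenhuis_def ball by (intro ball_cong refl) (simp add: cc closedness)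
  also have "\<dots> \<longleftrightarrow> ?cond"
    using torsion by blast
  finally show ?thesis .
qed

text \<open>The Courant bracket of two one-forms is 0, so only the \<open>\<Lambda>\<close>-part of \<open>N\<close> enters the deformed bracket,
  which is the bracket of one-forms. The two components of the torsion are the Hamiltonian defect
  and, since multiples of the identity cancel from \<open>\<delta>\<close>, minus the dual defect of \<open>N0\<close>.\<close>

lemma outer_nijenhuis_cotangent_iff:
  "outer_nijenhuis A N (\<lambda>p. {0} \<times> T' p) \<longleftrightarrow>
    (\<forall>\<xi>\<in>\<F>. \<forall>\<eta>\<in>\<F>. hamiltonian_defect \<Lambda> \<xi> \<eta> = 0 \<and> dual_defect \<Lambda> N0 \<xi> \<eta> = 0)"
proof -
  note LX = map_Tstar_T_field[OF \<Lambda>]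
  have c0: "courant A (\<lambda>p. (0, \<xi> p)) (\<lambda>p. (0, \<eta> p)) = (\<lambda>p. (0, 0))"
    if "\<xi> \<in> \<F>" "\<eta> \<in> \<F>" for \<xi> \<eta>
    using that by (simp add: courant_pair Cartan_zero(3,4,5)[OF field_zero])
  have N00: "bapp N (\<lambda>p. (0, 0)) = (\<lambda>p. (0, 0))"
    using block_fields[OF field_zero] by (simp add: block_zero)
  have d: "deformed_courant A N (\<lambda>p. (0, \<xi> p)) (\<lambda>p. (0, \<eta> p)) = (\<lambda>p. (0, form_bracket A \<Lambda> \<xi> \<eta> p))"
    if \<xi>: "\<xi> \<in> \<F>" and \<eta>: "\<eta> \<in> \<F>" for \<xi> \<eta>
    unfolding deformed_courant_def c0[OF \<xi> \<eta>] block_forms[OF \<xi>] block_forms[OF \<eta>] N00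
      courant_pair[where X = "\<lambda>p. 0"] courant_pair[where Y = "\<lambda>p. 0"]
    by (simp add: fun_eq_iff[where 'a = 'm and 'b = "'m tangent \<times> 'm cotangent"] form_bracket_def bapp_def
        Cartan_zero(3,4)[OF field_zero \<delta>_form[OF \<xi>]] Cartan_zero(3,4)[OF field_zero \<delta>_form[OF \<eta>]]
        Cartan_zero(5,6)[OF LX[OF \<xi>] \<xi>] Cartan_zero(5,6)[OF LX[OF \<eta>] \<xi>])
  have \<delta>_eq: "lie_derivative A (\<lambda>q. \<Lambda> q (\<xi> q)) (\<lambda>q. \<delta> q (\<eta> q)) p
       - interior_d A (\<lambda>q. \<Lambda> q (\<eta> q)) (\<lambda>q. \<delta> q (\<xi> q)) p - \<delta> p (form_bracket A \<Lambda> \<xi> \<eta> p)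
       = - dual_defect \<Lambda> N0 \<xi> \<eta> p" if \<xi>: "\<xi> \<in> \<F>" and \<eta>: "\<eta> \<in> \<F>" for \<xi> \<eta> p
    unfolding \<delta>_def lie_derivative_diff[OF LX[OF \<xi>] form_scale[OF \<eta>] dual_map_form[OF N0 \<eta>]]
      interior_d_diff[OF LX[OF \<eta>] form_scale[OF \<xi>] dual_map_form[OF N0 \<xi>]]
      lie_derivative_scale[OF LX[OF \<xi>] \<eta>] interior_d_scale[OF LX[OF \<eta>] \<xi>]
    by (simp add: dual_defect_def form_bracket_def bapp_def algebra_simps)
  have t: "nijenhuis_torsion A N (\<lambda>p. (0, \<xi> p)) (\<lambda>p. (0, \<eta> p))
      = (\<lambda>p. (hamiltonian_defect \<Lambda> \<xi> \<eta> p, - dual_defect \<Lambda> N0 \<xi> \<eta> p))"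
    if \<xi>: "\<xi> \<in> \<F>" and \<eta>: "\<eta> \<in> \<F>" for \<xi> \<eta>
    unfolding nijenhuis_torsion_def d[OF \<xi> \<eta>] block_forms[OF \<xi>] block_forms[OF \<eta>] courant_pair
      block_forms[OF form_bracket_form[OF \<Lambda> \<xi> \<eta>]]
    using \<delta>_eq[OF \<xi> \<eta>]
    by (simp add: fun_eq_iff[where 'a = 'm and 'b = "'m tangent \<times> 'm cotangent"] hamiltonian_defect_def)
  have torsion: "nijenhuis_torsion A N (\<lambda>p. (0, \<xi> p)) (\<lambda>p. (0, \<eta> p)) = 0 \<longleftrightarrow>
      hamiltonian_defect \<Lambda> \<xi> \<eta> = 0 \<and> dual_defect \<Lambda> N0 \<xi> \<eta> = 0"
    if \<xi>: "\<xi> \<in> \<F>" and \<eta>: "\<eta> \<in> \<F>" for \<xi> \<eta>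
    by (auto simp: t[OF \<xi> \<eta>] fun_eq_iff[where 'a = 'm and 'b = "'m tangent \<times> 'm cotangent"]
        fun_eq_iff[where 'a = 'm and 'b = "'m cotangent"] fun_eq_iff[where 'a = 'm and 'b = "'m tangent"]
        prod_eq_iff)
  have ball: "(\<forall>U\<in>sub_sections A (\<lambda>p. {0} \<times> T' p). Q U) \<longleftrightarrow> (\<forall>\<xi>\<in>\<F>. Q (\<lambda>p. (0, \<xi> p)))" for Q
    unfolding sub_sections_cotangent by blast
  have "(\<lambda>p. (0, 0)) \<in> sub_sections A (\<lambda>p. {0} \<times> T' p)"
    using form_zero by (auto simp: sub_sections_cotangent)
  moreover have "deformed_courant A N (\<lambda>p. (0, \<xi> p)) (\<lambda>p. (0, \<eta> p)) \<in> sub_sections A (\<lambda>p. {0} \<times> T' p)"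
    if \<xi>: "\<xi> \<in> \<F>" and \<eta>: "\<eta> \<in> \<F>" for \<xi> \<eta>
    using form_bracket_form[OF \<Lambda> \<xi> \<eta>] by (auto simp: d[OF \<xi> \<eta>] sub_sections_cotangent)
  ultimately have "outer_nijenhuis A N (\<lambda>p. {0} \<times> T' p) \<longleftrightarrow> (\<forall>\<xi>\<in>\<F>. \<forall>\<eta>\<in>\<F>.
      nijenhuis_torsion A N (\<lambda>p. (0, \<xi> p)) (\<lambda>p. (0, \<eta> p)) = 0)"
    unfolding outer_nijenhuis_def ball by (intro ball_cong refl) (simp add: c0)
  also have "\<dots> \<longleftrightarrow> (\<forall>\<xi>\<in>\<F>. \<forall>\<eta>\<in>\<F>. hamiltonian_defect \<Lambda> \<xi> \<eta> = 0 \<and> dual_defect \<Lambda> N0 \<xi> \<eta> = 0)"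
    by (intro ball_cong refl torsion)
  finally show ?thesis .
qed

lemma block_nijenhuis_iff:
  "lie_bialgebroid_nijenhuis A N \<longleftrightarrow>
     nijenhuis_tensor A N0 \<and> presymplectic_nijenhuis A N0 \<Omega> \<and> poisson_nijenhuis A N0 \<Lambda>"
  unfolding lie_bialgebroid_nijenhuis_def outer_nijenhuis_tangent_iff outer_nijenhuis_cotangent_iff
    presymplectic_nijenhuis_def closed_two_form_iff[OF \<Omega>] closed_two_form_iff[OF bcomp_map_T_Tstar[OF \<Omega> N0]]
    poisson_nijenhuis_iff[OF \<Lambda> sk\<Lambda> N0]
  using block_map_big block_paired nijenhuis_tensor_iff[of N0] N0 by blast

end

end

section \<open>The classification\<close>

theorem theorem10:
  fixes A :: "('m::{t2_space,second_countable_topology}, 'e::real_inner) chart set"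
    and N :: "'m \<Rightarrow> 'm tangent \<times> 'm cotangent \<Rightarrow> 'm tangent \<times> 'm cotangent"
  assumes "smooth_manifold A"
  shows "lie_bialgebroid_nijenhuis A N \<longleftrightarrow>
    (\<exists>(c::real) N0 \<Lambda> \<Omega>.
       nijenhuis_tensor A N0 \<and> presymplectic_nijenhuis A N0 \<Omega> \<and> poisson_nijenhuis A N0 \<Lambda> \<and>
       (\<forall>p. \<forall>u\<in>big_space A p. N p u = block_map A c N0 \<Lambda> \<Omega> p u))"
proof -
  interpret smooth_frames A by (rule smooth_manifold_frames[OF assms])
  show ?thesis
  proof
    assume N: "lie_bialgebroid_nijenhuis A N"
    then obtain c N0 \<Lambda> \<Omega> where b: "map_T_T A N0" "map_Tstar_T A \<Lambda>" "map_T_Tstar A \<Omega>"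
        "skew_T_Tstar A \<Omega>" "skew_Tstar_T A \<Lambda>"
        "\<And>p u. u \<in> big_space A p \<Longrightarrow> N p u = block_map A c N0 \<Lambda> \<Omega> p u"
      using paired_blocks[of N] unfolding lie_bialgebroid_nijenhuis_def by blast
    then show "\<exists>c N0 \<Lambda> \<Omega>. nijenhuis_tensor A N0 \<and> presymplectic_nijenhuis A N0 \<Omega> \<and>
        poisson_nijenhuis A N0 \<Lambda> \<and> (\<forall>p. \<forall>u\<in>big_space A p. N p u = block_map A c N0 \<Lambda> \<Omega> p u)"
      using block_nijenhuis_iff[OF b] N by blast
  next
    assume "\<exists>c N0 \<Lambda> \<Omega>. nijenhuis_tensor A N0 \<and> presymplectic_nijenhuis A N0 \<Omega> \<and>
        poisson_nijenhuis A N0 \<Lambda> \<and> (\<forall>p. \<forall>u\<in>big_space A p. N p u = block_map A c N0 \<Lambda> \<Omega> p u)"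
    then obtain c N0 \<Lambda> \<Omega> where s: "nijenhuis_tensor A N0" "presymplectic_nijenhuis A N0 \<Omega>"
        "poisson_nijenhuis A N0 \<Lambda>" and
        N: "\<And>p u. u \<in> big_space A p \<Longrightarrow> N p u = block_map A c N0 \<Lambda> \<Omega> p u" by blast
    have "map_T_T A N0" "map_Tstar_T A \<Lambda>" "map_T_Tstar A \<Omega>" "skew_T_Tstar A \<Omega>" "skew_Tstar_T A \<Lambda>"
      using s by (simp_all add: nijenhuis_tensor_def presymplectic_nijenhuis_def closed_two_form_def
          poisson_nijenhuis_def poisson_tensor_def)
    from block_nijenhuis_iff[OF this N] s show "lie_bialgebroid_nijenhuis A N" by blast
  qed
qed

end
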